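(* Let $P$ be a finite dimensional Poisson algebra over a field $k$ with basis $\{e_1,\dots,e_n\}$ and let $U\bigl(G(\mathcal{P}(P)^{\mathrm{o}})\bigr)$ be the group of all invertible group-like elements of the finite dual $\mathcal{P}(P)^{\mathrm{o}}$. Then the map $$\overline{\gamma}\colon U\bigl(G(\mathcal{P}(P)^{\mathrm{o}})\bigr)\to \mathrm{Aut}_{\mathrm{Poiss}}(P),\qquad \overline{\gamma}(\theta)(e_i):=\sum_{s=1}^n\theta(x_{si})\,e_s,$$ defined for all $\theta\in U\bigl(G(\mathcal{P}(P)^{\mathrm{o}})\bigr)$ and $i=1,\dots,n$, is an isomorphism of groups.
   Context: All vector spaces, algebras and tensor products are over an arbitrary field $k$. A Poisson algebra is a vector space $P$ which is both an associative commutative (not necessarily unital) algebra and a Lie algebra such that $[x, yz] = [x,y]z + y[x,z]$ for all $x,y,z$. Morphisms of Poisson algebras are linear maps that are both algebra and Lie algebra homomorphisms; $\mathrm{Aut}_{\mathrm{Poiss}}(P)$ is the group of Poisson algebra automorphisms of $P$ under composition. Write $e_ie_j=\sum_s\tau_{i,j}^se_s$ and $[e_i,e_j]=\sum_s\mu_{i,j}^se_s$. $\mathcal{P}(P)$ is the unital commutative algebra generated by $x_{si}$ ($s,i=1,\dots,n$) subject to the relations $\sum_{u=1}^n\tau_{i,j}^ux_{au}=\sum_{s,t=1}^n\tau_{s,t}^ax_{si}x_{tj}$ and $\sum_{u=1}^n\mu_{i,j}^ux_{au}=\sum_{s,t=1}^n\mu_{s,t}^ax_{si}x_{tj}$ for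 all $a,i,j=1,\dots,n$. It is a bialgebra with $\Delta(x_{ij})=\sum_{s=1}^nx_{is}\otimes x_{sj}$ and $\varepsilon(x_{ij})=\delta_{i,j}$. For a bialgebra $H$, $H^{\mathrm{o}}$ denotes its finite dual bialgebra and, for a coalgebra $C$, $G(C)=\{x\in C\mid\Delta(x)=x\otimes x,\ \varepsilon(x)=1\}$. It is well known that $G(H^{\mathrm{o}})=\mathrm{Hom}_{\mathrm{Alg}_k}(H,k)$, the set of unital algebra homomorphisms $H\to k$; this is a monoid under the convolution product $(\theta_1\star\theta_2)(h)=\sum\theta_1(h_{(1)})\theta_2(h_{(2)})$ with unit $\varepsilon$. $U(-)$ denotes the group of invertible elements of a monoid. *)

theory Defs
  imports Complex_Main "HOL-Algebra.QuotRing" "HOL-Algebra.Module" "HOL-Library.Poly_Mapping"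
begin

section \<open>Poisson algebras\<close>

text \<open>The associative product need not be unital; the bracket is alternating, so the definition
  is correct in every characteristic.\<close>

locale poisson_algebra = vector_space scale
  for scale :: "'k::field \<Rightarrow> 'p::ab_group_add \<Rightarrow> 'p" +
  fixes pmult :: "'p \<Rightarrow> 'p \<Rightarrow> 'p" and bracket :: "'p \<Rightarrow> 'p \<Rightarrow> 'p"
  assumes pmult_linear_left: "Vector_Spaces.linear scale scale (\<lambda>x. pmult x y)"
    and pmult_linear_right: "Vector_Spaces.linear scale scale (\<lambda>y. pmult x y)"
    and pmult_assoc: "pmult (pmult x y) z = pmult x (pmult y z)"
    and pmult_commute: "pmult x y = pmult y x"
    and bracket_linear_left: "Vector_Spaces.linear scale scale (\<lambda>x. bracket x y)"
    and bracket_linear_right: "Vector_Spaces.linear scale scale (\<lambda>y. bracket x y)"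
    and bracket_alternating: "bracket x x = 0"
    and jacobi: "bracket x (bracket y z) + bracket y (bracket z x) + bracket z (bracket x y) = 0"
    and leibniz: "bracket x (pmult y z) = pmult (bracket x y) z + pmult y (bracket x z)"

definition poisson_aut_group ::
  "('k::field \<Rightarrow> 'p::ab_group_add \<Rightarrow> 'p) \<Rightarrow> ('p \<Rightarrow> 'p \<Rightarrow> 'p) \<Rightarrow> ('p \<Rightarrow> 'p \<Rightarrow> 'p) \<Rightarrow> ('p \<Rightarrow> 'p) monoid" where
  "poisson_aut_group scale pmult bracket =
     \<lparr>carrier = {f. Vector_Spaces.linear scale scale f \<and> bij f \<and>
                    (\<forall>x y. f (pmult x y) = pmult (f x) (f y)) \<and>
                    (\<forall>x y. f (bracket x y) = bracket (f x) (f y))},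
      monoid.mult = (\<circ>), one = id\<rparr>"

definition indexed_basis :: "('k::field \<Rightarrow> 'p::ab_group_add \<Rightarrow> 'p) \<Rightarrow> nat \<Rightarrow> (nat \<Rightarrow> 'p) \<Rightarrow> bool" where
  "indexed_basis scale n e \<longleftrightarrow>
     inj_on e {1..n} \<and> \<not> Modules.module.dependent scale (e ` {1..n}) \<and>
     Modules.module.span scale (e ` {1..n}) = UNIV"

text \<open>The linear map with prescribed values \<open>w i\<close> on the basis vectors \<open>e i\<close>.\<close>

definition linear_extension ::
  "('k::field \<Rightarrow> 'p::ab_group_add \<Rightarrow> 'p) \<Rightarrow> nat \<Rightarrow> (nat \<Rightarrow> 'p) \<Rightarrow> (nat \<Rightarrow> 'p) \<Rightarrow> 'p \<Rightarrow> 'p" where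
  "linear_extension scale n e w =
     (THE g. Vector_Spaces.linear scale scale g \<and> (\<forall>i\<in>{1..n}. g (e i) = w i))"


section \<open>Algebras over a field, quotients and tensor products\<close>

text \<open>The ground field is the type class \<open>field\<close>.  A unital \<open>'k\<close>-algebra is a record of type
  \<open>('k, 'a) module\<close>, which carries \<open>\<otimes>\<close>, \<open>\<one>\<close>, \<open>\<oplus>\<close>, \<open>\<zero>\<close> and \<open>\<odot>\<close>.\<close>

definition ground_algebra :: "('k::field, 'k) module" where
  "ground_algebra =
     \<lparr>carrier = UNIV, monoid.mult = (*), one = 1, zero = 0, add = (+), smult = (*)\<rparr>"

text \<open>Homomorphisms of unital algebras, as extensional functions (\<open>undefined\<close> off the carrier),
  so that two of them are equal as soon as they agree on the carrier.\<close>

definition alg_hom ::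
  "('k::field, 'a, 'x) module_scheme \<Rightarrow> ('k, 'b, 'y) module_scheme \<Rightarrow> ('a \<Rightarrow> 'b) set" where
  "alg_hom A B = {f \<in> ring_hom A B \<inter> extensional (carrier A).
                    \<forall>c. \<forall>x\<in>carrier A. f (c \<odot>\<^bsub>A\<^esub> x) = c \<odot>\<^bsub>B\<^esub> f x}"

definition quotient_algebra ::
  "('k::field, 'a, 'x) module_scheme \<Rightarrow> 'a set \<Rightarrow> ('k, 'a set) module" where
  "quotient_algebra A I =
     \<lparr>carrier = carrier (A Quot I), monoid.mult = monoid.mult (A Quot I), one = one (A Quot I),
      zero = zero (A Quot I), add = add (A Quot I),
      smult = (\<lambda>c X. \<Union>x\<in>X. I +>\<^bsub>A\<^esub> (c \<odot>\<^bsub>A\<^esub> x))\<rparr>"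

definition pm_scale :: "'k::field \<Rightarrow> ('b \<Rightarrow>\<^sub>0 'k) \<Rightarrow> 'b \<Rightarrow>\<^sub>0 'k" where
  "pm_scale c p = Poly_Mapping.map (\<lambda>a. c * a) p"

text \<open>The vector space with basis \<open>carrier V \<times> carrier W\<close>, with the product that is componentwise
  on basis elements.\<close>

definition free_pair_algebra ::
  "('k::field, 'v, 'x) module_scheme \<Rightarrow> ('k, 'w, 'y) module_scheme \<Rightarrow> ('k, ('v \<times> 'w) \<Rightarrow>\<^sub>0 'k) module" where
  "free_pair_algebra V W =
     \<lparr>carrier = {p. Poly_Mapping.keys p \<subseteq> carrier V \<times> carrier W},
      monoid.mult = (\<lambda>p q. \<Sum>a\<in>Poly_Mapping.keys p. \<Sum>b\<in>Poly_Mapping.keys q.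
        Poly_Mapping.single (fst a \<otimes>\<^bsub>V\<^esub> fst b, snd a \<otimes>\<^bsub>W\<^esub> snd b)
          (Poly_Mapping.lookup p a * Poly_Mapping.lookup q b)),
      one = Poly_Mapping.single (\<one>\<^bsub>V\<^esub>, \<one>\<^bsub>W\<^esub>) 1,
      zero = 0, add = (+), smult = pm_scale\<rparr>"

definition tensor_relations ::
  "('k::field, 'v, 'x) module_scheme \<Rightarrow> ('k, 'w, 'y) module_scheme \<Rightarrow> (('v \<times> 'w) \<Rightarrow>\<^sub>0 'k) set" where
  "tensor_relations V W = Modules.module.span pm_scale
     ({Poly_Mapping.single (v \<oplus>\<^bsub>V\<^esub> v', w) 1 - Poly_Mapping.single (v, w) 1 - Poly_Mapping.single (v', w) 1
         | v v' w. v \<in> carrier V \<and> v' \<in> carrier V \<and> w \<in> carrier W} \<union>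
      {Poly_Mapping.single (v, w \<oplus>\<^bsub>W\<^esub> w') 1 - Poly_Mapping.single (v, w) 1 - Poly_Mapping.single (v, w') 1
         | v w w'. v \<in> carrier V \<and> w \<in> carrier W \<and> w' \<in> carrier W} \<union>
      {Poly_Mapping.single (c \<odot>\<^bsub>V\<^esub> v, w) 1 - Poly_Mapping.single (v, w) c
         | c v w. v \<in> carrier V \<and> w \<in> carrier W} \<union>
      {Poly_Mapping.single (v, c \<odot>\<^bsub>W\<^esub> w) 1 - Poly_Mapping.single (v, w) c
         | c v w. v \<in> carrier V \<and> w \<in> carrier W})"

definition tensor_algebra ::
  "('k::field, 'v, 'x) module_scheme \<Rightarrow> ('k, 'w, 'y) module_scheme \<Rightarrow>
     ('k, (('v \<times> 'w) \<Rightarrow>\<^sub>0 'k) set) module" where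
  "tensor_algebra V W = quotient_algebra (free_pair_algebra V W) (tensor_relations V W)"

definition pure_tensor ::
  "('k::field, 'v, 'x) module_scheme \<Rightarrow> ('k, 'w, 'y) module_scheme \<Rightarrow> 'v \<Rightarrow> 'w \<Rightarrow>
     (('v \<times> 'w) \<Rightarrow>\<^sub>0 'k) set" where
  "pure_tensor V W v w =
     tensor_relations V W +>\<^bsub>free_pair_algebra V W\<^esub> Poly_Mapping.single (v, w) 1"

text \<open>The value at a tensor of the linear functional induced by a bilinear form \<open>\<phi>\<close>, that is
  \<open>\<Sum>i. v\<^sub>i \<otimes> w\<^sub>i \<mapsto> \<Sum>i. \<phi> v\<^sub>i w\<^sub>i\<close>; it does not depend on the representative.\<close>

definition tensor_eval :: "('v \<Rightarrow> 'w \<Rightarrow> 'k::field) \<Rightarrow> (('v \<times> 'w) \<Rightarrow>\<^sub>0 'k) set \<Rightarrow> 'k" where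
  "tensor_eval \<phi> t = the_elem
     ((\<lambda>p. \<Sum>a\<in>Poly_Mapping.keys p. Poly_Mapping.lookup p a * \<phi> (fst a) (snd a)) ` t)"


section \<open>Bialgebras, group-like elements and the finite dual\<close>

record (overloaded) ('k::zero, 'h) bialgebra = "('k, 'h) module" +
  comult :: "'h \<Rightarrow> (('h \<times> 'h) \<Rightarrow>\<^sub>0 'k) set"
  counit :: "'h \<Rightarrow> 'k"

text \<open>The monoid \<open>G(C)\<close>, with the product inherited from the algebra structure.\<close>

definition group_likes :: "('k::field, 'c) bialgebra \<Rightarrow> 'c monoid" where
  "group_likes C =
     \<lparr>carrier = {x \<in> carrier C. comult C x = pure_tensor C C x x \<and> counit C x = 1},
      monoid.mult = monoid.mult C, one = one C\<rparr>"

definition linear_functionals :: "('k::field, 'h, 'x) module_scheme \<Rightarrow> ('h \<Rightarrow> 'k) set" where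
  "linear_functionals H = {f \<in> extensional (carrier H).
     (\<forall>x\<in>carrier H. \<forall>y\<in>carrier H. f (x \<oplus>\<^bsub>H\<^esub> y) = f x + f y) \<and>
     (\<forall>c. \<forall>x\<in>carrier H. f (c \<odot>\<^bsub>H\<^esub> x) = c * f x)}"

definition finite_codimension :: "('k::field, 'h, 'x) module_scheme \<Rightarrow> 'h set \<Rightarrow> bool" where
  "finite_codimension H I \<longleftrightarrow>
     (\<exists>B. finite B \<and> B \<subseteq> carrier H \<and>
        (\<forall>h\<in>carrier H. \<exists>c. h \<ominus>\<^bsub>H\<^esub> (\<Oplus>\<^bsub>H\<^esub>b\<in>B. c b \<odot>\<^bsub>H\<^esub> b) \<in> I))"

text \<open>The finite dual consists of the functionals vanishing on an ideal of finite codimension; its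
  product is the convolution \<open>(f \<star> g)(h) = \<Sum> f(h\<^sub>1) g(h\<^sub>2)\<close>.\<close>

definition finite_dual_algebra :: "('k::field, 'h) bialgebra \<Rightarrow> ('k, 'h \<Rightarrow> 'k) module" where
  "finite_dual_algebra H =
     \<lparr>carrier = {f \<in> linear_functionals H.
                   \<exists>I. ideal I H \<and> finite_codimension H I \<and> (\<forall>x\<in>I. f x = 0)},
      monoid.mult = (\<lambda>f g. \<lambda>h\<in>carrier H. tensor_eval (\<lambda>a b. f a * g b) (comult H h)),
      one = (\<lambda>h\<in>carrier H. counit H h),
      zero = (\<lambda>h\<in>carrier H. 0),
      add = (\<lambda>f g. \<lambda>h\<in>carrier H. f h + g h),
      smult = (\<lambda>c f. \<lambda>h\<in>carrier H. c * f h)\<rparr>"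

text \<open>The comultiplication of the finite dual is the transpose of the multiplication: it sends \<open>f\<close>
  to the tensor \<open>\<Sum>i. f\<^sub>i \<otimes> g\<^sub>i\<close> of elements of the finite dual for which
  \<open>f (a b) = \<Sum>i. f\<^sub>i a * g\<^sub>i b\<close>.\<close>

definition finite_dual :: "('k::field, 'h) bialgebra \<Rightarrow> ('k, 'h \<Rightarrow> 'k) bialgebra" where
  "finite_dual H = module.extend (finite_dual_algebra H)
     (bialgebra.fields
        (\<lambda>f. THE t. t \<in> carrier (tensor_algebra (finite_dual_algebra H) (finite_dual_algebra H)) \<and>
           (\<forall>a\<in>carrier H. \<forall>b\<in>carrier H. tensor_eval (\<lambda>u v. u a * v b) t = f (a \<otimes>\<^bsub>H\<^esub> b)))
        (\<lambda>f. f \<one>\<^bsub>H\<^esub>))"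


section \<open>The universal bialgebra of a Poisson algebra\<close>

text \<open>Polynomials over \<open>'k\<close> in the variables from \<open>V\<close>: a polynomial is a finitely supported
  function on monomials, a monomial being a finitely supported exponent function.\<close>

definition polynomial_algebra :: "'v set \<Rightarrow> ('k::field, ('v \<Rightarrow>\<^sub>0 nat) \<Rightarrow>\<^sub>0 'k) module" where
  "polynomial_algebra V =
     \<lparr>carrier = {p. \<forall>m\<in>Poly_Mapping.keys p. Poly_Mapping.keys m \<subseteq> V},
      monoid.mult = (*), one = 1, zero = 0, add = (+), smult = pm_scale\<rparr>"

definition poly_var :: "'v \<Rightarrow> ('v \<Rightarrow>\<^sub>0 nat) \<Rightarrow>\<^sub>0 'k::field" where
  "poly_var v = Poly_Mapping.single (Poly_Mapping.single v 1) 1"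

text \<open>The relations for one bilinear operation with structure constants \<open>\<tau> i j s\<close> (the
  coefficient of \<open>e s\<close> in the product of \<open>e i\<close> and \<open>e j\<close>); the variable \<open>x\<^sub>s\<^sub>i\<close> is indexed by
  the pair \<open>(s, i)\<close>.\<close>

definition structure_relations ::
  "nat \<Rightarrow> (nat \<Rightarrow> nat \<Rightarrow> nat \<Rightarrow> 'k::field) \<Rightarrow> ((nat \<times> nat \<Rightarrow>\<^sub>0 nat) \<Rightarrow>\<^sub>0 'k) set" where
  "structure_relations n \<tau> =
     {(\<Sum>u=1..n. pm_scale (\<tau> i j u) (poly_var (a, u))) -
      (\<Sum>s=1..n. \<Sum>t=1..n. pm_scale (\<tau> s t a) (poly_var (s, i) * poly_var (t, j)))
      | a i j. a \<in> {1..n} \<and> i \<in> {1..n} \<and> j \<in> {1..n}}"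

definition poisson_ideal ::
  "nat \<Rightarrow> (nat \<Rightarrow> nat \<Rightarrow> nat \<Rightarrow> 'k::field) \<Rightarrow> (nat \<Rightarrow> nat \<Rightarrow> nat \<Rightarrow> 'k) \<Rightarrow>
     ((nat \<times> nat \<Rightarrow>\<^sub>0 nat) \<Rightarrow>\<^sub>0 'k) set" where
  "poisson_ideal n \<tau> \<mu> =
     genideal (polynomial_algebra ({1..n} \<times> {1..n})) (structure_relations n \<tau> \<union> structure_relations n \<mu>)"

definition universal_algebra ::
  "nat \<Rightarrow> (nat \<Rightarrow> nat \<Rightarrow> nat \<Rightarrow> 'k::field) \<Rightarrow> (nat \<Rightarrow> nat \<Rightarrow> nat \<Rightarrow> 'k) \<Rightarrow>
     ('k, ((nat \<times> nat \<Rightarrow>\<^sub>0 nat) \<Rightarrow>\<^sub>0 'k) set) module" where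
  "universal_algebra n \<tau> \<mu> =
     quotient_algebra (polynomial_algebra ({1..n} \<times> {1..n})) (poisson_ideal n \<tau> \<mu>)"

definition gen ::
  "nat \<Rightarrow> (nat \<Rightarrow> nat \<Rightarrow> nat \<Rightarrow> 'k::field) \<Rightarrow> (nat \<Rightarrow> nat \<Rightarrow> nat \<Rightarrow> 'k) \<Rightarrow> nat \<Rightarrow> nat \<Rightarrow>
     ((nat \<times> nat \<Rightarrow>\<^sub>0 nat) \<Rightarrow>\<^sub>0 'k) set" where
  "gen n \<tau> \<mu> s i =
     poisson_ideal n \<tau> \<mu> +>\<^bsub>polynomial_algebra ({1..n} \<times> {1..n})\<^esub> poly_var (s, i)"

text \<open>The comultiplication and the counit are the unital algebra homomorphisms with the given values
  on the generators.\<close>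

definition universal_bialgebra ::
  "nat \<Rightarrow> (nat \<Rightarrow> nat \<Rightarrow> nat \<Rightarrow> 'k::field) \<Rightarrow> (nat \<Rightarrow> nat \<Rightarrow> nat \<Rightarrow> 'k) \<Rightarrow>
     ('k, ((nat \<times> nat \<Rightarrow>\<^sub>0 nat) \<Rightarrow>\<^sub>0 'k) set) bialgebra" where
  "universal_bialgebra n \<tau> \<mu> =
     (let A = universal_algebra n \<tau> \<mu>; x = gen n \<tau> \<mu> in
      module.extend A
        (bialgebra.fields
          (THE D. D \<in> alg_hom A (tensor_algebra A A) \<and>
             (\<forall>i\<in>{1..n}. \<forall>j\<in>{1..n}.
                D (x i j) = (\<Oplus>\<^bsub>tensor_algebra A A\<^esub>s\<in>{1..n}. pure_tensor A A (x i s) (x s j))))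
          (THE E. E \<in> alg_hom A ground_algebra \<and>
             (\<forall>i\<in>{1..n}. \<forall>j\<in>{1..n}. E (x i j) = (if i = j then 1 else 0)))))"

definition invertible_group_likes ::
  "nat \<Rightarrow> (nat \<Rightarrow> nat \<Rightarrow> nat \<Rightarrow> 'k::field) \<Rightarrow> (nat \<Rightarrow> nat \<Rightarrow> nat \<Rightarrow> 'k) \<Rightarrow>
     (((nat \<times> nat \<Rightarrow>\<^sub>0 nat) \<Rightarrow>\<^sub>0 'k) set \<Rightarrow> 'k) monoid" where
  "invertible_group_likes n \<tau> \<mu> =
     units_of (group_likes (finite_dual (universal_bialgebra n \<tau> \<mu>)))"

definition gamma_bar ::
  "('k::field \<Rightarrow> 'p::ab_group_add \<Rightarrow> 'p) \<Rightarrow> nat \<Rightarrow> (nat \<Rightarrow> 'p) \<Rightarrow>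
     (nat \<Rightarrow> nat \<Rightarrow> nat \<Rightarrow> 'k) \<Rightarrow> (nat \<Rightarrow> nat \<Rightarrow> nat \<Rightarrow> 'k) \<Rightarrow>
     (((nat \<times> nat \<Rightarrow>\<^sub>0 nat) \<Rightarrow>\<^sub>0 'k) set \<Rightarrow> 'k) \<Rightarrow> 'p \<Rightarrow> 'p" where
  "gamma_bar scale n e \<tau> \<mu> \<theta> =
     linear_extension scale n e (\<lambda>i. \<Sum>s=1..n. scale (\<theta> (gen n \<tau> \<mu> s i)) (e s))"

end

theory Submission
  imports Defs
begin

text \<open>
  The matrix \<open>(\<theta> x\<^sub>s\<^sub>i)\<close> of an algebra map \<open>\<theta> : \<P>(P) \<rightarrow> k\<close> satisfies the defining relations of \<open>\<P>(P)\<close>, and for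
  a linear endomorphism of \<open>P\<close> these relations say exactly that it respects the product and the
  bracket.  So \<open>\<theta> \<mapsto> \<gamma>(\<theta>)\<close> is a bijection from algebra maps to Poisson endomorphisms; since
  \<open>\<Delta> x\<^sub>i\<^sub>j = \<Sum> x\<^sub>i\<^sub>s \<otimes> x\<^sub>s\<^sub>j\<close>, convolution becomes matrix multiplication, that is, composition, and
  units correspond to automorphisms.  Group-likes of \<open>H\<^sup>o\<close> are the algebra maps because the
  comultiplication of \<open>H\<^sup>o\<close> is determined by \<open>f (a b) = \<Sum> f\<^sub>i a * g\<^sub>i b\<close>: such a decomposition exists for
  a functional vanishing on a cofinite ideal, and \<open>H\<^sup>o \<otimes> H\<^sup>o\<close> embeds into the bilinear forms on \<open>H\<close>.
\<close>

section \<open>Commutative algebras over a field\<close>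

text \<open>The comultiplication and counit of \<open>universal_bialgebra\<close>, the
  comultiplication of \<open>finite_dual\<close> and \<open>linear_extension\<close> are definite
  descriptions, so nothing can be said about them before unique existence is proved. For \<Delta>
  the point is that the product of two matrices satisfying the relations, with entries in the two
  tensor factors, satisfies them again; this is the coordinate form of composing two endomorphisms.
  For the finite dual the obstacle is that different functionals vanish on different ideals:
  membership is therefore tested by whether the form (a, b) \<mapsto> f (a b) has finite rank, a
  condition that visibly passes to sums. The monoid laws of the group-like elements are pulled back
  along the injective map \<gamma> from composition of functions.\<close>

lemma cring_cong:
  assumes "cring R"
    and "carrier S = carrier R" "monoid.mult S = monoid.mult R" "one S = one R"
    and "zero S = zero R" "add S = add R"
  shows "cring S"
proof -
  interpret cring R by (fact assms(1))
  show ?thesis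
  proof (rule cringI)
    show "abelian_group S"
    proof (rule abelian_groupI)
      show "\<exists>y\<in>carrier S. y \<oplus>\<^bsub>S\<^esub> x = \<zero>\<^bsub>S\<^esub>" if "x \<in> carrier S" for x
        using that l_neg[of x] a_inv_closed[of x] by (auto simp: assms)
    qed (simp_all add: assms a_assoc a_comm add.m_lcomm)
    show "Group.comm_monoid S"
      by (rule comm_monoidI) (simp_all add: assms m_assoc m_comm m_lcomm)
  qed (simp_all add: assms l_distr)
qed

text \<open>The scalars are the elements of the type \<open>'k\<close>, not the carrier of a ring
  record, so the module axioms are stated with type-class operations on scalars and record
  operations on vectors.\<close>

locale comm_algebra = cring A
  for A :: "('k::field, 'a, 'x) module_scheme" (structure) +
  assumes smult_closed [simp, intro]: "x \<in> carrier A \<Longrightarrow> c \<odot> x \<in> carrier A"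
    and smult_l_distr: "x \<in> carrier A \<Longrightarrow> (c + d) \<odot> x = c \<odot> x \<oplus> d \<odot> x"
    and smult_r_distr: "x \<in> carrier A \<Longrightarrow> y \<in> carrier A \<Longrightarrow> c \<odot> (x \<oplus> y) = c \<odot> x \<oplus> c \<odot> y"
    and smult_assoc1: "x \<in> carrier A \<Longrightarrow> (c * d) \<odot> x = c \<odot> (d \<odot> x)"
    and smult_one [simp]: "x \<in> carrier A \<Longrightarrow> 1 \<odot> x = x"
    and smult_assoc2: "x \<in> carrier A \<Longrightarrow> y \<in> carrier A \<Longrightarrow> (c \<odot> x) \<otimes> y = c \<odot> (x \<otimes> y)"
begin

lemma smult_zero_left [simp]: "x \<in> carrier A \<Longrightarrow> 0 \<odot> x = \<zero>"
  using smult_l_distr[of x 0 0] by (metis add.l_cancel_one add_0 smult_closed)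

lemma smult_zero_right [simp]: "c \<odot> \<zero> = \<zero>"
  using smult_r_distr[of \<zero> \<zero> c] by (metis add.l_cancel_one l_zero smult_closed zero_closed)

lemma smult_uminus:
  assumes "x \<in> carrier A"
  shows "(- c) \<odot> x = \<ominus> (c \<odot> x)"
  by (rule minus_equality[symmetric]) (use assms in \<open>simp_all add: smult_l_distr[symmetric]\<close>)

lemma smult_assoc2_right: "x \<in> carrier A \<Longrightarrow> y \<in> carrier A \<Longrightarrow> x \<otimes> (c \<odot> y) = c \<odot> (x \<otimes> y)"
  by (metis m_comm smult_assoc2 smult_closed)

text \<open>Scaling is multiplication by an element of the algebra; for this reason ring ideals are
  subspaces, see \<open>ideal_smult_closed\<close>.\<close>

lemma smult_eq_mult_one: "x \<in> carrier A \<Longrightarrow> c \<odot> x = (c \<odot> \<one>) \<otimes> x"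
  by (simp add: smult_assoc2)

lemma smult_mult_smult:
  assumes "x \<in> carrier A" "y \<in> carrier A"
  shows "(c \<odot> x) \<otimes> (d \<odot> y) = (c * d) \<odot> (x \<otimes> y)"
  using assms by (simp add: smult_assoc2 smult_assoc2_right mult.commute flip: smult_assoc1)

lemma smult_finsum:
  "f \<in> S \<rightarrow> carrier A \<Longrightarrow> c \<odot> (\<Oplus>i\<in>S. f i) = (\<Oplus>i\<in>S. c \<odot> f i)"
proof (induction S rule: infinite_finite_induct)
  case (insert x S)
  then show ?case
    by (auto simp: finsum_insert Pi_iff smult_r_distr)
qed auto

lemma finsum_swap:
  assumes "finite S" "finite T" "\<And>i j. i \<in> S \<Longrightarrow> j \<in> T \<Longrightarrow> f i j \<in> carrier A"
  shows "(\<Oplus>i\<in>S. \<Oplus>j\<in>T. f i j) = (\<Oplus>j\<in>T. \<Oplus>i\<in>S. f i j)"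
  using assms(1,3)
proof (induction S)
  case (insert x S)
  then have "(\<Oplus>i\<in>insert x S. \<Oplus>j\<in>T. f i j) = (\<Oplus>j\<in>T. f x j) \<oplus> (\<Oplus>j\<in>T. \<Oplus>i\<in>S. f i j)"
    by (subst finsum_insert) (auto intro!: finsum_closed)
  also have "\<dots> = (\<Oplus>j\<in>T. f x j \<oplus> (\<Oplus>i\<in>S. f i j))"
    using insert by (subst finsum_addf) (auto intro!: finsum_closed)
  also have "\<dots> = (\<Oplus>j\<in>T. \<Oplus>i\<in>insert x S. f i j)"
    using insert by (intro finsum_cong') (auto simp: finsum_insert Pi_iff intro!: finsum_closed)
  finally show ?case .
qed (simp add: finsum_zero)

lemma finsum_mult_finsum:
  assumes "finite S" "finite T" "f \<in> S \<rightarrow> carrier A" "g \<in> T \<rightarrow> carrier A"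
  shows "(\<Oplus>i\<in>S. f i) \<otimes> (\<Oplus>j\<in>T. g j) = (\<Oplus>i\<in>S. \<Oplus>j\<in>T. f i \<otimes> g j)"
proof -
  have "(\<Oplus>i\<in>S. f i) \<otimes> (\<Oplus>j\<in>T. g j) = (\<Oplus>i\<in>S. f i \<otimes> (\<Oplus>j\<in>T. g j))"
    using assms by (subst finsum_ldistr) (auto intro!: finsum_closed)
  also have "\<dots> = (\<Oplus>i\<in>S. \<Oplus>j\<in>T. f i \<otimes> g j)"
    using assms by (intro finsum_cong') (auto simp: finsum_rdistr Pi_iff intro!: finsum_closed)
  finally show ?thesis .
qed

end

text \<open>An algebra and its extension to a bialgebra record have different types and cannot be
  equated, so the axioms are carried over field by field.\<close>

lemma comm_algebra_cong:
  fixes R :: "('k::field, 'a, 'x) module_scheme" and S :: "('k, 'a, 'y) module_scheme"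
  assumes "comm_algebra R"
    and "carrier S = carrier R" "monoid.mult S = monoid.mult R" "one S = one R"
    and "zero S = zero R" "add S = add R" "smult S = smult R"
  shows "comm_algebra S"
proof -
  interpret comm_algebra R by fact
  show ?thesis
    by (intro comm_algebra.intro comm_algebra_axioms.intro cring_cong[OF is_cring])
      (simp_all add: assms smult_l_distr smult_r_distr smult_assoc1 smult_assoc2)
qed

lemma ground_algebra_simps [simp]:
  "carrier ground_algebra = UNIV" "x \<otimes>\<^bsub>ground_algebra\<^esub> y = x * y" "\<one>\<^bsub>ground_algebra\<^esub> = 1"
  "\<zero>\<^bsub>ground_algebra\<^esub> = 0" "x \<oplus>\<^bsub>ground_algebra\<^esub> y = x + y" "c \<odot>\<^bsub>ground_algebra\<^esub> x = c * x"
  by (simp_all add: ground_algebra_def)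

lemma comm_algebra_ground: "comm_algebra (ground_algebra :: ('k::field, 'k) module)"
proof (intro comm_algebra.intro comm_algebra_axioms.intro cringI abelian_groupI comm_monoidI)
  show "\<exists>y\<in>carrier ground_algebra. y \<oplus>\<^bsub>ground_algebra\<^esub> x = \<zero>\<^bsub>ground_algebra\<^esub>" for x :: 'k
    by (rule bexI[of _ "- x"]) auto
qed (auto simp: algebra_simps)

interpretation ground: comm_algebra "ground_algebra :: ('k::field, 'k) module"
  by (rule comm_algebra_ground)

text \<open>Both kinds of sum are zero on an infinite index set, so the rewrite rule is
  unconditional. It turns statements about an arbitrary target algebra into type-class sums once the
  target is the ground field.\<close>

lemma finsum_ground [simp]: "finsum ground_algebra f S = sum f S"
proof (induction S rule: infinite_finite_induct)
  case (insert x S)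
  then show ?case by (subst ground.finsum_insert) auto
qed auto

lemma quotient_algebra_sel:
  "carrier (quotient_algebra A I) = carrier (A Quot I)"
  "monoid.mult (quotient_algebra A I) = monoid.mult (A Quot I)"
  "one (quotient_algebra A I) = one (A Quot I)"
  "zero (quotient_algebra A I) = zero (A Quot I)"
  "add (quotient_algebra A I) = add (A Quot I)"
  by (simp_all add: quotient_algebra_def)

section \<open>Homomorphisms of unital algebras\<close>

lemma alg_homD:
  assumes "f \<in> alg_hom A B"
  shows "x \<in> carrier A \<Longrightarrow> f x \<in> carrier B"
    and "x \<in> carrier A \<Longrightarrow> y \<in> carrier A \<Longrightarrow> f (x \<otimes>\<^bsub>A\<^esub> y) = f x \<otimes>\<^bsub>B\<^esub> f y"
    and "x \<in> carrier A \<Longrightarrow> y \<in> carrier A \<Longrightarrow> f (x \<oplus>\<^bsub>A\<^esub> y) = f x \<oplus>\<^bsub>B\<^esub> f y"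
    and "f \<one>\<^bsub>A\<^esub> = \<one>\<^bsub>B\<^esub>"
    and "x \<in> carrier A \<Longrightarrow> f (c \<odot>\<^bsub>A\<^esub> x) = c \<odot>\<^bsub>B\<^esub> f x"
    and "f \<in> extensional (carrier A)"
  using assms by (auto simp: alg_hom_def ring_hom_def)

lemma alg_homI:
  assumes "\<And>x. x \<in> carrier A \<Longrightarrow> f x \<in> carrier B"
    and "\<And>x y. x \<in> carrier A \<Longrightarrow> y \<in> carrier A \<Longrightarrow> f (x \<otimes>\<^bsub>A\<^esub> y) = f x \<otimes>\<^bsub>B\<^esub> f y"
    and "\<And>x y. x \<in> carrier A \<Longrightarrow> y \<in> carrier A \<Longrightarrow> f (x \<oplus>\<^bsub>A\<^esub> y) = f x \<oplus>\<^bsub>B\<^esub> f y"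
    and "f \<one>\<^bsub>A\<^esub> = \<one>\<^bsub>B\<^esub>"
    and "\<And>c x. x \<in> carrier A \<Longrightarrow> f (c \<odot>\<^bsub>A\<^esub> x) = c \<odot>\<^bsub>B\<^esub> f x"
    and "f \<in> extensional (carrier A)"
  shows "f \<in> alg_hom A B"
  using assms by (auto simp: alg_hom_def ring_hom_def)

lemma alg_hom_zero:
  assumes "comm_algebra A" "comm_algebra B" "f \<in> alg_hom A B"
  shows "f \<zero>\<^bsub>A\<^esub> = \<zero>\<^bsub>B\<^esub>"
proof -
  interpret A: comm_algebra A by fact
  interpret B: comm_algebra B by fact
  have "f (0 \<odot>\<^bsub>A\<^esub> \<one>\<^bsub>A\<^esub>) = 0 \<odot>\<^bsub>B\<^esub> f \<one>\<^bsub>A\<^esub>"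
    by (rule alg_homD(5)[OF assms(3)]) simp
  then show ?thesis
    by (simp add: alg_homD[OF assms(3)])
qed

lemma alg_hom_finsum:
  assumes "comm_algebra A" "comm_algebra B" "f \<in> alg_hom A B" "g \<in> S \<rightarrow> carrier A"
  shows "f (finsum A g S) = finsum B (\<lambda>i. f (g i)) S"
proof -
  interpret A: comm_algebra A by fact
  interpret B: comm_algebra B by fact
  show ?thesis using assms(4)
  proof (induction S rule: infinite_finite_induct)
    case (insert x S)
    then have "f (g x \<oplus>\<^bsub>A\<^esub> finsum A g S) = f (g x) \<oplus>\<^bsub>B\<^esub> finsum B (\<lambda>i. f (g i)) S"
      using alg_homD(3)[OF assms(3), of "g x" "finsum A g S"] by auto
    with insert show ?case
      by (auto simp: A.finsum_insert B.finsum_insert Pi_iff alg_homD[OF assms(3)])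
  qed (auto simp: alg_hom_zero[OF assms(1-3)])
qed

lemma alg_hom_compose:
  assumes "f \<in> alg_hom A B" "g \<in> alg_hom B C" "comm_algebra A"
  shows "(\<lambda>x\<in>carrier A. g (f x)) \<in> alg_hom A C"
proof -
  interpret A: comm_algebra A by fact
  show ?thesis
    by (rule alg_homI) (auto simp: alg_homD[OF assms(1)] alg_homD[OF assms(2)])
qed

section \<open>Quotient algebras\<close>

context comm_algebra
begin

lemma coset_eq_iff:
  assumes "ideal I A" "x \<in> carrier A" "y \<in> carrier A"
  shows "I +> x = I +> y \<longleftrightarrow> x \<ominus> y \<in> I"
  using quotient_eq_iff_same_a_r_cos[OF assms] by simp

lemma ideal_smult_closed:
  assumes "ideal I A" "x \<in> I"
  shows "c \<odot> x \<in> I"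
  using assms ideal.I_l_closed[of I A x "c \<odot> \<one>"]
  by (metis additive_subgroup.a_Hcarr ideal.axioms(1) one_closed smult_closed smult_eq_mult_one)

lemma quotient_algebra_simps:
  assumes "ideal I A"
  shows "carrier (quotient_algebra A I) = (\<lambda>x. I +> x) ` carrier A"
    and "x \<in> carrier A \<Longrightarrow> y \<in> carrier A \<Longrightarrow>
          (I +> x) \<otimes>\<^bsub>quotient_algebra A I\<^esub> (I +> y) = I +> (x \<otimes> y)"
    and "x \<in> carrier A \<Longrightarrow> y \<in> carrier A \<Longrightarrow>
          (I +> x) \<oplus>\<^bsub>quotient_algebra A I\<^esub> (I +> y) = I +> (x \<oplus> y)"
    and "\<one>\<^bsub>quotient_algebra A I\<^esub> = I +> \<one>"
    and "\<zero>\<^bsub>quotient_algebra A I\<^esub> = I +> \<zero>"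
    and "x \<in> carrier A \<Longrightarrow> c \<odot>\<^bsub>quotient_algebra A I\<^esub> (I +> x) = I +> (c \<odot> x)"
proof -
  interpret ideal I A by fact
  show "carrier (quotient_algebra A I) = (\<lambda>x. I +> x) ` carrier A"
    by (auto simp: quotient_algebra_def FactRing_def A_RCOSETS_def' a_r_coset_def')
  show "\<one>\<^bsub>quotient_algebra A I\<^esub> = I +> \<one>"
    by (simp add: quotient_algebra_def FactRing_def)
  show "\<zero>\<^bsub>quotient_algebra A I\<^esub> = I +> \<zero>"
    by (auto simp add: quotient_algebra_def FactRing_def a_r_coset_def')
  show "(I +> x) \<otimes>\<^bsub>quotient_algebra A I\<^esub> (I +> y) = I +> (x \<otimes> y)"
    and "(I +> x) \<oplus>\<^bsub>quotient_algebra A I\<^esub> (I +> y) = I +> (x \<oplus> y)"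
    if "x \<in> carrier A" "y \<in> carrier A"
    using that by (simp_all add: quotient_algebra_def FactRing_def rcoset_mult_add a_rcos_sum)
  show "c \<odot>\<^bsub>quotient_algebra A I\<^esub> (I +> x) = I +> (c \<odot> x)" if x: "x \<in> carrier A"
  proof -
    \<comment> \<open>Scaling in the quotient is defined as a union over all representatives. They
      all give the same coset, so the union is that coset.\<close>
    have *: "I +> (c \<odot> y) = I +> (c \<odot> x)" if y: "y \<in> I +> x" for y
    proof -
      obtain h where h: "h \<in> I" "y = h \<oplus> x"
        using y by (auto simp: a_r_coset_def')
      have "c \<odot> y \<ominus> c \<odot> x = c \<odot> h"
        using h x a_Hcarr by (simp add: smult_r_distr minus_eq a_assoc r_neg)
      moreover have "y \<in> carrier A"
        using h x a_Hcarr by auto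
      ultimately show ?thesis
        using x h coset_eq_iff[OF is_ideal, of "c \<odot> y" "c \<odot> x"] ideal_smult_closed[OF is_ideal] by simp
    qed
    have "x \<in> I +> x" using x by (rule a_rcos_self)
    with * have "(\<Union>y\<in>I +> x. I +> (c \<odot> y)) = I +> (c \<odot> x)"
      by (intro SUP_eq_const) blast+
    then show ?thesis
      by (simp add: quotient_algebra_def)
  qed
qed

lemma comm_algebra_quotient:
  assumes "ideal I A"
  shows "comm_algebra (quotient_algebra A I)"
proof -
  note simps = quotient_algebra_simps[OF assms]
  have "cring (A Quot I)" by (rule ideal.quotient_is_cring[OF assms is_cring])
  then have "cring (quotient_algebra A I)"
    by (rule cring_cong) (simp_all add: quotient_algebra_sel)
  moreover have "comm_algebra_axioms (quotient_algebra A I)"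
  proof
    fix X and c d :: 'k assume "X \<in> carrier (quotient_algebra A I)"
    then obtain x where X: "X = I +> x" "x \<in> carrier A"
      by (auto simp only: simps)
    then show "c \<odot>\<^bsub>quotient_algebra A I\<^esub> X \<in> carrier (quotient_algebra A I)"
      by (simp add: simps)
    show "(c + d) \<odot>\<^bsub>quotient_algebra A I\<^esub> X =
        c \<odot>\<^bsub>quotient_algebra A I\<^esub> X \<oplus>\<^bsub>quotient_algebra A I\<^esub> d \<odot>\<^bsub>quotient_algebra A I\<^esub> X"
      using X by (simp add: simps smult_l_distr)
    show "(c * d) \<odot>\<^bsub>quotient_algebra A I\<^esub> X =
        c \<odot>\<^bsub>quotient_algebra A I\<^esub> (d \<odot>\<^bsub>quotient_algebra A I\<^esub> X)"
      using X by (simp add: simps smult_assoc1)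
    show "1 \<odot>\<^bsub>quotient_algebra A I\<^esub> X = X"
      using X by (simp add: simps)
    fix Y assume "Y \<in> carrier (quotient_algebra A I)"
    then obtain y where Y: "Y = I +> y" "y \<in> carrier A"
      by (auto simp only: simps)
    show "c \<odot>\<^bsub>quotient_algebra A I\<^esub> (X \<oplus>\<^bsub>quotient_algebra A I\<^esub> Y) =
        c \<odot>\<^bsub>quotient_algebra A I\<^esub> X \<oplus>\<^bsub>quotient_algebra A I\<^esub> c \<odot>\<^bsub>quotient_algebra A I\<^esub> Y"
      using X Y by (simp add: simps smult_r_distr)
    show "c \<odot>\<^bsub>quotient_algebra A I\<^esub> X \<otimes>\<^bsub>quotient_algebra A I\<^esub> Y =
        c \<odot>\<^bsub>quotient_algebra A I\<^esub> (X \<otimes>\<^bsub>quotient_algebra A I\<^esub> Y)"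
      using X Y by (simp add: simps smult_assoc2)
  qed
  ultimately show ?thesis
    by (rule comm_algebra.intro)
qed

lemma quotient_projection: "ideal I A \<Longrightarrow> (\<lambda>x\<in>carrier A. I +> x) \<in> alg_hom A (quotient_algebra A I)"
  by (rule alg_homI) (auto simp: quotient_algebra_simps)

lemma quotient_lift:
  assumes I: "ideal I A" and B: "comm_algebra B" and f: "f \<in> alg_hom A B"
    and f0: "\<And>x. x \<in> I \<Longrightarrow> f x = \<zero>\<^bsub>B\<^esub>"
  shows "\<exists>h\<in>alg_hom (quotient_algebra A I) B. \<forall>x\<in>carrier A. h (I +> x) = f x"
proof -
  interpret ideal I A by fact
  interpret B: comm_algebra B by fact
  \<comment> \<open>Since \<open>f\<close> vanishes on \<open>I\<close> it is constant on each
    coset, so the image of a coset is a singleton and \<open>the_elem\<close> is meaningful.\<close>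
  define h where "h = (\<lambda>X\<in>carrier (quotient_algebra A I). the_elem (f ` X))"
  have h: "h (I +> x) = f x" if x: "x \<in> carrier A" for x
  proof -
    have "f y = f x" if "y \<in> I +> x" for y
      using that x f0 by (auto simp: a_r_coset_def' alg_homD[OF f] a_Hcarr)
    then have "f ` (I +> x) = {f x}"
      using a_rcos_self[OF x] by blast
    then show ?thesis
      using x by (simp add: h_def quotient_algebra_simps[OF I])
  qed
  have "h \<in> alg_hom (quotient_algebra A I) B"
  proof (rule alg_homI)
    show "h \<in> extensional (carrier (quotient_algebra A I))" by (simp add: h_def)
  qed (clarsimp simp: quotient_algebra_simps[OF I] h alg_homD[OF f])+
  with h show ?thesis by blast
qed

end

section \<open>Tensor products\<close>

lemma poly_mapping_sum_singles:
  "p = (\<Sum>a\<in>Poly_Mapping.keys p. Poly_Mapping.single a (Poly_Mapping.lookup p a))"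
proof (rule poly_mapping_eqI)
  fix k
  show "Poly_Mapping.lookup p k =
      Poly_Mapping.lookup (\<Sum>a\<in>Poly_Mapping.keys p. Poly_Mapping.single a (Poly_Mapping.lookup p a)) k"
    by (simp add: lookup_sum lookup_single when_def sum.delta' in_keys_iff)
qed

text \<open>The carriers of the free algebra on pairs, of polynomials and even of monomials are all
  described by a bound on the support. The rule therefore keeps the bound \<open>S\<close> available
  in every case, in particular for both summands in the additive case.\<close>

lemma poly_mapping_keys_induct [consumes 1, case_names zero single add]:
  assumes "Poly_Mapping.keys p \<subseteq> S"
    and zero: "P 0"
    and single: "\<And>a c. a \<in> S \<Longrightarrow> P (Poly_Mapping.single a c)"
    and add: "\<And>p q. Poly_Mapping.keys p \<subseteq> S \<Longrightarrow> Poly_Mapping.keys q \<subseteq> S \<Longrightarrow> P p \<Longrightarrow> P q \<Longrightarrow> P (p + q)"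
  shows "P (p :: 'a \<Rightarrow>\<^sub>0 'b::comm_monoid_add)"
proof -
  \<comment> \<open>The support bound is proved together with \<open>P\<close>, because
    \<open>add\<close> demands it of the partial sum.\<close>
  have "Poly_Mapping.keys (\<Sum>a\<in>F. Poly_Mapping.single a (f a)) \<subseteq> S \<and> P (\<Sum>a\<in>F. Poly_Mapping.single a (f a))"
    if "finite F" "F \<subseteq> S" for F and f :: "'a \<Rightarrow> 'b"
    using that
  proof (induction F)
    case (insert x F)
    let ?s = "\<Sum>a\<in>F. Poly_Mapping.single a (f a)"
    have "Poly_Mapping.keys (Poly_Mapping.single x (f x)) \<subseteq> S"
      using insert.prems by (simp add: keys_single)
    with insert show ?case
      using Poly_Mapping.keys_add[of "Poly_Mapping.single x (f x)" ?s]
      by (auto intro!: add single)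
  qed (simp add: zero)
  from this[of "Poly_Mapping.keys p" "Poly_Mapping.lookup p"] assms(1) show ?thesis
    by (simp flip: poly_mapping_sum_singles)
qed

lemma lookup_pm_scale [simp]: "Poly_Mapping.lookup (pm_scale c p) a = c * Poly_Mapping.lookup p a"
  unfolding pm_scale_def by (subst map.rep_eq) (simp add: when_def)

lemma pm_scale_single [simp]: "pm_scale c (Poly_Mapping.single a d) = Poly_Mapping.single a (c * d)"
  by (rule poly_mapping_eqI) (simp add: lookup_single when_def)

lemma keys_pm_scale: "Poly_Mapping.keys (pm_scale c p) \<subseteq> Poly_Mapping.keys p"
  by (auto simp: in_keys_iff)

interpretation pm: vector_space "pm_scale :: 'k::field \<Rightarrow> ('b \<Rightarrow>\<^sub>0 'k) \<Rightarrow> 'b \<Rightarrow>\<^sub>0 'k"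
  by standard (auto intro!: poly_mapping_eqI simp: lookup_add algebra_simps)

lemma keys_diff_subset:
  "Poly_Mapping.keys (p - q) \<subseteq> Poly_Mapping.keys p \<union> Poly_Mapping.keys (q :: 'a \<Rightarrow>\<^sub>0 'b::ab_group_add)"
  by (auto simp: in_keys_iff lookup_minus)

lemma subspace_keys: "pm.subspace {p :: 'b \<Rightarrow>\<^sub>0 'k::field. Poly_Mapping.keys p \<subseteq> S}"
proof (rule pm.subspaceI)
  show "p + q \<in> {p. Poly_Mapping.keys p \<subseteq> S}"
    if "p \<in> {p. Poly_Mapping.keys p \<subseteq> S}" "q \<in> {p. Poly_Mapping.keys p \<subseteq> S}"
    for p q :: "'b \<Rightarrow>\<^sub>0 'k"
    using that Poly_Mapping.keys_add[of p q] by auto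
  show "pm_scale c p \<in> {p. Poly_Mapping.keys p \<subseteq> S}" if "p \<in> {p. Poly_Mapping.keys p \<subseteq> S}"
    for c :: 'k and p :: "'b \<Rightarrow>\<^sub>0 'k"
    using that keys_pm_scale[of c p] by auto
qed simp

text \<open>The linear extension of \<open>\<phi>\<close> from the basis to the free vector space;
  \<open>tensor_eval\<close> applies this function to every representative of a tensor.\<close>

definition pm_eval :: "('b \<Rightarrow> 'k) \<Rightarrow> ('b \<Rightarrow>\<^sub>0 'k::field) \<Rightarrow> 'k" where
  "pm_eval \<phi> p = (\<Sum>a\<in>Poly_Mapping.keys p. Poly_Mapping.lookup p a * \<phi> a)"

lemma pm_eval_zero [simp]: "pm_eval \<phi> 0 = 0"
  by (simp add: pm_eval_def)

lemma pm_eval_single [simp]: "pm_eval \<phi> (Poly_Mapping.single a c) = c * \<phi> a"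
  by (simp add: pm_eval_def keys_single)

lemma pm_eval_add: "pm_eval \<phi> (p + q) = pm_eval \<phi> p + pm_eval \<phi> q"
  unfolding pm_eval_def by (rule setsum_keys_plus_distrib) (auto simp: algebra_simps)

lemma pm_eval_scale: "pm_eval \<phi> (pm_scale c p) = c * pm_eval \<phi> p"
proof -
  have "pm_eval \<phi> (pm_scale c p) = (\<Sum>a\<in>Poly_Mapping.keys p. c * Poly_Mapping.lookup p a * \<phi> a)"
    unfolding pm_eval_def using keys_pm_scale[of c p]
    by (intro sum.mono_neutral_cong_left) (auto simp: in_keys_iff)
  then show ?thesis
    by (simp add: pm_eval_def sum_distrib_left mult.assoc)
qed

lemma pm_eval_diff: "pm_eval \<phi> (p - q) = pm_eval \<phi> p - pm_eval \<phi> q"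
  using pm_eval_add[of \<phi> "p - q" q] by simp

section \<open>The algebra on pairs and the tensor relations\<close>

lemma free_pair_algebra_sel [simp]:
  "carrier (free_pair_algebra V W) = {p. Poly_Mapping.keys p \<subseteq> carrier V \<times> carrier W}"
  "one (free_pair_algebra V W) = Poly_Mapping.single (\<one>\<^bsub>V\<^esub>, \<one>\<^bsub>W\<^esub>) 1"
  "zero (free_pair_algebra V W) = 0"
  "add (free_pair_algebra V W) = (+)"
  "smult (free_pair_algebra V W) = pm_scale"
  by (simp_all add: free_pair_algebra_def)

lemma free_pair_mult_eq:
  "p \<otimes>\<^bsub>free_pair_algebra V W\<^esub> q = (\<Sum>a\<in>Poly_Mapping.keys p. \<Sum>b\<in>Poly_Mapping.keys q.
        Poly_Mapping.single (fst a \<otimes>\<^bsub>V\<^esub> fst b, snd a \<otimes>\<^bsub>W\<^esub> snd b)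
          (Poly_Mapping.lookup p a * Poly_Mapping.lookup q b))"
  by (simp add: free_pair_algebra_def)

lemma free_pair_mult_single [simp]:
  "Poly_Mapping.single (v, w) c \<otimes>\<^bsub>free_pair_algebra V W\<^esub> Poly_Mapping.single (v', w') d =
     Poly_Mapping.single (v \<otimes>\<^bsub>V\<^esub> v', w \<otimes>\<^bsub>W\<^esub> w') (c * d)"
  by (simp add: free_pair_mult_eq keys_single)

lemma free_pair_mult_zero [simp]:
  "0 \<otimes>\<^bsub>free_pair_algebra V W\<^esub> p = 0" "p \<otimes>\<^bsub>free_pair_algebra V W\<^esub> 0 = 0"
  by (simp_all add: free_pair_mult_eq)

lemma free_pair_mult_add_left:
  "(p + q) \<otimes>\<^bsub>free_pair_algebra V W\<^esub> r =
     p \<otimes>\<^bsub>free_pair_algebra V W\<^esub> r + q \<otimes>\<^bsub>free_pair_algebra V W\<^esub> r"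
  unfolding free_pair_mult_eq
  by (rule setsum_keys_plus_distrib) (simp_all add: distrib_right single_add sum.distrib)

lemma free_pair_mult_add_right:
  "r \<otimes>\<^bsub>free_pair_algebra V W\<^esub> (p + q) =
     r \<otimes>\<^bsub>free_pair_algebra V W\<^esub> p + r \<otimes>\<^bsub>free_pair_algebra V W\<^esub> q"
  unfolding free_pair_mult_eq sum.distrib[symmetric]
  by (intro sum.cong refl setsum_keys_plus_distrib) (simp_all add: distrib_left single_add)

lemma free_pair_mult_scale_left:
  "pm_scale c p \<otimes>\<^bsub>free_pair_algebra V W\<^esub> q = pm_scale c (p \<otimes>\<^bsub>free_pair_algebra V W\<^esub> q)"
proof -
  have "Poly_Mapping.keys p \<subseteq> UNIV" by simp
  then show ?thesis
  proof (induction p rule: poly_mapping_keys_induct)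
    case (single a d)
    have "Poly_Mapping.keys q \<subseteq> UNIV" by simp
    then show ?case
    proof (induction q rule: poly_mapping_keys_induct)
      case (single b e)
      then show ?case by (cases a; cases b) (simp add: mult.assoc)
    qed (auto simp: free_pair_mult_add_right pm.scale_right_distrib)
  qed (auto simp: free_pair_mult_add_left pm.scale_right_distrib)
qed

text \<open>This is the monoid algebra of the product of the multiplicative monoids of
  \<open>V\<close> and \<open>W\<close>. Every multiplicative law reduces by linearity to basis
  pairs, where it is the corresponding law of \<open>V\<close> and \<open>W\<close> in each
  component; addition in \<open>V\<close> and \<open>W\<close> enters only with the tensor
  relations.\<close>

lemma comm_algebra_free_pair:
  fixes V :: "('k::field, 'v, 'x) module_scheme" and W :: "('k, 'w, 'y) module_scheme"
  assumes "comm_algebra V" "comm_algebra W"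
  shows "comm_algebra (free_pair_algebra V W)"
proof -
  interpret V: comm_algebra V by fact
  interpret W: comm_algebra W by fact
  let ?F = "free_pair_algebra V W" and ?S = "carrier V \<times> carrier W"
  have sub: "p \<in> {p. Poly_Mapping.keys p \<subseteq> ?S} \<Longrightarrow> q \<in> {p. Poly_Mapping.keys p \<subseteq> ?S} \<Longrightarrow>
      Poly_Mapping.keys (p + q) \<subseteq> ?S" for p q :: "'v \<times> 'w \<Rightarrow>\<^sub>0 'k"
    using pm.subspace_add[OF subspace_keys, of p ?S q] by simp
  have closed: "Poly_Mapping.keys (p \<otimes>\<^bsub>?F\<^esub> q) \<subseteq> ?S"
    if "Poly_Mapping.keys p \<subseteq> ?S" "Poly_Mapping.keys q \<subseteq> ?S" for p q
    using that(1)
  proof (induction p rule: poly_mapping_keys_induct)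
    case (single a c)
    from that(2) show ?case
    proof (induction q rule: poly_mapping_keys_induct)
      case (single b d)
      with \<open>a \<in> ?S\<close> show ?case by (cases a; cases b) (auto simp: keys_single)
    qed (simp_all add: free_pair_mult_add_right sub)
  qed (simp_all add: free_pair_mult_add_left sub)
  have comm: "p \<otimes>\<^bsub>?F\<^esub> q = q \<otimes>\<^bsub>?F\<^esub> p"
    if "Poly_Mapping.keys p \<subseteq> ?S" "Poly_Mapping.keys q \<subseteq> ?S" for p q
    using that(1)
  proof (induction p rule: poly_mapping_keys_induct)
    case (single a c)
    from that(2) show ?case
    proof (induction q rule: poly_mapping_keys_induct)
      case (single b d)
      with \<open>a \<in> ?S\<close> show ?case by (cases a; cases b) (auto simp: V.m_comm W.m_comm mult.commute)
    qed (simp_all add: free_pair_mult_add_left free_pair_mult_add_right)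
  qed (simp_all add: free_pair_mult_add_left free_pair_mult_add_right)
  have assoc: "p \<otimes>\<^bsub>?F\<^esub> q \<otimes>\<^bsub>?F\<^esub> r = p \<otimes>\<^bsub>?F\<^esub> (q \<otimes>\<^bsub>?F\<^esub> r)"
    if "Poly_Mapping.keys p \<subseteq> ?S" "Poly_Mapping.keys q \<subseteq> ?S" "Poly_Mapping.keys r \<subseteq> ?S" for p q r
    using that(1)
  proof (induction p rule: poly_mapping_keys_induct)
    case (single a c)
    from that(2) show ?case
    proof (induction q rule: poly_mapping_keys_induct)
      case (single b d)
      from that(3) show ?case
      proof (induction r rule: poly_mapping_keys_induct)
        case (single e f)
        with \<open>a \<in> ?S\<close> \<open>b \<in> ?S\<close> show ?case
          by (cases a; cases b; cases e) (auto simp: V.m_assoc W.m_assoc mult.assoc)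
      qed (simp_all add: free_pair_mult_add_right)
    qed (simp_all add: free_pair_mult_add_left free_pair_mult_add_right)
  qed (simp_all add: free_pair_mult_add_left)
  have one: "\<one>\<^bsub>?F\<^esub> \<otimes>\<^bsub>?F\<^esub> p = p" if "Poly_Mapping.keys p \<subseteq> ?S" for p
    using that
  proof (induction p rule: poly_mapping_keys_induct)
    case (single a c)
    then show ?case by (cases a) auto
  qed (simp_all add: free_pair_mult_add_right)
  have neg: "\<exists>q. Poly_Mapping.keys q \<subseteq> ?S \<and> p + q = 0" if "Poly_Mapping.keys p \<subseteq> ?S"
    for p :: "'v \<times> 'w \<Rightarrow>\<^sub>0 'k"
    by (rule exI[of _ "- p"]) (use that in \<open>auto simp: in_keys_iff\<close>)
  have ab: "abelian_group ?F"
    by (rule abelian_groupI) (simp_all add: neg sub add.assoc add.commute add.left_commute)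
  have mon: "Group.comm_monoid ?F"
    by (rule comm_monoidI) (simp_all add: closed assoc one[simplified] keys_single, simp add: comm)
  show ?thesis
    by (intro comm_algebra.intro comm_algebra_axioms.intro cringI ab mon)
      (use pm.subspace_scale[OF subspace_keys] in
        \<open>simp_all add: free_pair_mult_add_left free_pair_mult_scale_left pm.scale_left_distrib pm.scale_right_distrib\<close>)
qed

text \<open>The span is formed in the whole type, whereas an ideal has to lie in the carrier.
  Elements with support in a fixed set form a subspace, so it is enough to inspect the
  generators.\<close>

lemma keys_tensor_relations:
  assumes "comm_algebra V" "comm_algebra W"
  shows "tensor_relations V W \<subseteq> {p. Poly_Mapping.keys p \<subseteq> carrier V \<times> carrier W}"
proof -
  interpret V: comm_algebra V by fact
  interpret W: comm_algebra W by fact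
  have "Poly_Mapping.single (v, w) c \<in> {p. Poly_Mapping.keys p \<subseteq> carrier V \<times> carrier W}"
    if "v \<in> carrier V" "w \<in> carrier W" for v w c
    using that by (auto simp: keys_single)
  note single = this and diff = pm.subspace_diff[OF subspace_keys]
  show ?thesis
    unfolding tensor_relations_def
    by (intro pm.span_minimal subspace_keys Un_least subsetI; elim CollectE exE conjE; simp only:; intro diff single)
      simp_all
qed

lemma subspace_tensor_relations: "pm.subspace (tensor_relations V W)"
  unfolding tensor_relations_def by (rule pm.subspace_span)

lemma tensor_relations_base:
  "v \<in> carrier V \<Longrightarrow> v' \<in> carrier V \<Longrightarrow> w \<in> carrier W \<Longrightarrow>
     Poly_Mapping.single (v \<oplus>\<^bsub>V\<^esub> v', w) 1 - Poly_Mapping.single (v, w) 1 - Poly_Mapping.single (v', w) 1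
       \<in> tensor_relations V W"
  "v \<in> carrier V \<Longrightarrow> w \<in> carrier W \<Longrightarrow> w' \<in> carrier W \<Longrightarrow>
     Poly_Mapping.single (v, w \<oplus>\<^bsub>W\<^esub> w') 1 - Poly_Mapping.single (v, w) 1 - Poly_Mapping.single (v, w') 1
       \<in> tensor_relations V W"
  "v \<in> carrier V \<Longrightarrow> w \<in> carrier W \<Longrightarrow>
     Poly_Mapping.single (c \<odot>\<^bsub>V\<^esub> v, w) 1 - Poly_Mapping.single (v, w) c \<in> tensor_relations V W"
  "v \<in> carrier V \<Longrightarrow> w \<in> carrier W \<Longrightarrow>
     Poly_Mapping.single (v, c \<odot>\<^bsub>W\<^esub> w) 1 - Poly_Mapping.single (v, w) c \<in> tensor_relations V W"
  unfolding tensor_relations_def by (rule pm.span_base, blast)+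

lemma tensor_relations_induct [consumes 1, case_names subspace add_left add_right smult_left smult_right]:
  assumes "p \<in> tensor_relations V W" "pm.subspace U"
    and "\<And>v v' w. v \<in> carrier V \<Longrightarrow> v' \<in> carrier V \<Longrightarrow> w \<in> carrier W \<Longrightarrow>
     Poly_Mapping.single (v \<oplus>\<^bsub>V\<^esub> v', w) 1 - Poly_Mapping.single (v, w) 1 - Poly_Mapping.single (v', w) 1 \<in> U"
    and "\<And>v w w'. v \<in> carrier V \<Longrightarrow> w \<in> carrier W \<Longrightarrow> w' \<in> carrier W \<Longrightarrow>
     Poly_Mapping.single (v, w \<oplus>\<^bsub>W\<^esub> w') 1 - Poly_Mapping.single (v, w) 1 - Poly_Mapping.single (v, w') 1 \<in> U"
    and "\<And>c v w. v \<in> carrier V \<Longrightarrow> w \<in> carrier W \<Longrightarrow>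
     Poly_Mapping.single (c \<odot>\<^bsub>V\<^esub> v, w) 1 - Poly_Mapping.single (v, w) c \<in> U"
    and "\<And>c v w. v \<in> carrier V \<Longrightarrow> w \<in> carrier W \<Longrightarrow>
     Poly_Mapping.single (v, c \<odot>\<^bsub>W\<^esub> w) 1 - Poly_Mapping.single (v, w) c \<in> U"
  shows "p \<in> U"
proof -
  have "tensor_relations V W \<subseteq> U"
    unfolding tensor_relations_def using assms(3-6) by (intro pm.span_minimal assms(2)) blast
  with assms(1) show ?thesis by blast
qed

text \<open>Multiplying a bilinearity relation by a basis pair (x, y) gives a multiple of the same
  kind of relation for the products with x and y, by distributivity in \<open>V\<close> and
  \<open>W\<close>. Linearity and commutativity do the rest.\<close>

lemma ideal_tensor_relations:
  assumes "comm_algebra V" "comm_algebra W"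
  shows "ideal (tensor_relations V W) (free_pair_algebra V W)"
proof -
  interpret V: comm_algebra V by fact
  interpret W: comm_algebra W by fact
  let ?F = "free_pair_algebra V W" and ?R = "tensor_relations V W" and ?S = "carrier V \<times> carrier W"
  interpret F: comm_algebra ?F by (rule comm_algebra_free_pair) fact+
  note sub = subspace_tensor_relations[of V W]
  have carr: "p \<in> ?R \<Longrightarrow> p \<in> carrier ?F" for p
    using keys_tensor_relations[OF assms] by auto
  have neg: "\<ominus>\<^bsub>?F\<^esub> p = - p" if "p \<in> carrier ?F" for p
  proof (rule F.minus_equality)
    show "- p \<oplus>\<^bsub>?F\<^esub> p = \<zero>\<^bsub>?F\<^esub>" by simp
    show "- p \<in> carrier ?F" "p \<in> carrier ?F"
      using that by (auto simp: in_keys_iff)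
  qed
  have gens: "Poly_Mapping.single (x, y) d \<otimes>\<^bsub>?F\<^esub> p \<in> ?R" if p: "p \<in> ?R"
      and xy: "x \<in> carrier V" "y \<in> carrier W" for p x y d
  proof -
    \<comment> \<open>The preimage of the relations under multiplication by one basis term is a
      subspace, so that only the four families of generators have to be multiplied out.\<close>
    define U where "U = {p. Poly_Mapping.single (x, y) d \<otimes>\<^bsub>?F\<^esub> p \<in> ?R}"
    have scale_right: "Poly_Mapping.single (x, y) d \<otimes>\<^bsub>?F\<^esub> pm_scale c p =
        pm_scale c (Poly_Mapping.single (x, y) d \<otimes>\<^bsub>?F\<^esub> p)" for c p
    proof -
      have "Poly_Mapping.keys p \<subseteq> UNIV" by simp
      then show ?thesis
      proof (induction p rule: poly_mapping_keys_induct)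
        case (single a f)
        then show ?case by (cases a) (simp add: mult.left_commute)
      qed (simp_all add: free_pair_mult_add_right pm.scale_right_distrib)
    qed
    have diff: "r \<otimes>\<^bsub>?F\<^esub> (p - q) = r \<otimes>\<^bsub>?F\<^esub> p - r \<otimes>\<^bsub>?F\<^esub> q" for r p q
      using free_pair_mult_add_right[of V W r "p - q" q] by simp
    have "pm.subspace U"
      unfolding U_def
      by (rule pm.subspaceI)
        (auto simp: free_pair_mult_add_right scale_right pm.subspace_0[OF sub]
           intro: pm.subspace_add[OF sub] pm.subspace_scale[OF sub])
    with p have "p \<in> U"
    proof (rule tensor_relations_induct)
      show "Poly_Mapping.single (v \<oplus>\<^bsub>V\<^esub> v', w) 1 - Poly_Mapping.single (v, w) 1 - Poly_Mapping.single (v', w) 1 \<in> U"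
        if "v \<in> carrier V" "v' \<in> carrier V" "w \<in> carrier W" for v v' w
        using pm.subspace_scale[OF sub tensor_relations_base(1)[of "x \<otimes>\<^bsub>V\<^esub> v" V "x \<otimes>\<^bsub>V\<^esub> v'" "y \<otimes>\<^bsub>W\<^esub> w" W], of d]
          that xy by (simp add: U_def diff V.r_distr pm.scale_right_diff_distrib)
      show "Poly_Mapping.single (v, w \<oplus>\<^bsub>W\<^esub> w') 1 - Poly_Mapping.single (v, w) 1 - Poly_Mapping.single (v, w') 1 \<in> U"
        if "v \<in> carrier V" "w \<in> carrier W" "w' \<in> carrier W" for v w w'
        using pm.subspace_scale[OF sub tensor_relations_base(2)[of "x \<otimes>\<^bsub>V\<^esub> v" V "y \<otimes>\<^bsub>W\<^esub> w" W "y \<otimes>\<^bsub>W\<^esub> w'"], of d]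
          that xy by (simp add: U_def diff W.r_distr pm.scale_right_diff_distrib)
      show "Poly_Mapping.single (c \<odot>\<^bsub>V\<^esub> v, w) 1 - Poly_Mapping.single (v, w) c \<in> U"
        if "v \<in> carrier V" "w \<in> carrier W" for c v w
        using pm.subspace_scale[OF sub tensor_relations_base(3)[of "x \<otimes>\<^bsub>V\<^esub> v" V "y \<otimes>\<^bsub>W\<^esub> w" W c], of d]
          that xy by (simp add: U_def diff V.smult_assoc2_right pm.scale_right_diff_distrib)
      show "Poly_Mapping.single (v, c \<odot>\<^bsub>W\<^esub> w) 1 - Poly_Mapping.single (v, w) c \<in> U"
        if "v \<in> carrier V" "w \<in> carrier W" for c v w
        using pm.subspace_scale[OF sub tensor_relations_base(4)[of "x \<otimes>\<^bsub>V\<^esub> v" V "y \<otimes>\<^bsub>W\<^esub> w" W c], of d]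
          that xy by (simp add: U_def diff W.smult_assoc2_right pm.scale_right_diff_distrib)
    qed
    then show ?thesis by (simp add: U_def)
  qed
  have mult: "q \<otimes>\<^bsub>?F\<^esub> p \<in> ?R" if p: "p \<in> ?R" and q: "q \<in> carrier ?F" for p q
    using q[simplified]
  proof (induction q rule: poly_mapping_keys_induct)
    case (single a c)
    then show ?case using gens[OF p] by (cases a) auto
  qed (simp_all add: free_pair_mult_add_left pm.subspace_0[OF sub] pm.subspace_add[OF sub])
  show ?thesis
  proof (rule idealI)
    show "subgroup ?R (add_monoid ?F)"
    proof (rule F.add.subgroupI)
      show "?R \<noteq> {}" using pm.subspace_0[OF sub] by blast
      show "\<ominus>\<^bsub>?F\<^esub> p \<in> ?R" if "p \<in> ?R" for p
        using that neg[OF carr[OF that]] pm.subspace_neg[OF sub] by simp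
    qed (use carr pm.subspace_add[OF sub] in auto)
    show "p \<otimes>\<^bsub>?F\<^esub> q \<in> ?R" if "p \<in> ?R" "q \<in> carrier ?F" for p q
      using mult[OF that] F.m_comm[of p q] carr that by simp
  qed (use mult F.ring_axioms in auto)
qed

lemma tensor_coset:
  "tensor_relations V W +>\<^bsub>free_pair_algebra V W\<^esub> p = (\<lambda>r. r + p) ` tensor_relations V W"
  by (auto simp: a_r_coset_def')

text \<open>Cosets are translates in the additive group of the whole type, so the equivalence holds
  for all \<open>p\<close>, \<open>q\<close> and all records. In this generality it also serves the
  tensor square of the finite dual, of which only the linear structure is studied below.\<close>

lemma tensor_coset_eq_iff:
  "tensor_relations V W +>\<^bsub>free_pair_algebra V W\<^esub> p = tensor_relations V W +>\<^bsub>free_pair_algebra V W\<^esub> q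
     \<longleftrightarrow> p - q \<in> tensor_relations V W"
proof
  note sub = subspace_tensor_relations[of V W]
  assume "tensor_relations V W +>\<^bsub>free_pair_algebra V W\<^esub> p = tensor_relations V W +>\<^bsub>free_pair_algebra V W\<^esub> q"
  then have "(\<lambda>r. r + p) ` tensor_relations V W = (\<lambda>r. r + q) ` tensor_relations V W"
    by (simp only: tensor_coset)
  moreover have "0 + p \<in> (\<lambda>r. r + p) ` tensor_relations V W"
    using pm.subspace_0[OF sub] by blast
  ultimately have "p \<in> (\<lambda>r. r + q) ` tensor_relations V W" by simp
  then show "p - q \<in> tensor_relations V W" by auto
next
  note sub = subspace_tensor_relations[of V W]
  assume pq: "p - q \<in> tensor_relations V W"
  have "(\<lambda>r. r + p) ` tensor_relations V W = (\<lambda>r. r + q) ` tensor_relations V W"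
  proof safe
    fix r assume "r \<in> tensor_relations V W"
    then have "r + (p - q) \<in> tensor_relations V W" "r - (p - q) \<in> tensor_relations V W"
      using pq pm.subspace_add[OF sub] pm.subspace_diff[OF sub] by blast+
    then show "r + p \<in> (\<lambda>r. r + q) ` tensor_relations V W" "r + q \<in> (\<lambda>r. r + p) ` tensor_relations V W"
      by (auto intro: image_eqI[of "r + p" _ "r + (p - q)"] image_eqI[of "r + q" _ "r - (p - q)"])
  qed
  then show "tensor_relations V W +>\<^bsub>free_pair_algebra V W\<^esub> p = tensor_relations V W +>\<^bsub>free_pair_algebra V W\<^esub> q"
    by (simp only: tensor_coset)
qed

lemma carrier_tensor_algebra:
  "carrier (tensor_algebra V W) =
     (\<lambda>p. tensor_relations V W +>\<^bsub>free_pair_algebra V W\<^esub> p) ` {p. Poly_Mapping.keys p \<subseteq> carrier V \<times> carrier W}"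
  by (auto simp: tensor_algebra_def quotient_algebra_sel FactRing_def A_RCOSETS_def' a_r_coset_def')

lemma comm_algebra_tensor:
  assumes "comm_algebra V" "comm_algebra W"
  shows "comm_algebra (tensor_algebra V W)"
  unfolding tensor_algebra_def
  by (rule comm_algebra.comm_algebra_quotient[OF comm_algebra_free_pair[OF assms] ideal_tensor_relations[OF assms]])

lemma pure_tensor_closed:
  "v \<in> carrier V \<Longrightarrow> w \<in> carrier W \<Longrightarrow> pure_tensor V W v w \<in> carrier (tensor_algebra V W)"
  by (auto simp: pure_tensor_def carrier_tensor_algebra keys_single)

lemma tensor_algebra_ops:
  assumes "comm_algebra V" "comm_algebra W"
    and "Poly_Mapping.keys p \<subseteq> carrier V \<times> carrier W"
  defines "\<pi> \<equiv> \<lambda>p. tensor_relations V W +>\<^bsub>free_pair_algebra V W\<^esub> p"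
  shows "Poly_Mapping.keys q \<subseteq> carrier V \<times> carrier W \<Longrightarrow>
           \<pi> p \<otimes>\<^bsub>tensor_algebra V W\<^esub> \<pi> q = \<pi> (p \<otimes>\<^bsub>free_pair_algebra V W\<^esub> q)"
    and "Poly_Mapping.keys q \<subseteq> carrier V \<times> carrier W \<Longrightarrow>
           \<pi> p \<oplus>\<^bsub>tensor_algebra V W\<^esub> \<pi> q = \<pi> (p + q)"
    and "c \<odot>\<^bsub>tensor_algebra V W\<^esub> \<pi> p = \<pi> (pm_scale c p)"
    and "\<one>\<^bsub>tensor_algebra V W\<^esub> = \<pi> \<one>\<^bsub>free_pair_algebra V W\<^esub>"
proof -
  interpret F: comm_algebra "free_pair_algebra V W" by (rule comm_algebra_free_pair) fact+
  note simps = F.quotient_algebra_simps[OF ideal_tensor_relations[OF assms(1,2)], folded tensor_algebra_def \<pi>_def]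
  show "Poly_Mapping.keys q \<subseteq> carrier V \<times> carrier W \<Longrightarrow>
           \<pi> p \<otimes>\<^bsub>tensor_algebra V W\<^esub> \<pi> q = \<pi> (p \<otimes>\<^bsub>free_pair_algebra V W\<^esub> q)"
    and "Poly_Mapping.keys q \<subseteq> carrier V \<times> carrier W \<Longrightarrow>
           \<pi> p \<oplus>\<^bsub>tensor_algebra V W\<^esub> \<pi> q = \<pi> (p + q)"
    and "c \<odot>\<^bsub>tensor_algebra V W\<^esub> \<pi> p = \<pi> (pm_scale c p)"
    and "\<one>\<^bsub>tensor_algebra V W\<^esub> = \<pi> \<one>\<^bsub>free_pair_algebra V W\<^esub>"
    using assms(3) by (simp_all add: simps del: free_pair_algebra_sel(2))
qed

lemma
  assumes "comm_algebra V" "comm_algebra W" "v \<in> carrier V" "w \<in> carrier W"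
  shows pure_tensor_add_left: "v' \<in> carrier V \<Longrightarrow>
      pure_tensor V W (v \<oplus>\<^bsub>V\<^esub> v') w = pure_tensor V W v w \<oplus>\<^bsub>tensor_algebra V W\<^esub> pure_tensor V W v' w"
    and pure_tensor_add_right: "w' \<in> carrier W \<Longrightarrow>
      pure_tensor V W v (w \<oplus>\<^bsub>W\<^esub> w') = pure_tensor V W v w \<oplus>\<^bsub>tensor_algebra V W\<^esub> pure_tensor V W v w'"
    and pure_tensor_smult_left:
      "pure_tensor V W (c \<odot>\<^bsub>V\<^esub> v) w = c \<odot>\<^bsub>tensor_algebra V W\<^esub> pure_tensor V W v w"
    and pure_tensor_smult_right:
      "pure_tensor V W v (c \<odot>\<^bsub>W\<^esub> w) = c \<odot>\<^bsub>tensor_algebra V W\<^esub> pure_tensor V W v w"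
    and pure_tensor_mult: "v' \<in> carrier V \<Longrightarrow> w' \<in> carrier W \<Longrightarrow>
      pure_tensor V W v w \<otimes>\<^bsub>tensor_algebra V W\<^esub> pure_tensor V W v' w' =
        pure_tensor V W (v \<otimes>\<^bsub>V\<^esub> v') (w \<otimes>\<^bsub>W\<^esub> w')"
  unfolding pure_tensor_def
  using assms(3,4)
  by (simp_all add: tensor_algebra_ops[OF assms(1,2)] keys_single tensor_coset_eq_iff
      tensor_relations_base diff_diff_eq[symmetric])

lemma
  assumes V: "comm_algebra V" and W: "comm_algebra W" and f: "f \<in> S \<rightarrow> carrier V" and g: "g \<in> S \<rightarrow> carrier W"
  shows pure_tensor_finsum_left: "w \<in> carrier W \<Longrightarrow>
      pure_tensor V W (finsum V f S) w = finsum (tensor_algebra V W) (\<lambda>i. pure_tensor V W (f i) w) S"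
    and pure_tensor_finsum_right: "v \<in> carrier V \<Longrightarrow>
      pure_tensor V W v (finsum W g S) = finsum (tensor_algebra V W) (\<lambda>i. pure_tensor V W v (g i)) S"
proof -
  interpret V: comm_algebra V by fact
  interpret W: comm_algebra W by fact
  interpret T: comm_algebra "tensor_algebra V W" by (rule comm_algebra_tensor) fact+
  note closed = pure_tensor_closed[of _ V _ W]
  have zero_left: "pure_tensor V W \<zero>\<^bsub>V\<^esub> w = \<zero>\<^bsub>tensor_algebra V W\<^esub>" if "w \<in> carrier W" for w
    using pure_tensor_smult_left[OF V W V.zero_closed that, of 0] that closed by simp
  have zero_right: "pure_tensor V W v \<zero>\<^bsub>W\<^esub> = \<zero>\<^bsub>tensor_algebra V W\<^esub>" if "v \<in> carrier V" for v
    using pure_tensor_smult_right[OF V W that W.zero_closed, of 0] that closed by simp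
  show "pure_tensor V W (finsum V f S) w = finsum (tensor_algebra V W) (\<lambda>i. pure_tensor V W (f i) w) S"
    if w: "w \<in> carrier W"
    using f
  proof (induction S rule: infinite_finite_induct)
    case (insert x S)
    then have fS: "f \<in> S \<rightarrow> carrier V" and fx: "f x \<in> carrier V" by auto
    then have "(\<lambda>i. pure_tensor V W (f i) w) \<in> S \<rightarrow> carrier (tensor_algebra V W)"
      using w closed by auto
    with insert fS fx w closed show ?case
      by (simp add: V.finsum_insert T.finsum_insert pure_tensor_add_left[OF V W] V.finsum_closed)
  qed (auto simp: zero_left w)
  show "pure_tensor V W v (finsum W g S) = finsum (tensor_algebra V W) (\<lambda>i. pure_tensor V W v (g i)) S"
    if v: "v \<in> carrier V"
    using g
  proof (induction S rule: infinite_finite_induct)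
    case (insert x S)
    then have gS: "g \<in> S \<rightarrow> carrier W" and gx: "g x \<in> carrier W" by auto
    then have "(\<lambda>i. pure_tensor V W v (g i)) \<in> S \<rightarrow> carrier (tensor_algebra V W)"
      using v closed by auto
    with insert gS gx v closed show ?case
      by (simp add: W.finsum_insert T.finsum_insert pure_tensor_add_right[OF V W] W.finsum_closed)
  qed (auto simp: zero_right v)
qed

section \<open>Bilinear forms as functionals on tensors\<close>

definition bilinear_form ::
  "('k::field, 'v, 'x) module_scheme \<Rightarrow> ('k, 'w, 'y) module_scheme \<Rightarrow> ('v \<Rightarrow> 'w \<Rightarrow> 'k) \<Rightarrow> bool" where
  "bilinear_form V W \<phi> \<longleftrightarrow>
     (\<forall>v\<in>carrier V. \<forall>v'\<in>carrier V. \<forall>w\<in>carrier W. \<phi> (v \<oplus>\<^bsub>V\<^esub> v') w = \<phi> v w + \<phi> v' w) \<and>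
     (\<forall>v\<in>carrier V. \<forall>w\<in>carrier W. \<forall>w'\<in>carrier W. \<phi> v (w \<oplus>\<^bsub>W\<^esub> w') = \<phi> v w + \<phi> v w') \<and>
     (\<forall>c. \<forall>v\<in>carrier V. \<forall>w\<in>carrier W. \<phi> (c \<odot>\<^bsub>V\<^esub> v) w = c * \<phi> v w) \<and>
     (\<forall>c. \<forall>v\<in>carrier V. \<forall>w\<in>carrier W. \<phi> v (c \<odot>\<^bsub>W\<^esub> w) = c * \<phi> v w)"

text \<open>The kernel of \<open>pm_eval\<close> is a subspace, and bilinearity of
  \<open>\<phi>\<close> says that it contains the generators of the relations.\<close>

lemma pm_eval_tensor_relations:
  assumes "bilinear_form V W \<phi>" "p \<in> tensor_relations V W"
  shows "pm_eval (case_prod \<phi>) p = 0"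
proof -
  have "pm.subspace {p. pm_eval (case_prod \<phi>) p = 0}"
    by (rule pm.subspaceI) (auto simp: pm_eval_add pm_eval_scale)
  with assms(2) have "p \<in> {p. pm_eval (case_prod \<phi>) p = 0}"
    by (rule tensor_relations_induct) (use assms(1) in \<open>auto simp: bilinear_form_def pm_eval_diff\<close>)
  then show ?thesis by simp
qed

text \<open>This is the well-definedness of \<open>tensor_eval\<close>: representatives differ by a
  relation and so have equal values, which leaves a singleton for \<open>the_elem\<close>.\<close>

lemma tensor_eval_coset:
  assumes "bilinear_form V W \<phi>"
  shows "tensor_eval \<phi> (tensor_relations V W +>\<^bsub>free_pair_algebra V W\<^esub> p) = pm_eval (case_prod \<phi>) p"
proof -
  have "tensor_relations V W \<noteq> {}"
    using pm.subspace_0[OF subspace_tensor_relations[of V W]] by blast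
  then have "pm_eval (case_prod \<phi>) ` (tensor_relations V W +>\<^bsub>free_pair_algebra V W\<^esub> p) = {pm_eval (case_prod \<phi>) p}"
    unfolding tensor_coset image_image
    by (auto simp: pm_eval_add pm_eval_tensor_relations[OF assms] image_constant_conv)
  then show ?thesis
    unfolding tensor_eval_def pm_eval_def[abs_def] by (simp add: case_prod_unfold)
qed

lemma tensor_eval_pure_tensor:
  "bilinear_form V W \<phi> \<Longrightarrow> tensor_eval \<phi> (pure_tensor V W v w) = \<phi> v w"
  by (simp add: pure_tensor_def tensor_eval_coset)

text \<open>The functional f \<otimes> g is multiplicative because f and g are and the field is
  commutative; by bilinearity of both sides it is enough to check basis pairs. Composed with
  \<Delta> it becomes the convolution of two characters.\<close>

lemma tensor_eval_alg_hom:
  assumes V: "comm_algebra V" and W: "comm_algebra W"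
    and f: "f \<in> alg_hom V ground_algebra" and g: "g \<in> alg_hom W ground_algebra"
  shows "(\<lambda>t\<in>carrier (tensor_algebra V W). tensor_eval (\<lambda>v w. f v * g w) t)
           \<in> alg_hom (tensor_algebra V W) ground_algebra"
proof -
  interpret V: comm_algebra V by fact
  interpret W: comm_algebra W by fact
  interpret T: comm_algebra "tensor_algebra V W" by (rule comm_algebra_tensor) fact+
  let ?\<phi> = "\<lambda>v w. f v * g w" and ?F = "free_pair_algebra V W"
  interpret F: comm_algebra ?F by (rule comm_algebra_free_pair) fact+
  note f = alg_homD[OF f] and g = alg_homD[OF g]
  have bil: "bilinear_form V W ?\<phi>"
    by (auto simp: bilinear_form_def f g algebra_simps)
  have mult: "pm_eval (case_prod ?\<phi>) (p \<otimes>\<^bsub>?F\<^esub> q) = pm_eval (case_prod ?\<phi>) p * pm_eval (case_prod ?\<phi>) q"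
    if p: "Poly_Mapping.keys p \<subseteq> carrier V \<times> carrier W" and q: "Poly_Mapping.keys q \<subseteq> carrier V \<times> carrier W" for p q
    using p
  proof (induction p rule: poly_mapping_keys_induct)
    case (single a c)
    from q show ?case
    proof (induction q rule: poly_mapping_keys_induct)
      case (single b d)
      with \<open>a \<in> _\<close> show ?case by (cases a; cases b) (auto simp: f g)
    qed (simp_all add: free_pair_mult_add_right pm_eval_add distrib_left)
  qed (simp_all add: free_pair_mult_add_left pm_eval_add distrib_right)
  let ?e = "\<lambda>t\<in>carrier (tensor_algebra V W). tensor_eval ?\<phi> t"
  let ?\<pi> = "\<lambda>p. tensor_relations V W +>\<^bsub>?F\<^esub> p"
  have e: "?e (?\<pi> p) = pm_eval (case_prod ?\<phi>) p" if "Poly_Mapping.keys p \<subseteq> carrier V \<times> carrier W"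
      for p
    using that by (simp add: carrier_tensor_algebra tensor_eval_coset[OF bil])
  show ?thesis
  proof (rule alg_homI)
    fix X assume "X \<in> carrier (tensor_algebra V W)"
    then obtain p where X: "X = ?\<pi> p" and p: "Poly_Mapping.keys p \<subseteq> carrier V \<times> carrier W"
      by (auto simp only: carrier_tensor_algebra)
    have "Poly_Mapping.keys (pm_scale c p) \<subseteq> carrier V \<times> carrier W" for c
      using p keys_pm_scale[of c p] by blast
    then show "?e (c \<odot>\<^bsub>tensor_algebra V W\<^esub> X) = c \<odot>\<^bsub>ground_algebra\<^esub> ?e X" for c
      unfolding X tensor_algebra_ops[OF V W p] using p
      by (simp only: e pm_eval_scale ground_algebra_simps)
    fix Y assume "Y \<in> carrier (tensor_algebra V W)"
    then obtain q where Y: "Y = ?\<pi> q" and q: "Poly_Mapping.keys q \<subseteq> carrier V \<times> carrier W"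
      by (auto simp only: carrier_tensor_algebra)
    have "p \<otimes>\<^bsub>?F\<^esub> q \<in> carrier ?F" "p \<oplus>\<^bsub>?F\<^esub> q \<in> carrier ?F"
      using F.m_closed[of p q] F.add.m_closed[of p q] p q by simp_all
    then have "Poly_Mapping.keys (p \<otimes>\<^bsub>?F\<^esub> q) \<subseteq> carrier V \<times> carrier W"
      "Poly_Mapping.keys (p + q) \<subseteq> carrier V \<times> carrier W"
      by simp_all
    then show "?e (X \<otimes>\<^bsub>tensor_algebra V W\<^esub> Y) = ?e X \<otimes>\<^bsub>ground_algebra\<^esub> ?e Y"
      and "?e (X \<oplus>\<^bsub>tensor_algebra V W\<^esub> Y) = ?e X \<oplus>\<^bsub>ground_algebra\<^esub> ?e Y"
      unfolding X Y tensor_algebra_ops(1,2)[OF V W p q] using p q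
      by (simp_all only: e mult pm_eval_add ground_algebra_simps)
  next
    have "Poly_Mapping.keys \<one>\<^bsub>?F\<^esub> \<subseteq> carrier V \<times> carrier W"
      using F.one_closed by simp
    moreover have "\<one>\<^bsub>tensor_algebra V W\<^esub> = ?\<pi> \<one>\<^bsub>?F\<^esub>"
      by (rule tensor_algebra_ops[OF V W, of 0]) simp
    ultimately show "?e \<one>\<^bsub>tensor_algebra V W\<^esub> = \<one>\<^bsub>ground_algebra\<^esub>"
      by (simp only: e) (simp add: f g)
  qed simp_all
qed

section \<open>Polynomial algebras\<close>

lemma polynomial_algebra_sel [simp]:
  "carrier (polynomial_algebra V) = {p. Poly_Mapping.keys p \<subseteq> {m. Poly_Mapping.keys m \<subseteq> V}}"
  "monoid.mult (polynomial_algebra V) = (*)" "one (polynomial_algebra V) = 1"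
  "zero (polynomial_algebra V) = 0" "add (polynomial_algebra V) = (+)"
  "smult (polynomial_algebra V) = pm_scale"
  by (auto simp add: polynomial_algebra_def)

lemma pm_scale_eq_mult: "pm_scale c p = Poly_Mapping.single 0 c * p"
  unfolding pm_scale_def by (rule mult_map_scale_conv_mult)

lemma pm_scale_mult_left: "pm_scale c p * q = pm_scale c (p * q)"
  by (simp add: pm_scale_eq_mult mult.assoc)

lemma comm_algebra_polynomial:
  "comm_algebra (polynomial_algebra V :: ('k::field, ('v \<Rightarrow>\<^sub>0 nat) \<Rightarrow>\<^sub>0 'k) module)"
proof -
  let ?P = "polynomial_algebra V :: ('k, ('v \<Rightarrow>\<^sub>0 nat) \<Rightarrow>\<^sub>0 'k) module" and ?M = "{m :: 'v \<Rightarrow>\<^sub>0 nat. Poly_Mapping.keys m \<subseteq> V}"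
  have add: "Poly_Mapping.keys (p + q) \<subseteq> ?M"
    if "Poly_Mapping.keys p \<subseteq> ?M" "Poly_Mapping.keys q \<subseteq> ?M" for p q :: "('v \<Rightarrow>\<^sub>0 nat) \<Rightarrow>\<^sub>0 'k"
    using that Poly_Mapping.keys_add[of p q] by blast
  have mult: "Poly_Mapping.keys (p * q) \<subseteq> ?M"
    if "Poly_Mapping.keys p \<subseteq> ?M" "Poly_Mapping.keys q \<subseteq> ?M" for p q :: "('v \<Rightarrow>\<^sub>0 nat) \<Rightarrow>\<^sub>0 'k"
  proof
    fix m assume "m \<in> Poly_Mapping.keys (p * q)"
    then obtain a b where "m = a + b" "a \<in> Poly_Mapping.keys p" "b \<in> Poly_Mapping.keys q"
      using keys_mult[of p q] by blast
    with that Poly_Mapping.keys_add[of a b] show "m \<in> ?M" by blast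
  qed
  have neg: "\<exists>q. Poly_Mapping.keys q \<subseteq> ?M \<and> p + q = 0" if "Poly_Mapping.keys p \<subseteq> ?M"
    for p :: "('v \<Rightarrow>\<^sub>0 nat) \<Rightarrow>\<^sub>0 'k"
    by (rule exI[of _ "- p"]) (use that in \<open>auto simp: in_keys_iff\<close>)
  have scale: "Poly_Mapping.keys (pm_scale c p) \<subseteq> ?M" if "Poly_Mapping.keys p \<subseteq> ?M"
    for c and p :: "('v \<Rightarrow>\<^sub>0 nat) \<Rightarrow>\<^sub>0 'k"
    using that keys_pm_scale[of c p] by blast
  have ab: "abelian_group ?P"
    by (rule abelian_groupI) (simp_all add: neg add add.assoc add.commute add.left_commute)
  have mon: "Group.comm_monoid ?P"
    by (rule comm_monoidI) (simp_all add: mult mult.assoc mult.commute mult.left_commute)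
  show ?thesis
    by (intro comm_algebra.intro comm_algebra_axioms.intro cringI ab mon)
      (simp_all add: scale pm.scale_left_distrib pm.scale_right_distrib distrib_right pm_scale_mult_left)
qed

lemma keys_poly_var: "Poly_Mapping.keys (poly_var v) \<subseteq> {m. Poly_Mapping.keys m \<subseteq> V} \<longleftrightarrow> v \<in> V"
  by (simp add: poly_var_def keys_single)

lemma poly_var_closed: "v \<in> V \<Longrightarrow> poly_var v \<in> carrier (polynomial_algebra V)"
  by (simp add: keys_poly_var)

text \<open>Scalars and variables generate the polynomial algebra. The carrier premises of the last
  two cases are those under which a homomorphism respects sums and products.\<close>

lemma polynomial_induct [consumes 1, case_names scalar var add mult]:
  fixes p :: "('v \<Rightarrow>\<^sub>0 nat) \<Rightarrow>\<^sub>0 'k::field"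
  assumes p: "p \<in> carrier (polynomial_algebra V)"
    and scalar: "\<And>c. Q (pm_scale c 1)"
    and var: "\<And>v. v \<in> V \<Longrightarrow> Q (poly_var v)"
    and add: "\<And>p q. p \<in> carrier (polynomial_algebra V) \<Longrightarrow> q \<in> carrier (polynomial_algebra V) \<Longrightarrow>
                Q p \<Longrightarrow> Q q \<Longrightarrow> Q (p + q)"
    and mult: "\<And>p q. p \<in> carrier (polynomial_algebra V) \<Longrightarrow> q \<in> carrier (polynomial_algebra V) \<Longrightarrow>
                Q p \<Longrightarrow> Q q \<Longrightarrow> Q (p * q)"
  shows "Q p"
proof -
  interpret P: comm_algebra "polynomial_algebra V :: ('k, ('v \<Rightarrow>\<^sub>0 nat) \<Rightarrow>\<^sub>0 'k) module" by (rule comm_algebra_polynomial)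
  \<comment> \<open>Membership in the carrier is bundled with \<open>Q\<close>, since
    \<open>add\<close> and \<open>mult\<close> ask for both.\<close>
  define G where "G p \<longleftrightarrow> p \<in> carrier (polynomial_algebra V) \<and> Q p" for p
  have G0: "G (pm_scale c 1)" for c
    using scalar P.smult_closed[OF P.one_closed, of c] by (simp add: G_def)
  have Gmult: "G p \<Longrightarrow> G q \<Longrightarrow> G (p * q)" for p q
    using mult P.m_closed[of p q] by (simp add: G_def)
  have Gvar: "v \<in> V \<Longrightarrow> G (poly_var v)" for v
    using var poly_var_closed by (simp add: G_def)
  have G1: "G 1" using G0[of 1] by simp
  have Gmon: "G (Poly_Mapping.single m 1)" if "Poly_Mapping.keys m \<subseteq> V" for m :: "'v \<Rightarrow>\<^sub>0 nat"
    using that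
  proof (induction m rule: poly_mapping_keys_induct)
    case (single v k)
    have "G (Poly_Mapping.single (Poly_Mapping.single v k) 1)"
    proof (induction k)
      case (Suc k)
      have "Poly_Mapping.single (Poly_Mapping.single v (Suc k)) 1 =
          (poly_var v * Poly_Mapping.single (Poly_Mapping.single v k) 1 :: ('v \<Rightarrow>\<^sub>0 nat) \<Rightarrow>\<^sub>0 'k)"
        unfolding poly_var_def mult_single by (simp flip: single_add)
      with Suc Gvar[OF single] show ?case by (simp add: Gmult)
    qed (simp add: G1)
    then show ?case .
  next
    case (add p q)
    then show ?case using Gmult by (metis mult_single mult_1)
  qed (simp add: G1)
  show ?thesis
    using p[simplified]
  proof (induction p rule: poly_mapping_keys_induct)
    case (single m c)
    then have "G (pm_scale c 1 * Poly_Mapping.single m 1)"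
      using Gmon G0 Gmult by blast
    moreover have "pm_scale c 1 * Poly_Mapping.single m 1 = Poly_Mapping.single m c"
      by (simp add: pm_scale_eq_mult mult_single)
    ultimately show ?case by (simp add: G_def)
  qed (use scalar[of 0] add in auto)
qed

text \<open>Monomials are sent to products of powers and the map is extended linearly; two nested
  inductions reduce multiplicativity to pairs of monomials.\<close>

lemma polynomial_eval_exists:
  fixes B :: "('k::field, 'b, 'x) module_scheme" and V :: "'v set"
  assumes "comm_algebra B" and b: "\<And>v. v \<in> V \<Longrightarrow> b v \<in> carrier B"
  obtains f where "f \<in> alg_hom (polynomial_algebra V) B" "\<And>v. v \<in> V \<Longrightarrow> f (poly_var v) = b v"
proof -
  interpret B: comm_algebra B by fact
  interpret P: comm_algebra "polynomial_algebra V" by (rule comm_algebra_polynomial)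
  let ?M = "{m :: 'v \<Rightarrow>\<^sub>0 nat. Poly_Mapping.keys m \<subseteq> V}"
  define mon where "mon m = (\<Otimes>\<^bsub>B\<^esub>v\<in>Poly_Mapping.keys m. b v [^]\<^bsub>B\<^esub> Poly_Mapping.lookup m v)"
      for m :: "'v \<Rightarrow>\<^sub>0 nat"
  define f where "f p = (\<Oplus>\<^bsub>B\<^esub>m\<in>Poly_Mapping.keys p. Poly_Mapping.lookup p m \<odot>\<^bsub>B\<^esub> mon m)" for p
  have mon_closed: "mon m \<in> carrier B" if "m \<in> ?M" for m
    unfolding mon_def using that by (intro B.finprod_closed) (auto intro!: B.nat_pow_closed b)
  \<comment> \<open>The supports of \<open>m\<close>, \<open>m'\<close> and \<open>m + m'\<close>
    differ, so products are compared over a common finite superset, where exponent zero contributes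
    the factor one. \<open>f_super\<close> does the same for coefficients, where cancellation can
    also shrink the support of a sum.\<close>
  have mon_super: "mon m = (\<Otimes>\<^bsub>B\<^esub>v\<in>S. b v [^]\<^bsub>B\<^esub> Poly_Mapping.lookup m v)"
    if "finite S" "Poly_Mapping.keys m \<subseteq> S" "S \<subseteq> V" for m S
    unfolding mon_def using that b
    by (intro B.finprod_mono_neutral_cong_left) (auto simp: in_keys_iff)
  have mon_add: "mon (m + m') = mon m \<otimes>\<^bsub>B\<^esub> mon m'" if "m \<in> ?M" "m' \<in> ?M" for m m'
  proof -
    let ?S = "Poly_Mapping.keys m \<union> Poly_Mapping.keys m'"
    have S: "finite ?S" "?S \<subseteq> V" using that by auto
    have "mon (m + m') = (\<Otimes>\<^bsub>B\<^esub>v\<in>?S. b v [^]\<^bsub>B\<^esub> Poly_Mapping.lookup m v \<otimes>\<^bsub>B\<^esub> b v [^]\<^bsub>B\<^esub> Poly_Mapping.lookup m' v)"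
      using S b Poly_Mapping.keys_add[of m m']
      by (subst mon_super[OF S(1) _ S(2)]) (auto intro!: B.finprod_cong' simp: lookup_add B.nat_pow_mult)
    also have "\<dots> = mon m \<otimes>\<^bsub>B\<^esub> mon m'"
      using S b by (subst B.finprod_multf) (auto simp: mon_super[OF S(1) _ S(2)])
    finally show ?thesis .
  qed
  have f_super: "f p = (\<Oplus>\<^bsub>B\<^esub>m\<in>S. Poly_Mapping.lookup p m \<odot>\<^bsub>B\<^esub> mon m)"
    if "finite S" "Poly_Mapping.keys p \<subseteq> S" "S \<subseteq> ?M" for p S
    unfolding f_def using that mon_closed
    by (intro B.add.finprod_mono_neutral_cong_left) (auto simp: in_keys_iff)
  have f_closed: "f p \<in> carrier B" if "Poly_Mapping.keys p \<subseteq> ?M" for p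
    unfolding f_def using that mon_closed by (intro B.finsum_closed) auto
  have f_zero: "f 0 = \<zero>\<^bsub>B\<^esub>"
    by (simp add: f_def)
  have f_add: "f (p + q) = f p \<oplus>\<^bsub>B\<^esub> f q" if "Poly_Mapping.keys p \<subseteq> ?M" "Poly_Mapping.keys q \<subseteq> ?M"
      for p q
  proof -
    let ?S = "Poly_Mapping.keys p \<union> Poly_Mapping.keys q"
    have S: "finite ?S" "?S \<subseteq> ?M" using that by auto
    have "f (p + q) = (\<Oplus>\<^bsub>B\<^esub>m\<in>?S. Poly_Mapping.lookup p m \<odot>\<^bsub>B\<^esub> mon m \<oplus>\<^bsub>B\<^esub> Poly_Mapping.lookup q m \<odot>\<^bsub>B\<^esub> mon m)"
      using S mon_closed Poly_Mapping.keys_add[of p q]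
      by (subst f_super[OF S(1) _ S(2)]) (auto intro!: B.finsum_cong' simp: lookup_add B.smult_l_distr)
    also have "\<dots> = f p \<oplus>\<^bsub>B\<^esub> f q"
      using S mon_closed by (subst B.finsum_addf) (auto simp: f_super[OF S(1) _ S(2)])
    finally show ?thesis .
  qed
  have f_single: "f (Poly_Mapping.single m c) = c \<odot>\<^bsub>B\<^esub> mon m" if "m \<in> ?M" for m c
    using f_super[of "{m}" "Poly_Mapping.single m c"] that mon_closed[OF that]
    by (simp add: keys_single B.finsum_insert)
  have mon_0: "mon 0 = \<one>\<^bsub>B\<^esub>"
    by (simp add: mon_def)
  have f_mult: "f (p * q) = f p \<otimes>\<^bsub>B\<^esub> f q" if p: "Poly_Mapping.keys p \<subseteq> ?M"
      and q: "Poly_Mapping.keys q \<subseteq> ?M" for p q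
    using p
  proof (induction p rule: poly_mapping_keys_induct)
    case (single m c)
    from q show ?case
    proof (induction q rule: poly_mapping_keys_induct)
      case (single m' d)
      have "m + m' \<in> ?M" using \<open>m \<in> ?M\<close> single Poly_Mapping.keys_add[of m m'] by blast
      with \<open>m \<in> ?M\<close> single show ?case
        using mon_closed by (simp only: mult_single f_single mon_add B.smult_mult_smult)
    next
      case (add p q)
      have s: "Poly_Mapping.keys (Poly_Mapping.single m c) \<subseteq> ?M"
        using \<open>m \<in> ?M\<close> by (simp add: keys_single)
      then show ?case
        using add P.m_closed[of "Poly_Mapping.single m c" p] P.m_closed[of "Poly_Mapping.single m c" q]
        by (simp add: distrib_left f_add B.r_distr f_closed)
    next
      case zero
      have "Poly_Mapping.keys (Poly_Mapping.single m c) \<subseteq> ?M"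
        using \<open>m \<in> ?M\<close> by (simp add: keys_single)
      then show ?case by (simp add: f_zero f_closed)
    qed
  next
    case (add p p')
    then show ?case
      using P.m_closed[of p q] P.m_closed[of p' q] q
      by (simp add: distrib_right f_add B.l_distr f_closed)
  qed (simp add: f_zero f_closed q)
  have f_one: "f 1 = \<one>\<^bsub>B\<^esub>"
    using f_single[of 0 1] by (simp add: mon_0)
  have f_scale: "f (pm_scale c p) = c \<odot>\<^bsub>B\<^esub> f p" if "Poly_Mapping.keys p \<subseteq> ?M" for c p
    using that f_closed[OF that] f_single[of 0 c]
    by (simp add: pm_scale_eq_mult f_mult keys_single mon_0 B.smult_assoc2)
  have f_var: "f (poly_var v) = b v" if "v \<in> V" for v
    using that b[OF that] f_single[of "Poly_Mapping.single v 1" 1] mon_closed[of "Poly_Mapping.single v 1"]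
    by (simp add: poly_var_def keys_single mon_def B.finprod_insert)
  let ?C = "carrier (polynomial_algebra V)"
  have hom: "p \<in> ?C \<Longrightarrow> f p \<in> carrier B"
    "p \<in> ?C \<Longrightarrow> q \<in> ?C \<Longrightarrow> f (p * q) = f p \<otimes>\<^bsub>B\<^esub> f q"
    "p \<in> ?C \<Longrightarrow> q \<in> ?C \<Longrightarrow> f (p + q) = f p \<oplus>\<^bsub>B\<^esub> f q"
    "p \<in> ?C \<Longrightarrow> f (pm_scale c p) = c \<odot>\<^bsub>B\<^esub> f p" for p q c
    using f_closed f_mult f_add f_scale by auto
  note closed = P.one_closed[unfolded polynomial_algebra_sel(3)] P.m_closed[unfolded polynomial_algebra_sel(2)]
    P.add.m_closed[unfolded polynomial_algebra_sel(5)] P.smult_closed[unfolded polynomial_algebra_sel(6)]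
  show ?thesis
  proof (rule that)
    show "restrict f (carrier (polynomial_algebra V)) \<in> alg_hom (polynomial_algebra V) B"
      by (intro alg_homI) (simp_all add: hom closed f_one del: polynomial_algebra_sel(1))
    show "restrict f (carrier (polynomial_algebra V)) (poly_var v) = b v" if "v \<in> V" for v
      by (simp add: f_var that poly_var_closed del: polynomial_algebra_sel(1))
  qed
qed

lemma polynomial_hom_eqI:
  assumes "comm_algebra B" "f \<in> alg_hom (polynomial_algebra V) B" "g \<in> alg_hom (polynomial_algebra V) B"
    and "\<And>v. v \<in> V \<Longrightarrow> f (poly_var v) = g (poly_var v)"
    and p: "p \<in> carrier (polynomial_algebra V)"
  shows "f p = g p"
proof -
  interpret P: comm_algebra "polynomial_algebra V" by (rule comm_algebra_polynomial)
  note f = alg_homD[OF assms(2)] and g = alg_homD[OF assms(3)]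
  from p show ?thesis
  proof (induction p rule: polynomial_induct)
    case (scalar c)
    then show ?case using f(4) g(4) f(5)[OF P.one_closed] g(5)[OF P.one_closed] by simp
  next
    case (add p q)
    then show ?case using f(3)[of p q] g(3)[of p q] by simp
  next
    case (mult p q)
    then show ?case using f(2)[of p q] g(2)[of p q] by simp
  qed (rule assms(4))
qed

section \<open>The universal bialgebra\<close>

text \<open>Otherwise \<open>{1..n}\<close> inside the algebra records is rewritten to \<open>{Suc 0..n}\<close> and no longer matches
  the interpreted facts.\<close>

declare One_nat_def [simp del]

text \<open>The defining relations of one operation with a matrix over \<open>B\<close> in place of
  the variables. Equivalently, the \<open>B\<close>-linear map sending \<open>e i\<close> to the sum
  of the \<open>M s i\<close> times \<open>e s\<close> respects the operation extended to
  \<open>B\<close>. One predicate covers the generic matrix, matrices over a tensor product and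
  scalar matrices.\<close>

definition structure_compatible ::
  "('k::field, 'b, 'x) module_scheme \<Rightarrow> nat \<Rightarrow> (nat \<Rightarrow> nat \<Rightarrow> nat \<Rightarrow> 'k) \<Rightarrow> (nat \<Rightarrow> nat \<Rightarrow> 'b) \<Rightarrow> bool" where
  "structure_compatible B n \<tau> M \<longleftrightarrow>
     (\<forall>a\<in>{1..n}. \<forall>i\<in>{1..n}. \<forall>j\<in>{1..n}.
        (\<Oplus>\<^bsub>B\<^esub>u\<in>{1..n}. \<tau> i j u \<odot>\<^bsub>B\<^esub> M a u) =
        (\<Oplus>\<^bsub>B\<^esub>s\<in>{1..n}. \<Oplus>\<^bsub>B\<^esub>t\<in>{1..n}. \<tau> s t a \<odot>\<^bsub>B\<^esub> (M s i \<otimes>\<^bsub>B\<^esub> M t j)))"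

lemma structure_compatible_cong:
  assumes "comm_algebra B"
    and M: "\<And>i j. i \<in> {1..n} \<Longrightarrow> j \<in> {1..n} \<Longrightarrow> M i j = M' i j"
    and M': "\<And>i j. i \<in> {1..n} \<Longrightarrow> j \<in> {1..n} \<Longrightarrow> M' i j \<in> carrier B"
  shows "structure_compatible B n \<tau> M \<longleftrightarrow> structure_compatible B n \<tau> M'"
proof -
  interpret B: comm_algebra B by fact
  have "(\<Oplus>\<^bsub>B\<^esub>u\<in>{1..n}. \<tau> i j u \<odot>\<^bsub>B\<^esub> M a u) = (\<Oplus>\<^bsub>B\<^esub>u\<in>{1..n}. \<tau> i j u \<odot>\<^bsub>B\<^esub> M' a u)"
    "(\<Oplus>\<^bsub>B\<^esub>s\<in>{1..n}. \<Oplus>\<^bsub>B\<^esub>t\<in>{1..n}. \<tau> s t a \<odot>\<^bsub>B\<^esub> (M s i \<otimes>\<^bsub>B\<^esub> M t j)) =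
     (\<Oplus>\<^bsub>B\<^esub>s\<in>{1..n}. \<Oplus>\<^bsub>B\<^esub>t\<in>{1..n}. \<tau> s t a \<odot>\<^bsub>B\<^esub> (M' s i \<otimes>\<^bsub>B\<^esub> M' t j))"
    if "a \<in> {1..n}" "i \<in> {1..n}" "j \<in> {1..n}" for a i j
    using that M M' by (auto intro!: B.finsum_cong' B.finsum_closed)
  then show ?thesis
    unfolding structure_compatible_def by simp
qed

text \<open>\<open>structure_relations\<close> is written with type-class sums, while homomorphisms
  are applied to sums of the record; this lemma translates between them.\<close>

lemma finsum_polynomial:
  "f \<in> S \<rightarrow> carrier (polynomial_algebra V) \<Longrightarrow> finsum (polynomial_algebra V) f S = sum f S"
proof (induction S rule: infinite_finite_induct)
  interpret P: comm_algebra "polynomial_algebra V" by (rule comm_algebra_polynomial)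
  {
    case (insert x S)
    then have "f \<in> S \<rightarrow> carrier (polynomial_algebra V)" "f x \<in> carrier (polynomial_algebra V)"
      by blast+
    with insert show ?case by (simp add: P.finsum_insert del: polynomial_algebra_sel(1))
  next
    case (infinite S)
    then show ?case by simp
  next
    case empty
    then show ?case by simp
  }
qed

text \<open>The relations are polynomial identities in the entries with coefficients in the field,
  hence they survive an algebra homomorphism applied entrywise.\<close>

lemma structure_compatible_hom:
  assumes "comm_algebra A" "comm_algebra B" and h: "h \<in> alg_hom A B"
    and M: "\<And>i j. i \<in> {1..n} \<Longrightarrow> j \<in> {1..n} \<Longrightarrow> M i j \<in> carrier A"
    and "structure_compatible A n \<tau> M"
  shows "structure_compatible B n \<tau> (\<lambda>i j. h (M i j))"
  unfolding structure_compatible_def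
proof (intro ballI)
  interpret A: comm_algebra A by fact
  interpret B: comm_algebra B by fact
  note hom = alg_homD[OF h] and sum = alg_hom_finsum[OF assms(1-3)]
  fix a i j assume *: "a \<in> {1..n}" "i \<in> {1..n}" "j \<in> {1..n}"
  have "(\<Oplus>\<^bsub>B\<^esub>u\<in>{1..n}. \<tau> i j u \<odot>\<^bsub>B\<^esub> h (M a u)) = h (\<Oplus>\<^bsub>A\<^esub>u\<in>{1..n}. \<tau> i j u \<odot>\<^bsub>A\<^esub> M a u)"
    using * M by (subst sum) (auto intro!: B.finsum_cong' simp: hom)
  also have "\<dots> = h (\<Oplus>\<^bsub>A\<^esub>s\<in>{1..n}. \<Oplus>\<^bsub>A\<^esub>t\<in>{1..n}. \<tau> s t a \<odot>\<^bsub>A\<^esub> (M s i \<otimes>\<^bsub>A\<^esub> M t j))"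
    using assms(5) * by (simp add: structure_compatible_def)
  also have "\<dots> = (\<Oplus>\<^bsub>B\<^esub>s\<in>{1..n}. h (\<Oplus>\<^bsub>A\<^esub>t\<in>{1..n}. \<tau> s t a \<odot>\<^bsub>A\<^esub> (M s i \<otimes>\<^bsub>A\<^esub> M t j)))"
    using * M by (subst sum) (auto intro!: A.finsum_closed)
  also have "\<dots> = (\<Oplus>\<^bsub>B\<^esub>s\<in>{1..n}. \<Oplus>\<^bsub>B\<^esub>t\<in>{1..n}. \<tau> s t a \<odot>\<^bsub>B\<^esub> (h (M s i) \<otimes>\<^bsub>B\<^esub> h (M t j)))"
  proof (rule B.finsum_cong')
    fix s assume s: "s \<in> {1..n}"
    show "h (\<Oplus>\<^bsub>A\<^esub>t\<in>{1..n}. \<tau> s t a \<odot>\<^bsub>A\<^esub> (M s i \<otimes>\<^bsub>A\<^esub> M t j)) =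
        (\<Oplus>\<^bsub>B\<^esub>t\<in>{1..n}. \<tau> s t a \<odot>\<^bsub>B\<^esub> (h (M s i) \<otimes>\<^bsub>B\<^esub> h (M t j)))"
      using * M s by (subst sum) (auto intro!: B.finsum_cong' simp: hom)
  qed (use * M in \<open>auto intro!: B.finsum_closed simp: hom\<close>)
  finally show "(\<Oplus>\<^bsub>B\<^esub>u\<in>{1..n}. \<tau> i j u \<odot>\<^bsub>B\<^esub> h (M a u)) =
     (\<Oplus>\<^bsub>B\<^esub>s\<in>{1..n}. \<Oplus>\<^bsub>B\<^esub>t\<in>{1..n}. \<tau> s t a \<odot>\<^bsub>B\<^esub> (h (M s i) \<otimes>\<^bsub>B\<^esub> h (M t j)))" .
qed

section \<open>The generic matrix and its relations\<close>

locale structure_constants =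
  fixes n :: nat and \<tau> \<mu> :: "nat \<Rightarrow> nat \<Rightarrow> nat \<Rightarrow> 'k::field"
begin

abbreviation "PA \<equiv> polynomial_algebra ({1..n} \<times> {1..n}) :: ('k, (nat \<times> nat \<Rightarrow>\<^sub>0 nat) \<Rightarrow>\<^sub>0 'k) module"
abbreviation "\<I> \<equiv> poisson_ideal n \<tau> \<mu>"
abbreviation "UA \<equiv> universal_algebra n \<tau> \<mu>"
abbreviation "X \<equiv> gen n \<tau> \<mu>"

sublocale PA: comm_algebra PA
  by (rule comm_algebra_polynomial)

lemma var_closed: "i \<in> {1..n} \<Longrightarrow> j \<in> {1..n} \<Longrightarrow> poly_var (i, j) \<in> carrier PA"
  by (rule poly_var_closed) simp

lemma structure_relation_sides_closed:
  assumes "a \<in> {1..n}" "i \<in> {1..n}" "j \<in> {1..n}"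
  shows "(\<Sum>u=1..n. pm_scale (\<sigma> i j u) (poly_var (a, u))) \<in> carrier PA"
    and "(\<Sum>s=1..n. \<Sum>t=1..n. pm_scale (\<sigma> s t a) (poly_var (s, i) * poly_var (t, j))) \<in> carrier PA"
    and "(\<Sum>u=1..n. pm_scale (\<sigma> i j u) (poly_var (a, u))) =
         (\<Oplus>\<^bsub>PA\<^esub>u\<in>{1..n}. \<sigma> i j u \<odot>\<^bsub>PA\<^esub> poly_var (a, u))"
    and "(\<Sum>s=1..n. \<Sum>t=1..n. pm_scale (\<sigma> s t a) (poly_var (s, i) * poly_var (t, j))) =
         (\<Oplus>\<^bsub>PA\<^esub>s\<in>{1..n}. \<Oplus>\<^bsub>PA\<^esub>t\<in>{1..n}. \<sigma> s t a \<odot>\<^bsub>PA\<^esub> (poly_var (s, i) \<otimes>\<^bsub>PA\<^esub> poly_var (t, j)))"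
proof -
  have 1: "(\<lambda>u. \<sigma> i j u \<odot>\<^bsub>PA\<^esub> poly_var (a, u)) \<in> {1..n} \<rightarrow> carrier PA"
    using assms var_closed by (auto simp del: polynomial_algebra_sel)
  have 2: "(\<lambda>t. \<sigma> s t a \<odot>\<^bsub>PA\<^esub> (poly_var (s, i) \<otimes>\<^bsub>PA\<^esub> poly_var (t, j))) \<in> {1..n} \<rightarrow> carrier PA"
    if "s \<in> {1..n}" for s
    using assms that var_closed by (auto simp del: polynomial_algebra_sel)
  have 3: "(\<lambda>s. \<Oplus>\<^bsub>PA\<^esub>t\<in>{1..n}. \<sigma> s t a \<odot>\<^bsub>PA\<^esub> (poly_var (s, i) \<otimes>\<^bsub>PA\<^esub> poly_var (t, j))) \<in> {1..n} \<rightarrow> carrier PA"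
    by (intro funcsetI PA.finsum_closed[OF 2])
  show eq1: "(\<Sum>u=1..n. pm_scale (\<sigma> i j u) (poly_var (a, u))) =
         (\<Oplus>\<^bsub>PA\<^esub>u\<in>{1..n}. \<sigma> i j u \<odot>\<^bsub>PA\<^esub> poly_var (a, u))"
    using finsum_polynomial[OF 1] by simp
  show eq2: "(\<Sum>s=1..n. \<Sum>t=1..n. pm_scale (\<sigma> s t a) (poly_var (s, i) * poly_var (t, j))) =
         (\<Oplus>\<^bsub>PA\<^esub>s\<in>{1..n}. \<Oplus>\<^bsub>PA\<^esub>t\<in>{1..n}. \<sigma> s t a \<odot>\<^bsub>PA\<^esub> (poly_var (s, i) \<otimes>\<^bsub>PA\<^esub> poly_var (t, j)))"
    unfolding finsum_polynomial[OF 3] by (rule sum.cong) (use finsum_polynomial[OF 2] in simp_all)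
  show "(\<Sum>u=1..n. pm_scale (\<sigma> i j u) (poly_var (a, u))) \<in> carrier PA"
    unfolding eq1 using 1 by (rule PA.finsum_closed)
  show "(\<Sum>s=1..n. \<Sum>t=1..n. pm_scale (\<sigma> s t a) (poly_var (s, i) * poly_var (t, j))) \<in> carrier PA"
    unfolding eq2 using 3 by (rule PA.finsum_closed)
qed

lemma PA_minus: "p \<in> carrier PA \<Longrightarrow> q \<in> carrier PA \<Longrightarrow> p \<ominus>\<^bsub>PA\<^esub> q = p - q"
  by (metis PA.add.inv_solve_right PA.minus_closed PA.minus_eq add_diff_cancel_right' polynomial_algebra_sel(5))

lemma structure_relations_closed: "structure_relations n \<sigma> \<subseteq> carrier PA"
proof
  fix r assume "r \<in> structure_relations n \<sigma>"
  then obtain a i j where r: "a \<in> {1..n}" "i \<in> {1..n}" "j \<in> {1..n}"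
    "r = (\<Sum>u=1..n. pm_scale (\<sigma> i j u) (poly_var (a, u))) -
      (\<Sum>s=1..n. \<Sum>t=1..n. pm_scale (\<sigma> s t a) (poly_var (s, i) * poly_var (t, j)))"
    unfolding structure_relations_def by blast
  note c = structure_relation_sides_closed(1,2)[OF r(1-3), of \<sigma>]
  show "r \<in> carrier PA"
    using PA.minus_closed[OF c] unfolding r(4) PA_minus[OF c] .
qed

lemma ideal_poisson_ideal: "ideal \<I> PA"
  unfolding poisson_ideal_def
  by (rule PA.genideal_ideal) (use structure_relations_closed in blast)

sublocale UA: comm_algebra UA
  unfolding universal_algebra_def by (rule PA.comm_algebra_quotient[OF ideal_poisson_ideal])

lemma gen_closed: "i \<in> {1..n} \<Longrightarrow> j \<in> {1..n} \<Longrightarrow> X i j \<in> carrier UA"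
  unfolding universal_algebra_def PA.quotient_algebra_simps(1)[OF ideal_poisson_ideal] gen_def
  using var_closed by blast

lemma projection_hom: "(\<lambda>p\<in>carrier PA. \<I> +>\<^bsub>PA\<^esub> p) \<in> alg_hom PA UA"
  unfolding universal_algebra_def by (rule PA.quotient_projection[OF ideal_poisson_ideal])

text \<open>A homomorphism sends each relator to the difference of the two sides evaluated at the
  images of the variables. Read in one direction this lets maps descend to the quotient; read in the
  other, for the projection itself, it yields the relations among the generators.\<close>

lemma hom_structure_relations:
  assumes "comm_algebra B" and f: "f \<in> alg_hom PA B"
  shows "structure_compatible B n \<sigma> (\<lambda>i j. f (poly_var (i, j))) \<longleftrightarrow>
           (\<forall>r\<in>structure_relations n \<sigma>. f r = \<zero>\<^bsub>B\<^esub>)"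
proof -
  interpret B: comm_algebra B by fact
  note hom = alg_homD[OF f] and fsum = alg_hom_finsum[OF PA.comm_algebra_axioms assms]
  let ?v = "\<lambda>i j. poly_var (i, j)"
  let ?l = "\<lambda>a i j. \<Sum>u=1..n. pm_scale (\<sigma> i j u) (?v a u)"
  let ?r = "\<lambda>a i j. \<Sum>s=1..n. \<Sum>t=1..n. pm_scale (\<sigma> s t a) (?v s i * ?v t j)"
  have eq: "f (?l a i j) = (\<Oplus>\<^bsub>B\<^esub>u\<in>{1..n}. \<sigma> i j u \<odot>\<^bsub>B\<^esub> f (?v a u))"
      "f (?r a i j) = (\<Oplus>\<^bsub>B\<^esub>s\<in>{1..n}. \<Oplus>\<^bsub>B\<^esub>t\<in>{1..n}. \<sigma> s t a \<odot>\<^bsub>B\<^esub> (f (?v s i) \<otimes>\<^bsub>B\<^esub> f (?v t j)))"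
    if *: "a \<in> {1..n}" "i \<in> {1..n}" "j \<in> {1..n}" for a i j
  proof -
    show "f (?l a i j) = (\<Oplus>\<^bsub>B\<^esub>u\<in>{1..n}. \<sigma> i j u \<odot>\<^bsub>B\<^esub> f (?v a u))"
      unfolding structure_relation_sides_closed(3)[OF *] using * var_closed
      by (subst fsum) (auto intro!: B.finsum_cong' simp: hom simp del: polynomial_algebra_sel)
    have "f (?r a i j) = (\<Oplus>\<^bsub>B\<^esub>s\<in>{1..n}. f (\<Oplus>\<^bsub>PA\<^esub>t\<in>{1..n}. \<sigma> s t a \<odot>\<^bsub>PA\<^esub> (?v s i \<otimes>\<^bsub>PA\<^esub> ?v t j)))"
      unfolding structure_relation_sides_closed(4)[OF *] using * var_closed
      by (subst fsum) (auto intro!: PA.finsum_closed simp del: polynomial_algebra_sel)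
    also have "\<dots> = (\<Oplus>\<^bsub>B\<^esub>s\<in>{1..n}. \<Oplus>\<^bsub>B\<^esub>t\<in>{1..n}. \<sigma> s t a \<odot>\<^bsub>B\<^esub> (f (?v s i) \<otimes>\<^bsub>B\<^esub> f (?v t j)))"
    proof (rule B.finsum_cong')
      fix s assume s: "s \<in> {1..n}"
      show "f (\<Oplus>\<^bsub>PA\<^esub>t\<in>{1..n}. \<sigma> s t a \<odot>\<^bsub>PA\<^esub> (?v s i \<otimes>\<^bsub>PA\<^esub> ?v t j)) =
          (\<Oplus>\<^bsub>B\<^esub>t\<in>{1..n}. \<sigma> s t a \<odot>\<^bsub>B\<^esub> (f (?v s i) \<otimes>\<^bsub>B\<^esub> f (?v t j)))"
        using * s var_closed
        by (subst fsum) (auto intro!: B.finsum_cong' simp: hom simp del: polynomial_algebra_sel)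
    qed (use * var_closed in \<open>auto intro!: B.finsum_closed simp: hom simp del: polynomial_algebra_sel\<close>)
    finally show "f (?r a i j) = (\<Oplus>\<^bsub>B\<^esub>s\<in>{1..n}. \<Oplus>\<^bsub>B\<^esub>t\<in>{1..n}. \<sigma> s t a \<odot>\<^bsub>B\<^esub> (f (?v s i) \<otimes>\<^bsub>B\<^esub> f (?v t j)))" .
  qed
  have zero_iff: "f (p - q) = \<zero>\<^bsub>B\<^esub> \<longleftrightarrow> f p = f q" if "p \<in> carrier PA" "q \<in> carrier PA" for p q
  proof -
    have "p - q \<in> carrier PA"
      using PA.minus_closed[OF that] by (simp only: PA_minus[OF that])
    then have "f p = f (p - q) \<oplus>\<^bsub>B\<^esub> f q" "f (p - q) \<in> carrier B"
      using hom(3)[of "p - q" q] that hom(1) by (simp_all del: polynomial_algebra_sel(1))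
    then show ?thesis
      using hom(1)[OF that(2)] hom(1)[OF that(1)] by (metis B.add.r_cancel_one B.l_zero)
  qed
  have "(\<forall>r\<in>structure_relations n \<sigma>. f r = \<zero>\<^bsub>B\<^esub>) \<longleftrightarrow>
      (\<forall>a\<in>{1..n}. \<forall>i\<in>{1..n}. \<forall>j\<in>{1..n}. f (?l a i j - ?r a i j) = \<zero>\<^bsub>B\<^esub>)"
    unfolding structure_relations_def by blast
  also have "\<dots> \<longleftrightarrow> (\<forall>a\<in>{1..n}. \<forall>i\<in>{1..n}. \<forall>j\<in>{1..n}. f (?l a i j) = f (?r a i j))"
    using zero_iff[OF structure_relation_sides_closed(1,2)] by blast
  also have "\<dots> \<longleftrightarrow> structure_compatible B n \<sigma> (\<lambda>i j. f (?v i j))"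
    unfolding structure_compatible_def by (simp only: eq cong: ball_cong)
  finally show ?thesis by blast
qed

text \<open>The projection kills the relators because they lie in the ideal they generate, so the
  matrix of generators is the universal solution of the relations.\<close>

lemma gen_compatible: "structure_compatible UA n \<tau> X" "structure_compatible UA n \<mu> X"
proof -
  let ?f = "\<lambda>p\<in>carrier PA. \<I> +>\<^bsub>PA\<^esub> p"
  have zero: "?f r = \<zero>\<^bsub>UA\<^esub>" if "r \<in> structure_relations n \<tau> \<union> structure_relations n \<mu>" for r
  proof -
    have r: "r \<in> carrier PA" "r \<in> \<I>"
      using that structure_relations_closed PA.genideal_self[of "structure_relations n \<tau> \<union> structure_relations n \<mu>"]
      by (auto simp: poisson_ideal_def simp del: polynomial_algebra_sel)
    then have "\<I> +>\<^bsub>PA\<^esub> r = \<I> +>\<^bsub>PA\<^esub> \<zero>\<^bsub>PA\<^esub>"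
      using PA.coset_eq_iff[OF ideal_poisson_ideal r(1) PA.zero_closed] r PA_minus[OF r(1) PA.zero_closed] by simp
    with r show ?thesis
      unfolding universal_algebra_def PA.quotient_algebra_simps(5)[OF ideal_poisson_ideal] by (simp del: polynomial_algebra_sel)
  qed
  have X: "X i j = ?f (poly_var (i, j))" if "i \<in> {1..n}" "j \<in> {1..n}" for i j
    using var_closed[OF that] by (simp add: gen_def)
  have "structure_compatible UA n \<sigma> X" if "\<sigma> = \<tau> \<or> \<sigma> = \<mu>" for \<sigma>
  proof -
    have "structure_compatible UA n \<sigma> (\<lambda>i j. ?f (poly_var (i, j)))"
      using hom_structure_relations[OF UA.comm_algebra_axioms projection_hom, of \<sigma>] zero that by blast
    then show ?thesis
      by (rule structure_compatible_cong[OF UA.comm_algebra_axioms, THEN iffD1, rotated -1])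
        (simp_all only: X[symmetric] gen_closed)
  qed
  then show "structure_compatible UA n \<tau> X" "structure_compatible UA n \<mu> X" by blast+
qed

end

section \<open>Interchange of iterated sums and product matrices\<close>

context comm_algebra
begin

lemma finsum_swap3:
  assumes "finite P" "finite Q" "finite C"
    and f: "\<And>p q c. p \<in> P \<Longrightarrow> q \<in> Q \<Longrightarrow> c \<in> C \<Longrightarrow> f p q c \<in> carrier A"
  shows "(\<Oplus>p\<in>P. \<Oplus>q\<in>Q. \<Oplus>c\<in>C. f p q c) = (\<Oplus>c\<in>C. \<Oplus>p\<in>P. \<Oplus>q\<in>Q. f p q c)"
proof -
  have "(\<Oplus>p\<in>P. \<Oplus>q\<in>Q. \<Oplus>c\<in>C. f p q c) = (\<Oplus>p\<in>P. \<Oplus>c\<in>C. \<Oplus>q\<in>Q. f p q c)"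
    by (intro finsum_cong' finsum_swap assms refl funcsetI finsum_closed)
  also have "\<dots> = (\<Oplus>c\<in>C. \<Oplus>p\<in>P. \<Oplus>q\<in>Q. f p q c)"
    by (intro finsum_swap assms finsum_closed funcsetI)
  finally show ?thesis .
qed

lemma finsum_swap4:
  assumes "finite P" "finite Q" "finite C" "finite D"
    and f: "\<And>p q c d. p \<in> P \<Longrightarrow> q \<in> Q \<Longrightarrow> c \<in> C \<Longrightarrow> d \<in> D \<Longrightarrow> f p q c d \<in> carrier A"
  shows "(\<Oplus>p\<in>P. \<Oplus>q\<in>Q. \<Oplus>c\<in>C. \<Oplus>d\<in>D. f p q c d) = (\<Oplus>c\<in>C. \<Oplus>d\<in>D. \<Oplus>p\<in>P. \<Oplus>q\<in>Q. f p q c d)"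
proof -
  have "(\<Oplus>p\<in>P. \<Oplus>q\<in>Q. \<Oplus>c\<in>C. \<Oplus>d\<in>D. f p q c d) = (\<Oplus>c\<in>C. \<Oplus>p\<in>P. \<Oplus>q\<in>Q. \<Oplus>d\<in>D. f p q c d)"
    by (intro finsum_swap3 assms finsum_closed funcsetI)
  also have "\<dots> = (\<Oplus>c\<in>C. \<Oplus>d\<in>D. \<Oplus>p\<in>P. \<Oplus>q\<in>Q. f p q c d)"
    by (intro finsum_cong' finsum_swap3 assms refl funcsetI finsum_closed)
  finally show ?thesis .
qed

end

text \<open>A product of two compatible matrices whose entries commute with each other is
  compatible, just as a composite of two maps respecting an operation respects it. Applied to the
  generic matrix twice, this makes \<Delta> well defined on the quotient.\<close>

lemma structure_compatible_tensor:
  assumes V: "comm_algebra V" and W: "comm_algebra W"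
    and Mc: "\<And>i j. i \<in> {1..n} \<Longrightarrow> j \<in> {1..n} \<Longrightarrow> M i j \<in> carrier V"
    and M'c: "\<And>i j. i \<in> {1..n} \<Longrightarrow> j \<in> {1..n} \<Longrightarrow> M' i j \<in> carrier W"
    and M: "structure_compatible V n \<tau> M" and M': "structure_compatible W n \<tau> M'"
  shows "structure_compatible (tensor_algebra V W) n \<tau>
           (\<lambda>i j. \<Oplus>\<^bsub>tensor_algebra V W\<^esub>s\<in>{1..n}. pure_tensor V W (M i s) (M' s j))"
proof -
  interpret V: comm_algebra V by fact
  interpret W: comm_algebra W by fact
  define T where "T = tensor_algebra V W"
  interpret T: comm_algebra T unfolding T_def by (rule comm_algebra_tensor) fact+
  define N where "N = {1..n}"
  have N: "finite N" by (simp add: N_def)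
  define pt where "pt = pure_tensor V W"
  note Mc = Mc[folded N_def] and M'c = M'c[folded N_def]
  have ptc: "pt v w \<in> carrier T" if "v \<in> carrier V" "w \<in> carrier W" for v w
    unfolding pt_def T_def by (rule pure_tensor_closed) fact+
  note pt_simps =
    pure_tensor_smult_left[OF V W, folded T_def pt_def]
    pure_tensor_smult_right[OF V W, folded T_def pt_def]
    pure_tensor_mult[OF V W, folded T_def pt_def]
  \<comment> \<open>The two summation lemmas for pure tensors share their hypotheses; the constant
    zero family fills the place of the family in the other factor.\<close>
  have pt_sum_left: "pt (finsum V f N) w = finsum T (\<lambda>i. pt (f i) w) N"
    if "\<And>i. i \<in> N \<Longrightarrow> f i \<in> carrier V" "w \<in> carrier W" for f w
    using pure_tensor_finsum_left[OF V W, of f N "\<lambda>_. \<zero>\<^bsub>W\<^esub>" w] that by (auto simp: pt_def T_def)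
  have pt_sum_right: "pt v (finsum W f N) = finsum T (\<lambda>i. pt v (f i)) N"
    if "\<And>i. i \<in> N \<Longrightarrow> f i \<in> carrier W" "v \<in> carrier V" for f v
    using pure_tensor_finsum_right[OF V W, of "\<lambda>_. \<zero>\<^bsub>V\<^esub>" N f v] that by (auto simp: pt_def T_def)
  have comp: "(\<Oplus>\<^bsub>V\<^esub>u\<in>N. \<tau> i j u \<odot>\<^bsub>V\<^esub> M a u) = (\<Oplus>\<^bsub>V\<^esub>s\<in>N. \<Oplus>\<^bsub>V\<^esub>t\<in>N. \<tau> s t a \<odot>\<^bsub>V\<^esub> (M s i \<otimes>\<^bsub>V\<^esub> M t j))"
    "(\<Oplus>\<^bsub>W\<^esub>u\<in>N. \<tau> i j u \<odot>\<^bsub>W\<^esub> M' a u) = (\<Oplus>\<^bsub>W\<^esub>s\<in>N. \<Oplus>\<^bsub>W\<^esub>t\<in>N. \<tau> s t a \<odot>\<^bsub>W\<^esub> (M' s i \<otimes>\<^bsub>W\<^esub> M' t j))"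
    if "a \<in> N" "i \<in> N" "j \<in> N" for a i j
    using M M' that unfolding structure_compatible_def N_def by blast+
  note intros = T.finsum_cong' refl funcsetI T.finsum_closed V.finsum_closed W.finsum_closed ptc Mc M'c
    T.smult_closed V.smult_closed W.smult_closed V.m_closed W.m_closed T.m_closed N
  show ?thesis
    unfolding structure_compatible_def T_def[symmetric] N_def[symmetric] pt_def[symmetric]
  proof (intro ballI)
    fix a i j assume a: "a \<in> N" and i: "i \<in> N" and j: "j \<in> N"
    have "(\<Oplus>\<^bsub>T\<^esub>u\<in>N. \<tau> i j u \<odot>\<^bsub>T\<^esub> (\<Oplus>\<^bsub>T\<^esub>s\<in>N. pt (M a s) (M' s u))) =
        (\<Oplus>\<^bsub>T\<^esub>u\<in>N. \<Oplus>\<^bsub>T\<^esub>s\<in>N. \<tau> i j u \<odot>\<^bsub>T\<^esub> pt (M a s) (M' s u))"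
      by (intro intros T.smult_finsum a i j)
    also have "\<dots> = (\<Oplus>\<^bsub>T\<^esub>s\<in>N. \<Oplus>\<^bsub>T\<^esub>u\<in>N. \<tau> i j u \<odot>\<^bsub>T\<^esub> pt (M a s) (M' s u))"
      by (intro intros T.finsum_swap a i j)
    \<comment> \<open>For fixed \<open>s\<close> the sum over \<open>u\<close> is the linear side of
      the relation for \<open>M'\<close>; it is replaced by the quadratic side.\<close>
    also have "\<dots> = (\<Oplus>\<^bsub>T\<^esub>s\<in>N. pt (M a s) (\<Oplus>\<^bsub>W\<^esub>p\<in>N. \<Oplus>\<^bsub>W\<^esub>q\<in>N. \<tau> p q s \<odot>\<^bsub>W\<^esub> (M' p i \<otimes>\<^bsub>W\<^esub> M' q j)))"
    proof (rule T.finsum_cong'[OF refl])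
      fix s assume s: "s \<in> N"
      have "(\<Oplus>\<^bsub>T\<^esub>u\<in>N. \<tau> i j u \<odot>\<^bsub>T\<^esub> pt (M a s) (M' s u)) = (\<Oplus>\<^bsub>T\<^esub>u\<in>N. pt (M a s) (\<tau> i j u \<odot>\<^bsub>W\<^esub> M' s u))"
        by (intro intros pt_simps(2)[symmetric] a i j s)
      also have "\<dots> = pt (M a s) (\<Oplus>\<^bsub>W\<^esub>u\<in>N. \<tau> i j u \<odot>\<^bsub>W\<^esub> M' s u)"
        by (intro pt_sum_right[symmetric] intros a i j s)
      finally show "(\<Oplus>\<^bsub>T\<^esub>u\<in>N. \<tau> i j u \<odot>\<^bsub>T\<^esub> pt (M a s) (M' s u)) =
          pt (M a s) (\<Oplus>\<^bsub>W\<^esub>p\<in>N. \<Oplus>\<^bsub>W\<^esub>q\<in>N. \<tau> p q s \<odot>\<^bsub>W\<^esub> (M' p i \<otimes>\<^bsub>W\<^esub> M' q j))"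
        by (simp only: comp(2)[OF s i j])
    qed (intro intros a i j)
    \<comment> \<open>The constant \<open>\<tau> p q s\<close> is moved across the tensor sign, so
      that the sum over \<open>s\<close> can next be formed in the left factor, where it is the
      linear side of the relation for \<open>M\<close>.\<close>
    also have "\<dots> = (\<Oplus>\<^bsub>T\<^esub>s\<in>N. \<Oplus>\<^bsub>T\<^esub>p\<in>N. \<Oplus>\<^bsub>T\<^esub>q\<in>N. pt (\<tau> p q s \<odot>\<^bsub>V\<^esub> M a s) (M' p i \<otimes>\<^bsub>W\<^esub> M' q j))"
    proof (rule T.finsum_cong'[OF refl])
      fix s assume s: "s \<in> N"
      have "pt (M a s) (\<Oplus>\<^bsub>W\<^esub>p\<in>N. \<Oplus>\<^bsub>W\<^esub>q\<in>N. \<tau> p q s \<odot>\<^bsub>W\<^esub> (M' p i \<otimes>\<^bsub>W\<^esub> M' q j)) =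
          (\<Oplus>\<^bsub>T\<^esub>p\<in>N. pt (M a s) (\<Oplus>\<^bsub>W\<^esub>q\<in>N. \<tau> p q s \<odot>\<^bsub>W\<^esub> (M' p i \<otimes>\<^bsub>W\<^esub> M' q j)))"
        by (intro pt_sum_right intros a i j s)
      also have "\<dots> = (\<Oplus>\<^bsub>T\<^esub>p\<in>N. \<Oplus>\<^bsub>T\<^esub>q\<in>N. pt (M a s) (\<tau> p q s \<odot>\<^bsub>W\<^esub> (M' p i \<otimes>\<^bsub>W\<^esub> M' q j)))"
        by (intro T.finsum_cong' refl pt_sum_right; intro intros a i j s)
      also have "\<dots> = (\<Oplus>\<^bsub>T\<^esub>p\<in>N. \<Oplus>\<^bsub>T\<^esub>q\<in>N. pt (\<tau> p q s \<odot>\<^bsub>V\<^esub> M a s) (M' p i \<otimes>\<^bsub>W\<^esub> M' q j))"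
        using a i j s by (intro T.finsum_cong' refl; (intro intros)?) (simp_all add: pt_simps Mc M'c)
      finally show "pt (M a s) (\<Oplus>\<^bsub>W\<^esub>p\<in>N. \<Oplus>\<^bsub>W\<^esub>q\<in>N. \<tau> p q s \<odot>\<^bsub>W\<^esub> (M' p i \<otimes>\<^bsub>W\<^esub> M' q j)) =
          (\<Oplus>\<^bsub>T\<^esub>p\<in>N. \<Oplus>\<^bsub>T\<^esub>q\<in>N. pt (\<tau> p q s \<odot>\<^bsub>V\<^esub> M a s) (M' p i \<otimes>\<^bsub>W\<^esub> M' q j))" .
    qed (intro intros a i j)
    also have "\<dots> = (\<Oplus>\<^bsub>T\<^esub>p\<in>N. \<Oplus>\<^bsub>T\<^esub>q\<in>N. \<Oplus>\<^bsub>T\<^esub>s\<in>N. pt (\<tau> p q s \<odot>\<^bsub>V\<^esub> M a s) (M' p i \<otimes>\<^bsub>W\<^esub> M' q j))"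
      by (rule T.finsum_swap3[symmetric]; intro intros a i j)
    \<comment> \<open>Now the relation for \<open>M\<close> at the indices \<open>a\<close>,
      \<open>p\<close>, \<open>q\<close> is applied in the left factor, and each pure tensor splits
      into a product of two.\<close>
    also have "\<dots> = (\<Oplus>\<^bsub>T\<^esub>p\<in>N. \<Oplus>\<^bsub>T\<^esub>q\<in>N. \<Oplus>\<^bsub>T\<^esub>c\<in>N. \<Oplus>\<^bsub>T\<^esub>d\<in>N.
        \<tau> c d a \<odot>\<^bsub>T\<^esub> (pt (M c p) (M' p i) \<otimes>\<^bsub>T\<^esub> pt (M d q) (M' q j)))"
    proof (rule T.finsum_cong'[OF refl _ T.finsum_cong'[OF refl]])
      fix p q assume p: "p \<in> N" and q: "q \<in> N"
      have "(\<Oplus>\<^bsub>T\<^esub>s\<in>N. pt (\<tau> p q s \<odot>\<^bsub>V\<^esub> M a s) (M' p i \<otimes>\<^bsub>W\<^esub> M' q j)) =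
          pt (\<Oplus>\<^bsub>V\<^esub>s\<in>N. \<tau> p q s \<odot>\<^bsub>V\<^esub> M a s) (M' p i \<otimes>\<^bsub>W\<^esub> M' q j)"
        by (rule pt_sum_left[symmetric]; intro intros a i j p q)
      also have "\<dots> = pt (\<Oplus>\<^bsub>V\<^esub>c\<in>N. \<Oplus>\<^bsub>V\<^esub>d\<in>N. \<tau> c d a \<odot>\<^bsub>V\<^esub> (M c p \<otimes>\<^bsub>V\<^esub> M d q)) (M' p i \<otimes>\<^bsub>W\<^esub> M' q j)"
        by (simp only: comp(1)[OF a p q])
      also have "\<dots> = (\<Oplus>\<^bsub>T\<^esub>c\<in>N. pt (\<Oplus>\<^bsub>V\<^esub>d\<in>N. \<tau> c d a \<odot>\<^bsub>V\<^esub> (M c p \<otimes>\<^bsub>V\<^esub> M d q)) (M' p i \<otimes>\<^bsub>W\<^esub> M' q j))"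
        by (rule pt_sum_left; intro intros a i j p q)
      also have "\<dots> = (\<Oplus>\<^bsub>T\<^esub>c\<in>N. \<Oplus>\<^bsub>T\<^esub>d\<in>N. pt (\<tau> c d a \<odot>\<^bsub>V\<^esub> (M c p \<otimes>\<^bsub>V\<^esub> M d q)) (M' p i \<otimes>\<^bsub>W\<^esub> M' q j))"
        by (intro T.finsum_cong' refl pt_sum_left; intro intros a i j p q)
      also have "\<dots> = (\<Oplus>\<^bsub>T\<^esub>c\<in>N. \<Oplus>\<^bsub>T\<^esub>d\<in>N. \<tau> c d a \<odot>\<^bsub>T\<^esub> (pt (M c p) (M' p i) \<otimes>\<^bsub>T\<^esub> pt (M d q) (M' q j)))"
        using a i j p q by (intro T.finsum_cong' refl; (intro intros)?) (simp_all add: pt_simps Mc M'c)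
      finally show "(\<Oplus>\<^bsub>T\<^esub>s\<in>N. pt (\<tau> p q s \<odot>\<^bsub>V\<^esub> M a s) (M' p i \<otimes>\<^bsub>W\<^esub> M' q j)) =
         (\<Oplus>\<^bsub>T\<^esub>c\<in>N. \<Oplus>\<^bsub>T\<^esub>d\<in>N. \<tau> c d a \<odot>\<^bsub>T\<^esub> (pt (M c p) (M' p i) \<otimes>\<^bsub>T\<^esub> pt (M d q) (M' q j)))" .
    qed (intro intros a i j; assumption)+
    also have "\<dots> = (\<Oplus>\<^bsub>T\<^esub>c\<in>N. \<Oplus>\<^bsub>T\<^esub>d\<in>N. \<Oplus>\<^bsub>T\<^esub>p\<in>N. \<Oplus>\<^bsub>T\<^esub>q\<in>N.
        \<tau> c d a \<odot>\<^bsub>T\<^esub> (pt (M c p) (M' p i) \<otimes>\<^bsub>T\<^esub> pt (M d q) (M' q j)))"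
      by (rule T.finsum_swap4; intro intros a i j)
    \<comment> \<open>With \<open>c\<close> and \<open>d\<close> outermost, the sums over
      \<open>p\<close> and \<open>q\<close> separate into two entries of the product matrix.\<close>
    also have "\<dots> = (\<Oplus>\<^bsub>T\<^esub>c\<in>N. \<Oplus>\<^bsub>T\<^esub>d\<in>N. \<tau> c d a \<odot>\<^bsub>T\<^esub>
        ((\<Oplus>\<^bsub>T\<^esub>p\<in>N. pt (M c p) (M' p i)) \<otimes>\<^bsub>T\<^esub> (\<Oplus>\<^bsub>T\<^esub>q\<in>N. pt (M d q) (M' q j))))"
    proof (rule T.finsum_cong'[OF refl _ T.finsum_cong'[OF refl]])
      fix c d assume c: "c \<in> N" and d: "d \<in> N"
      have "\<tau> c d a \<odot>\<^bsub>T\<^esub> ((\<Oplus>\<^bsub>T\<^esub>p\<in>N. pt (M c p) (M' p i)) \<otimes>\<^bsub>T\<^esub> (\<Oplus>\<^bsub>T\<^esub>q\<in>N. pt (M d q) (M' q j))) =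
          \<tau> c d a \<odot>\<^bsub>T\<^esub> (\<Oplus>\<^bsub>T\<^esub>p\<in>N. \<Oplus>\<^bsub>T\<^esub>q\<in>N. pt (M c p) (M' p i) \<otimes>\<^bsub>T\<^esub> pt (M d q) (M' q j))"
        by (subst T.finsum_mult_finsum; (intro intros i j c d)?) simp
      also have "\<dots> = (\<Oplus>\<^bsub>T\<^esub>p\<in>N. \<tau> c d a \<odot>\<^bsub>T\<^esub> (\<Oplus>\<^bsub>T\<^esub>q\<in>N. pt (M c p) (M' p i) \<otimes>\<^bsub>T\<^esub> pt (M d q) (M' q j)))"
        by (rule T.smult_finsum; intro intros i j c d)
      also have "\<dots> = (\<Oplus>\<^bsub>T\<^esub>p\<in>N. \<Oplus>\<^bsub>T\<^esub>q\<in>N. \<tau> c d a \<odot>\<^bsub>T\<^esub> (pt (M c p) (M' p i) \<otimes>\<^bsub>T\<^esub> pt (M d q) (M' q j)))"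
        by (intro T.finsum_cong' refl T.smult_finsum; intro intros i j c d)
      finally show "(\<Oplus>\<^bsub>T\<^esub>p\<in>N. \<Oplus>\<^bsub>T\<^esub>q\<in>N. \<tau> c d a \<odot>\<^bsub>T\<^esub> (pt (M c p) (M' p i) \<otimes>\<^bsub>T\<^esub> pt (M d q) (M' q j))) =
        \<tau> c d a \<odot>\<^bsub>T\<^esub> ((\<Oplus>\<^bsub>T\<^esub>p\<in>N. pt (M c p) (M' p i)) \<otimes>\<^bsub>T\<^esub> (\<Oplus>\<^bsub>T\<^esub>q\<in>N. pt (M d q) (M' q j)))"
        by (rule sym)
    qed (intro intros a i j; assumption)+
    finally show "(\<Oplus>\<^bsub>T\<^esub>u\<in>N. \<tau> i j u \<odot>\<^bsub>T\<^esub> (\<Oplus>\<^bsub>T\<^esub>s\<in>N. pt (M a s) (M' s u))) =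
      (\<Oplus>\<^bsub>T\<^esub>c\<in>N. \<Oplus>\<^bsub>T\<^esub>d\<in>N. \<tau> c d a \<odot>\<^bsub>T\<^esub>
        ((\<Oplus>\<^bsub>T\<^esub>p\<in>N. pt (M c p) (M' p i)) \<otimes>\<^bsub>T\<^esub> (\<Oplus>\<^bsub>T\<^esub>q\<in>N. pt (M d q) (M' q j))))" .
  qed
qed

section \<open>Universal property, comultiplication and counit\<close>

context structure_constants
begin

text \<open>Evaluation of polynomials at \<open>M\<close> kills the relators by compatibility; its
  kernel is an ideal, so it contains the ideal they generate and the evaluation descends.\<close>

lemma universal_hom_exists:
  assumes B: "comm_algebra B" and M: "\<And>i j. i \<in> {1..n} \<Longrightarrow> j \<in> {1..n} \<Longrightarrow> M i j \<in> carrier B"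
    and \<tau>: "structure_compatible B n \<tau> M" and \<mu>: "structure_compatible B n \<mu> M"
  obtains h where "h \<in> alg_hom UA B" "\<And>i j. i \<in> {1..n} \<Longrightarrow> j \<in> {1..n} \<Longrightarrow> h (X i j) = M i j"
proof -
  interpret B: comm_algebra B by fact
  obtain f where f: "f \<in> alg_hom PA B"
    and fv: "\<And>v. v \<in> {1..n} \<times> {1..n} \<Longrightarrow> f (poly_var v) = case_prod M v"
  proof (rule polynomial_eval_exists[OF B, of "{1..n} \<times> {1..n}" "case_prod M"])
    show "case_prod M v \<in> carrier B" if "v \<in> {1..n} \<times> {1..n}" for v
      using that M by auto
  qed (rule that)
  have "structure_compatible B n \<sigma> (\<lambda>i j. f (poly_var (i, j)))" if "\<sigma> = \<tau> \<or> \<sigma> = \<mu>" for \<sigma>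
  proof -
    have "structure_compatible B n \<sigma> M"
      using that \<tau> \<mu> by blast
    then show ?thesis
      by (rule structure_compatible_cong[OF B _ M, THEN iffD2, rotated -1]) (simp add: fv)
  qed
  then have "f r = \<zero>\<^bsub>B\<^esub>" if "r \<in> structure_relations n \<tau> \<union> structure_relations n \<mu>" for r
    using that hom_structure_relations[OF B f] by blast
  then have sub: "structure_relations n \<tau> \<union> structure_relations n \<mu> \<subseteq> a_kernel PA B f"
    using structure_relations_closed by (auto simp: a_kernel_def' simp del: polynomial_algebra_sel)
  have "f \<in> ring_hom PA B"
    using f by (simp add: alg_hom_def)
  then interpret f: ring_hom_ring PA B f
    by (intro ring_hom_ringI2 PA.ring_axioms B.ring_axioms)
  have "\<I> \<subseteq> a_kernel PA B f"
    unfolding poisson_ideal_def by (rule PA.genideal_minimal[OF f.kernel_is_ideal sub])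
  then have f0: "f p = \<zero>\<^bsub>B\<^esub>" if "p \<in> \<I>" for p
    using subsetD[OF _ that] by (simp only: a_kernel_def' mem_Collect_eq) blast
  have "\<exists>h\<in>alg_hom UA B. \<forall>p\<in>carrier PA. h (\<I> +>\<^bsub>PA\<^esub> p) = f p"
    unfolding universal_algebra_def
  proof (rule PA.quotient_lift[OF ideal_poisson_ideal B f])
    show "f p = \<zero>\<^bsub>B\<^esub>" if "p \<in> \<I>" for p
      using that by (rule f0)
  qed
  then obtain h where h: "h \<in> alg_hom UA B" "\<And>p. p \<in> carrier PA \<Longrightarrow> h (\<I> +>\<^bsub>PA\<^esub> p) = f p"
    by blast
  moreover have "h (X i j) = M i j" if "i \<in> {1..n}" "j \<in> {1..n}" for i j
    unfolding gen_def using that var_closed[OF that] by (simp only: h(2) fv) (simp add: fv)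
  ultimately show ?thesis using that by blast
qed

text \<open>Every element is a coset of a polynomial, and the two composites with the projection
  agree on the variables.\<close>

lemma universal_hom_eqI:
  assumes B: "comm_algebra B" and f: "f \<in> alg_hom UA B" and g: "g \<in> alg_hom UA B"
    and eq: "\<And>i j. i \<in> {1..n} \<Longrightarrow> j \<in> {1..n} \<Longrightarrow> f (X i j) = g (X i j)"
  shows "f = g"
proof (rule extensionalityI[OF alg_homD(6)[OF f] alg_homD(6)[OF g]])
  fix x assume "x \<in> carrier UA"
  then obtain p where p: "p \<in> carrier PA" "x = \<I> +>\<^bsub>PA\<^esub> p"
    unfolding universal_algebra_def PA.quotient_algebra_simps(1)[OF ideal_poisson_ideal] by blast
  let ?\<pi> = "\<lambda>p\<in>carrier PA. \<I> +>\<^bsub>PA\<^esub> p"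
  have "(\<lambda>p\<in>carrier PA. f (?\<pi> p)) p = (\<lambda>p\<in>carrier PA. g (?\<pi> p)) p"
  proof (rule polynomial_hom_eqI[OF B _ _ _ p(1)])
    show "(\<lambda>p\<in>carrier PA. f (?\<pi> p)) \<in> alg_hom PA B" "(\<lambda>p\<in>carrier PA. g (?\<pi> p)) \<in> alg_hom PA B"
      using alg_hom_compose[OF projection_hom f PA.comm_algebra_axioms]
        alg_hom_compose[OF projection_hom g PA.comm_algebra_axioms] by blast+
    fix v assume "v \<in> {1..n} \<times> {1..n}"
    then show "(\<lambda>p\<in>carrier PA. f (?\<pi> p)) (poly_var v) = (\<lambda>p\<in>carrier PA. g (?\<pi> p)) (poly_var v)"
      using eq var_closed by (auto simp: gen_def simp del: polynomial_algebra_sel)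
  qed
  then show "f x = g x"
    using p by (simp del: polynomial_algebra_sel)
qed

abbreviation "UB \<equiv> universal_bialgebra n \<tau> \<mu>"
abbreviation "UT \<equiv> tensor_algebra UA UA"

lemma universal_bialgebra_sel:
  "carrier UB = carrier UA" "monoid.mult UB = monoid.mult UA" "one UB = one UA"
  "zero UB = zero UA" "add UB = add UA" "smult UB = smult UA"
  by (simp_all add: universal_bialgebra_def Let_def module.defs)

sublocale UB: comm_algebra UB
  by (rule comm_algebra_cong[OF UA.comm_algebra_axioms]) (simp_all add: universal_bialgebra_sel)

text \<open>Unique existence makes the definite description usable: existence is the universal
  property applied to the product of the generic matrix with itself over the tensor square,
  uniqueness holds because the generators determine a homomorphism.\<close>

lemma comult_hom: "comult UB \<in> alg_hom UA UT"
  and comult_gen: "i \<in> {1..n} \<Longrightarrow> j \<in> {1..n} \<Longrightarrow>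
    comult UB (X i j) = (\<Oplus>\<^bsub>UT\<^esub>s\<in>{1..n}. pure_tensor UA UA (X i s) (X s j))"
proof -
  let ?Q = "\<lambda>D. D \<in> alg_hom UA UT \<and> (\<forall>i\<in>{1..n}. \<forall>j\<in>{1..n}.
     D (X i j) = (\<Oplus>\<^bsub>UT\<^esub>s\<in>{1..n}. pure_tensor UA UA (X i s) (X s j)))"
  note T = comm_algebra_tensor[OF UA.comm_algebra_axioms UA.comm_algebra_axioms]
  interpret T: comm_algebra UT by (rule T)
  let ?M = "\<lambda>i j. \<Oplus>\<^bsub>UT\<^esub>s\<in>{1..n}. pure_tensor UA UA (X i s) (X s j)"
  have M: "?M i j \<in> carrier UT" if "i \<in> {1..n}" "j \<in> {1..n}" for i j
    by (intro T.finsum_closed funcsetI pure_tensor_closed gen_closed that)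
  have comp: "structure_compatible UT n \<sigma> ?M" if "structure_compatible UA n \<sigma> X" for \<sigma>
    by (rule structure_compatible_tensor[OF UA.comm_algebra_axioms UA.comm_algebra_axioms gen_closed gen_closed that that])
  obtain D where "D \<in> alg_hom UA UT" "\<And>i j. i \<in> {1..n} \<Longrightarrow> j \<in> {1..n} \<Longrightarrow> D (X i j) = ?M i j"
    by (rule universal_hom_exists[OF T M comp[OF gen_compatible(1)] comp[OF gen_compatible(2)]])
      (assumption, assumption, rule that)
  then have "\<exists>D. ?Q D" by blast
  moreover have "D = D'" if "?Q D" "?Q D'" for D D'
    by (rule universal_hom_eqI[OF T]) (use that in auto)
  ultimately have ex1: "\<exists>!D. ?Q D" by blast
  have eq: "comult UB = (THE D. ?Q D)"
    by (simp add: universal_bialgebra_def Let_def module.defs bialgebra.defs)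
  have "?Q (comult UB)"
    unfolding eq by (rule theI'[OF ex1])
  then show "comult UB \<in> alg_hom UA UT" "i \<in> {1..n} \<Longrightarrow> j \<in> {1..n} \<Longrightarrow>
    comult UB (X i j) = (\<Oplus>\<^bsub>UT\<^esub>s\<in>{1..n}. pure_tensor UA UA (X i s) (X s j))" by blast+
qed

lemma structure_compatible_ground:
  "structure_compatible ground_algebra n \<sigma> M \<longleftrightarrow>
     (\<forall>a\<in>{1..n}. \<forall>i\<in>{1..n}. \<forall>j\<in>{1..n}.
        (\<Sum>u=1..n. \<sigma> i j u * M a u) = (\<Sum>s=1..n. \<Sum>t=1..n. \<sigma> s t a * (M s i * M t j)))"
  by (simp add: structure_compatible_def)

lemma counit_hom: "counit UB \<in> alg_hom UA ground_algebra"
  and counit_gen: "i \<in> {1..n} \<Longrightarrow> j \<in> {1..n} \<Longrightarrow> counit UB (X i j) = (if i = j then 1 else 0)"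
proof -
  let ?Q = "\<lambda>E. E \<in> alg_hom UA (ground_algebra :: ('k, 'k) module) \<and> (\<forall>i\<in>{1..n}. \<forall>j\<in>{1..n}. E (X i j) = (if i = j then 1 else 0))"
  let ?M = "\<lambda>i j. if i = j then 1 else 0 :: 'k"
  \<comment> \<open>The identity matrix describes the identity map, which respects any operation:
    both sides collapse to \<open>\<sigma> i j a\<close>.\<close>
  have comp: "structure_compatible ground_algebra n \<sigma> ?M" for \<sigma> :: "nat \<Rightarrow> nat \<Rightarrow> nat \<Rightarrow> 'k"
    unfolding structure_compatible_ground
  proof (intro ballI)
    fix a i j assume *: "a \<in> {1..n}" "i \<in> {1..n}" "j \<in> {1..n}"
    have "(\<Sum>u=1..n. \<sigma> i j u * ?M a u) = (\<Sum>u=1..n. if u = a then \<sigma> i j u else 0)"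
      by (rule sum.cong) auto
    also have "\<dots> = \<sigma> i j a"
      using * by simp
    also have "\<dots> = (\<Sum>s=1..n. if s = i then \<Sum>t=1..n. if t = j then \<sigma> s t a else 0 else 0)"
      using * by simp
    also have "\<dots> = (\<Sum>s=1..n. \<Sum>t=1..n. \<sigma> s t a * (?M s i * ?M t j))"
    proof (rule sum.cong[OF refl])
      fix s
      have "(\<Sum>t=1..n. \<sigma> s t a * (?M s i * ?M t j)) =
          (\<Sum>t=1..n. if t = j then if s = i then \<sigma> s t a else 0 else 0)"
        by (rule sum.cong) auto
      then show "(if s = i then \<Sum>t=1..n. if t = j then \<sigma> s t a else 0 else 0) =
          (\<Sum>t=1..n. \<sigma> s t a * (?M s i * ?M t j))"
        by simp
    qed
    finally show "(\<Sum>u=1..n. \<sigma> i j u * ?M a u) = (\<Sum>s=1..n. \<Sum>t=1..n. \<sigma> s t a * (?M s i * ?M t j))" .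
  qed
  obtain E where "E \<in> alg_hom UA ground_algebra" "\<And>i j. i \<in> {1..n} \<Longrightarrow> j \<in> {1..n} \<Longrightarrow> E (X i j) = ?M i j"
    by (rule universal_hom_exists[OF comm_algebra_ground _ comp comp]) (simp, rule that)
  then have "\<exists>E. ?Q E" by blast
  moreover have "D = D'" if "?Q D" "?Q D'" for D D'
    by (rule universal_hom_eqI[OF comm_algebra_ground]) (use that in auto)
  ultimately have ex1: "\<exists>!D. ?Q D" by blast
  have eq: "counit UB = (THE D. ?Q D)"
    by (simp add: universal_bialgebra_def Let_def module.defs bialgebra.defs)
  have "?Q (counit UB)"
    unfolding eq by (rule theI'[OF ex1])
  then show "counit UB \<in> alg_hom UA ground_algebra"
    "i \<in> {1..n} \<Longrightarrow> j \<in> {1..n} \<Longrightarrow> counit UB (X i j) = (if i = j then 1 else 0)" by blast+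
qed

text \<open>Convolution is \<Delta> followed by f \<otimes> g, a composite of algebra maps, hence
  again a character. On generators the formula for \<Delta> turns it into a product of
  matrices.\<close>

lemma
  assumes f: "f \<in> alg_hom UA ground_algebra" and g: "g \<in> alg_hom UA ground_algebra"
  shows convolution_hom: "(\<lambda>h\<in>carrier UA. tensor_eval (\<lambda>a b. f a * g b) (comult UB h)) \<in> alg_hom UA ground_algebra"
    and convolution_gen: "i \<in> {1..n} \<Longrightarrow> j \<in> {1..n} \<Longrightarrow>
      (\<lambda>h\<in>carrier UA. tensor_eval (\<lambda>a b. f a * g b) (comult UB h)) (X i j) = (\<Sum>s=1..n. f (X i s) * g (X s j))"
proof -
  note UA = UA.comm_algebra_axioms
  note T = comm_algebra_tensor[OF UA UA] and e = tensor_eval_alg_hom[OF UA UA f g]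
  let ?e = "\<lambda>t\<in>carrier UT. tensor_eval (\<lambda>a b. f a * g b) t"
  let ?c = "\<lambda>h\<in>carrier UA. tensor_eval (\<lambda>a b. f a * g b) (comult UB h)"
  \<comment> \<open>\<open>tensor_eval_alg_hom\<close> concerns the evaluation restricted to the
    carrier; \<Delta> takes its values there, so the restriction does not change the
    composite.\<close>
  have eq: "?c = (\<lambda>h\<in>carrier UA. ?e (comult UB h))"
    using alg_homD(1)[OF comult_hom] by (intro restrict_ext) simp
  show "?c \<in> alg_hom UA ground_algebra"
    unfolding eq by (rule alg_hom_compose[OF comult_hom e UA])
  have bil: "bilinear_form UA UA (\<lambda>a b. f a * g b)"
    by (auto simp: bilinear_form_def alg_homD[OF f] alg_homD[OF g] algebra_simps)
  show "?c (X i j) = (\<Sum>s=1..n. f (X i s) * g (X s j))" if ij: "i \<in> {1..n}" "j \<in> {1..n}"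
  proof -
    have "?c (X i j) = ?e (\<Oplus>\<^bsub>UT\<^esub>s\<in>{1..n}. pure_tensor UA UA (X i s) (X s j))"
      unfolding eq using gen_closed[OF ij] comult_gen[OF ij] by simp
    also have "\<dots> = (\<Sum>s=1..n. ?e (pure_tensor UA UA (X i s) (X s j)))"
      using ij gen_closed by (subst alg_hom_finsum[OF T comm_algebra_ground e]) (auto intro!: pure_tensor_closed)
    also have "\<dots> = (\<Sum>s=1..n. f (X i s) * g (X s j))"
      using ij gen_closed by (intro sum.cong) (auto simp: pure_tensor_closed tensor_eval_pure_tensor[OF bil])
    finally show ?thesis .
  qed
qed

end

section \<open>Group-like elements of the finite dual\<close>

lemma finite_dual_algebra_sel [simp]:
  "carrier (finite_dual_algebra H) = {f \<in> linear_functionals H.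
     \<exists>I. ideal I H \<and> finite_codimension H I \<and> (\<forall>x\<in>I. f x = 0)}"
  "add (finite_dual_algebra H) = (\<lambda>f g. \<lambda>h\<in>carrier H. f h + g h)"
  "smult (finite_dual_algebra H) = (\<lambda>c f. \<lambda>h\<in>carrier H. c * f h)"
  by (simp_all add: finite_dual_algebra_def)

lemma finite_dual_sel:
  "carrier (finite_dual H) = carrier (finite_dual_algebra H)"
  "monoid.mult (finite_dual H) = monoid.mult (finite_dual_algebra H)"
  "one (finite_dual H) = one (finite_dual_algebra H)"
  "zero (finite_dual H) = zero (finite_dual_algebra H)"
  "add (finite_dual H) = add (finite_dual_algebra H)"
  "smult (finite_dual H) = smult (finite_dual_algebra H)"
  by (simp_all add: finite_dual_def module.defs)

text \<open>\<open>group_likes\<close> forms pure tensors over the bialgebra record, whereas the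
  comultiplication of \<open>finite_dual\<close> selects tensors over the underlying algebra record.
  The types of the tensors agree, and only shared fields enter their construction.\<close>

lemma pure_tensor_finite_dual:
  "pure_tensor (finite_dual H) (finite_dual H) = pure_tensor (finite_dual_algebra H) (finite_dual_algebra H)"
proof -
  have "free_pair_algebra (finite_dual H) (finite_dual H) =
      free_pair_algebra (finite_dual_algebra H) (finite_dual_algebra H)"
    unfolding free_pair_algebra_def by (simp only: finite_dual_sel)
  moreover have "tensor_relations (finite_dual H) (finite_dual H) =
      tensor_relations (finite_dual_algebra H) (finite_dual_algebra H)"
    unfolding tensor_relations_def by (simp only: finite_dual_sel)
  ultimately show ?thesis
    by (intro ext) (simp add: pure_tensor_def)
qed

text \<open>The comultiplication of the finite dual transposes the multiplication of
  \<open>H\<close> and its counit evaluates at the unit, so which functionals are group-like is a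
  question about the algebra \<open>H\<close>. The comultiplication of \<open>H\<close> determines
  how they are multiplied.\<close>

locale bialgebra_record = comm_algebra H for H :: "('k::field, 'h) bialgebra" (structure)
begin

abbreviation "LF \<equiv> linear_functionals H"
abbreviation "FD \<equiv> finite_dual_algebra H"
abbreviation "TR \<equiv> tensor_relations FD FD"

lemma linear_functionalD:
  assumes "f \<in> LF"
  shows "x \<in> carrier H \<Longrightarrow> y \<in> carrier H \<Longrightarrow> f (x \<oplus> y) = f x + f y"
    and "x \<in> carrier H \<Longrightarrow> f (c \<odot> x) = c * f x"
    and "f \<in> extensional (carrier H)"
  using assms by (auto simp: linear_functionals_def)

lemma linear_functionalI:
  assumes "\<And>x y. x \<in> carrier H \<Longrightarrow> y \<in> carrier H \<Longrightarrow> f (x \<oplus> y) = f x + f y"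
    and "\<And>c x. x \<in> carrier H \<Longrightarrow> f (c \<odot> x) = c * f x"
    and "f \<in> extensional (carrier H)"
  shows "f \<in> LF"
  using assms by (auto simp: linear_functionals_def)

lemma linear_functional_zero: "f \<in> LF \<Longrightarrow> f \<zero> = 0"
  using linear_functionalD(2)[of f \<zero> 0] by simp

lemma linear_functional_minus:
  assumes "f \<in> LF" "x \<in> carrier H" "y \<in> carrier H"
  shows "f (x \<ominus> y) = f x - f y"
proof -
  have "f (\<ominus> y) = - f y"
    using linear_functionalD(2)[OF assms(1,3), of "- 1"] smult_uminus[OF assms(3), of 1] assms(3) by simp
  then show ?thesis
    using assms linear_functionalD(1)[OF assms(1,2), of "\<ominus> y"] by (simp add: minus_eq)
qed

lemma linear_functional_combination:
  assumes "f \<in> LF" "B \<subseteq> carrier H"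
  shows "f (\<Oplus>b\<in>B. c b \<odot> b) = (\<Sum>b\<in>B. c b * f b)"
  using assms(2)
proof (induction B rule: infinite_finite_induct)
  case (insert x B)
  then have "(\<lambda>b. c b \<odot> b) \<in> B \<rightarrow> carrier H" "x \<in> carrier H" by auto
  with insert show ?case
    by (simp add: finsum_insert finsum_closed linear_functionalD[OF assms(1)])
qed (simp_all add: linear_functional_zero[OF assms(1)])

lemma dualI:
  assumes "f \<in> LF" "ideal I H" "finite_codimension H I" "\<And>x. x \<in> I \<Longrightarrow> f x = 0"
  shows "f \<in> carrier FD"
  using assms by auto

lemma dual_linear: "f \<in> carrier FD \<Longrightarrow> f \<in> LF"
  by simp

text \<open>Elimination on the columns of \<open>\<beta>\<close>, the functions of the first
  argument obtained by fixing the second. The columns at \<open>B\<close> span all columns; each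
  step discards one \<open>b0\<close>, either because its column is zero or after a form of rank one
  has been subtracted. The ideal \<open>I\<close> is carried along so that the split-off factors
  vanish on it and hence belong to the finite dual.\<close>

lemma bilinear_rank_decomposition:
  assumes I: "ideal I H" "finite_codimension H I"
    and "finite B" "B \<subseteq> carrier H" "bilinear_form H H \<beta>"
    and "\<And>a b. a \<in> I \<Longrightarrow> b \<in> carrier H \<Longrightarrow> \<beta> a b = 0"
    and "\<And>a b. a \<in> carrier H \<Longrightarrow> b \<in> I \<Longrightarrow> \<beta> a b = 0"
    and "\<And>h. h \<in> carrier H \<Longrightarrow> \<exists>c. \<forall>a\<in>carrier H. \<beta> a h = (\<Sum>b\<in>B. c b * \<beta> a b)"
  shows "\<exists>xs. set xs \<subseteq> carrier FD \<times> carrier FD \<and>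
           (\<forall>a\<in>carrier H. \<forall>b\<in>carrier H. \<beta> a b = (\<Sum>(u, v)\<leftarrow>xs. u a * v b))"
  using assms(3-)
proof (induction B arbitrary: \<beta>)
  case empty
  then show ?case by (intro exI[of _ "[]"]) simp
next
  case (insert b0 B)
  have sub: "x \<in> carrier H" if "x \<in> I" for x
    using ideal.Icarr[OF I(1) that] .
  have b0: "b0 \<in> carrier H" and B: "B \<subseteq> carrier H" using insert.prems(1) by auto
  note bil = insert.prems(2)[unfolded bilinear_form_def]
  show ?case
  proof (cases "\<forall>a\<in>carrier H. \<beta> a b0 = 0")
    case True
    have "\<exists>c. \<forall>a\<in>carrier H. \<beta> a h = (\<Sum>b\<in>B. c b * \<beta> a b)" if "h \<in> carrier H" for h
      using insert.prems(5)[OF that] insert.hyps True by simp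
    with insert.IH[OF B insert.prems(2,3,4)] show ?thesis by blast
  next
    case False
    then obtain a0 where a0: "a0 \<in> carrier H" "\<beta> a0 b0 \<noteq> 0" by blast
    \<comment> \<open>Column \<open>b0\<close> times row \<open>a0\<close>, normalised by the pivot
      \<open>\<beta> a0 b0\<close>, is subtracted. This kills column \<open>b0\<close>, so the
      remaining columns are spanned by those at \<open>B\<close>.\<close>
    define \<beta>' where "\<beta>' a b = \<beta> a b - \<beta> a b0 * (\<beta> a0 b / \<beta> a0 b0)" for a b
    define u where "u = (\<lambda>a\<in>carrier H. \<beta> a b0)"
    define v where "v = (\<lambda>b\<in>carrier H. \<beta> a0 b / \<beta> a0 b0)"
    have "u \<in> LF" "v \<in> LF"
      using bil a0 b0 by (auto intro!: linear_functionalI simp: u_def v_def add_divide_distrib)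
    moreover have "u x = 0" "v x = 0" if "x \<in> I" for x
      using insert.prems(3,4) that sub[OF that] a0 b0 by (auto simp: u_def v_def)
    ultimately have uv: "u \<in> carrier FD" "v \<in> carrier FD"
      by (auto intro!: dualI[OF _ I] simp del: finite_dual_algebra_sel)
    have bil': "bilinear_form H H \<beta>'"
      using bil a0 b0 unfolding bilinear_form_def \<beta>'_def
      by (simp add: algebra_simps add_divide_distrib diff_divide_distrib)
    have left: "\<beta>' a b = 0" if "a \<in> I" "b \<in> carrier H" for a b
      using insert.prems(3) that b0 by (simp add: \<beta>'_def)
    have right: "\<beta>' a b = 0" if "a \<in> carrier H" "b \<in> I" for a b
      using insert.prems(4) that a0 by (simp add: \<beta>'_def)
    have "\<exists>c. \<forall>a\<in>carrier H. \<beta>' a h = (\<Sum>b\<in>B. c b * \<beta>' a b)" if h: "h \<in> carrier H" for h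
    proof -
      obtain c where c: "\<And>a. a \<in> carrier H \<Longrightarrow> \<beta> a h = (\<Sum>b\<in>insert b0 B. c b * \<beta> a b)"
        using insert.prems(5)[OF h] by blast
      have "\<beta>' a h = (\<Sum>b\<in>B. c b * \<beta>' a b)" if a: "a \<in> carrier H" for a
      proof -
        have "\<beta>' a h = (\<Sum>b\<in>insert b0 B. c b * \<beta> a b) -
            \<beta> a b0 * ((\<Sum>b\<in>insert b0 B. c b * \<beta> a0 b) / \<beta> a0 b0)"
          unfolding \<beta>'_def by (simp only: c[OF a] c[OF a0(1)])
        also have "\<dots> = (\<Sum>b\<in>insert b0 B. c b * \<beta>' a b)"
          unfolding \<beta>'_def by (simp only: right_diff_distrib sum_subtractf sum_divide_distrib sum_distrib_left)
            (simp add: mult.left_commute)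
        also have "\<dots> = (\<Sum>b\<in>B. c b * \<beta>' a b)"
          using insert.hyps a0 by (simp add: \<beta>'_def)
        finally show ?thesis .
      qed
      then show ?thesis by blast
    qed
    from insert.IH[OF B bil' left right this] obtain xs where
      xs: "set xs \<subseteq> carrier FD \<times> carrier FD"
        "\<And>a b. a \<in> carrier H \<Longrightarrow> b \<in> carrier H \<Longrightarrow> \<beta>' a b = (\<Sum>(u, v)\<leftarrow>xs. u a * v b)"
      by blast
    have "\<beta> a b = (\<Sum>(u, v)\<leftarrow>(u, v) # xs. u a * v b)" if "a \<in> carrier H" "b \<in> carrier H" for a b
      using xs(2)[OF that] that by (simp add: \<beta>'_def u_def v_def diff_eq_eq add.commute)
    with xs(1) uv show ?thesis
      by (intro exI[of _ "(u, v) # xs"]) (simp del: finite_dual_algebra_sel)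
  qed
qed

text \<open>If f vanishes on the ideal I, then f (a b) vanishes as soon as one argument lies in I,
  and modulo I the second argument is a combination of finitely many elements. These are the
  conditions of the elimination lemma.\<close>

lemma dual_finite_rank:
  assumes "f \<in> carrier FD"
  shows "\<exists>xs. set xs \<subseteq> carrier FD \<times> carrier FD \<and>
           (\<forall>a\<in>carrier H. \<forall>b\<in>carrier H. f (a \<otimes> b) = (\<Sum>(u, v)\<leftarrow>xs. u a * v b))"
proof -
  obtain I where f: "f \<in> LF" and I: "ideal I H" "finite_codimension H I"
      and f0: "\<And>x. x \<in> I \<Longrightarrow> f x = 0"
    using assms by auto
  interpret I: ideal I H by (rule I(1))
  obtain B where B: "finite B" "B \<subseteq> carrier H"
    and span: "\<And>h. h \<in> carrier H \<Longrightarrow> \<exists>c. h \<ominus> (\<Oplus>b\<in>B. c b \<odot> b) \<in> I"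
    using I(2) unfolding finite_codimension_def by blast
  note lin = linear_functionalD[OF f]
  show ?thesis
  proof (rule bilinear_rank_decomposition[OF I B])
    show "bilinear_form H H (\<lambda>a b. f (a \<otimes> b))"
      by (simp add: bilinear_form_def lin l_distr r_distr smult_assoc2 smult_assoc2_right)
    show "f (a \<otimes> b) = 0" if "a \<in> I" "b \<in> carrier H" for a b
      by (rule f0[OF I.I_r_closed[OF that]])
    show "f (a \<otimes> b) = 0" if "a \<in> carrier H" "b \<in> I" for a b
      by (rule f0[OF I.I_l_closed[OF that(2,1)]])
    show "\<exists>c. \<forall>a\<in>carrier H. f (a \<otimes> h) = (\<Sum>b\<in>B. c b * f (a \<otimes> b))" if h: "h \<in> carrier H" for h
    proof -
      obtain c where c: "h \<ominus> (\<Oplus>b\<in>B. c b \<odot> b) \<in> I" (is "h \<ominus> ?s \<in> I") using span[OF h] by blast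
      have s: "?s \<in> carrier H"
        using B by (intro finsum_closed) auto
      have "f (a \<otimes> h) = (\<Sum>b\<in>B. c b * f (a \<otimes> b))" if a: "a \<in> carrier H" for a
      proof -
        \<comment> \<open>With the first argument fixed the form is a linear functional, so the
          approximation of \<open>h\<close> modulo \<open>I\<close> can be evaluated term by
          term.\<close>
        have fa: "(\<lambda>x\<in>carrier H. f (a \<otimes> x)) \<in> LF"
          using a by (intro linear_functionalI) (simp_all add: lin r_distr smult_assoc2_right)
        have "f (a \<otimes> (h \<ominus> ?s)) = 0"
          by (rule f0[OF I.I_l_closed[OF c a]])
        then have "f (a \<otimes> h) = f (a \<otimes> ?s)"
          using linear_functional_minus[OF fa h s] h s a by simp
        also have "\<dots> = (\<Sum>b\<in>B. c b * f (a \<otimes> b))"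
          using linear_functional_combination[OF fa B(2), of c] B(2) s
          by (simp add: subset_iff cong: sum.cong)
        finally show ?thesis .
      qed
      then show ?thesis by blast
    qed
  qed
qed

text \<open>If a further functional \<open>u\<close> is not already zero on the common zeros so far,
  they contain some \<open>k\<close> with \<open>u k\<close> nonzero. Adding \<open>k\<close> to the
  spanning set is enough: subtracting a multiple of \<open>k\<close> corrects the value of
  \<open>u\<close> and leaves those of the earlier functionals alone.\<close>

lemma finite_codimension_common_zeros:
  assumes "set us \<subseteq> LF"
  shows "finite_codimension H {x \<in> carrier H. \<forall>u\<in>set us. u x = 0}"
  using assms
proof (induction us)
  case Nil
  show ?case
    unfolding finite_codimension_def by (intro exI[of _ "{}"]) simp
next
  case (Cons u us)
  let ?Z = "{x \<in> carrier H. \<forall>u\<in>set us. u x = 0}" and ?Z' = "{x \<in> carrier H. \<forall>u\<in>set (u # us). u x = 0}"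
  have u: "u \<in> LF" and us: "\<And>w. w \<in> set us \<Longrightarrow> w \<in> LF" using Cons.prems by auto
  obtain B where B: "finite B" "B \<subseteq> carrier H"
    and span: "\<And>h. h \<in> carrier H \<Longrightarrow> \<exists>c. h \<ominus> (\<Oplus>b\<in>B. c b \<odot> b) \<in> ?Z"
    using Cons unfolding finite_codimension_def by (simp only: set_simps insert_subset) blast
  show ?case
  proof (cases "\<forall>x\<in>?Z. u x = 0")
    case True
    then have "?Z = ?Z'" by auto
    then show ?thesis using Cons by simp
  next
    case False
    then obtain k where k: "k \<in> carrier H" "u k \<noteq> 0" "\<And>w. w \<in> set us \<Longrightarrow> w k = 0" by auto
    \<comment> \<open>\<open>k\<close> may already belong to \<open>B\<close>; then its coefficient
      has to be raised by \<open>t\<close> instead of a new summand being introduced.\<close>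
    have ins: "\<exists>c'. (\<Oplus>b\<in>insert k B. c' b \<odot> b) = (\<Oplus>b\<in>B. c b \<odot> b) \<oplus> t \<odot> k" for c t
    proof (cases "k \<in> B")
      case True
      have "(\<Oplus>b\<in>B. (c b + (if k = b then t else 0)) \<odot> b) =
          (\<Oplus>b\<in>B. c b \<odot> b \<oplus> (if k = b then t \<odot> b else \<zero>))"
        using B by (intro finsum_cong') (auto simp: smult_l_distr)
      also have "\<dots> = (\<Oplus>b\<in>B. c b \<odot> b) \<oplus> (\<Oplus>b\<in>B. if k = b then t \<odot> b else \<zero>)"
        using B by (intro finsum_addf) auto
      also have "(\<Oplus>b\<in>B. if k = b then t \<odot> b else \<zero>) = t \<odot> k"
        using B True by (intro finsum_singleton) auto
      finally have "(\<Oplus>b\<in>insert k B. (c b + (if k = b then t else 0)) \<odot> b) = (\<Oplus>b\<in>B. c b \<odot> b) \<oplus> t \<odot> k"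
        using True by (simp add: insert_absorb)
      then show ?thesis by (intro exI[of _ "\<lambda>b. c b + (if k = b then t else 0)"])
    next
      case False
      have "(\<Oplus>b\<in>insert k B. (c(k := t)) b \<odot> b) = t \<odot> k \<oplus> (\<Oplus>b\<in>B. (c(k := t)) b \<odot> b)"
        using B k False by (subst finsum_insert) auto
      also have "(\<Oplus>b\<in>B. (c(k := t)) b \<odot> b) = (\<Oplus>b\<in>B. c b \<odot> b)"
        using B False by (intro finsum_cong') auto
      also have "t \<odot> k \<oplus> (\<Oplus>b\<in>B. c b \<odot> b) = (\<Oplus>b\<in>B. c b \<odot> b) \<oplus> t \<odot> k"
        using B k by (intro a_comm) (auto intro!: finsum_closed)
      finally show ?thesis by (intro exI[of _ "c(k := t)"])
    qed
    have "\<exists>c. h \<ominus> (\<Oplus>b\<in>insert k B. c b \<odot> b) \<in> ?Z'" if h: "h \<in> carrier H" for h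
    proof -
      obtain c where c: "h \<ominus> (\<Oplus>b\<in>B. c b \<odot> b) \<in> ?Z" (is "h \<ominus> ?s \<in> ?Z") using span[OF h] by blast
      have s: "?s \<in> carrier H"
        using B by (intro finsum_closed) auto
      \<comment> \<open>The multiple of \<open>k\<close> for which \<open>u\<close> vanishes on the
        corrected remainder.\<close>
      define t where "t = u (h \<ominus> ?s) / u k"
      obtain c' where c': "(\<Oplus>b\<in>insert k B. c' b \<odot> b) = ?s \<oplus> t \<odot> k" using ins by blast
      have w: "w (h \<ominus> (?s \<oplus> t \<odot> k)) = w (h \<ominus> ?s) - t * w k" if "w \<in> LF" for w
        using that h s k(1) by (simp add: linear_functional_minus linear_functionalD)
      have "u (h \<ominus> (?s \<oplus> t \<odot> k)) = 0"
        unfolding w[OF u] using k(2) by (simp add: t_def)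
      moreover have "w (h \<ominus> (?s \<oplus> t \<odot> k)) = 0" if "w \<in> set us" for w
        using c that k(3)[OF that] by (simp add: w[OF us[OF that]])
      ultimately have "h \<ominus> (\<Oplus>b\<in>insert k B. c' b \<odot> b) \<in> ?Z'"
        unfolding c' using h s k(1) by simp
      then show ?thesis by (intro exI[of _ c'])
    qed
    then show ?thesis
      unfolding finite_codimension_def using B k by (intro exI[of _ "insert k B"]) blast
  qed
qed

lemma finite_codimension_mono:
  "finite_codimension H I \<Longrightarrow> I \<subseteq> J \<Longrightarrow> finite_codimension H J"
  unfolding finite_codimension_def by (meson subsetD)

text \<open>The ideal witnessing membership in the finite dual is the radical of the form
  \<open>(a, b) \<mapsto> f (a \<otimes> b)\<close>; unlike the vanishing ideal it behaves well under sums of functionals.\<close>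

lemma finite_rank_dual:
  assumes f: "f \<in> LF" and xs: "set xs \<subseteq> LF \<times> LF"
    and rank: "\<And>a b. a \<in> carrier H \<Longrightarrow> b \<in> carrier H \<Longrightarrow> f (a \<otimes> b) = (\<Sum>(u, v)\<leftarrow>xs. u a * v b)"
  shows "f \<in> carrier FD"
proof (rule dualI[OF f])
  let ?K = "{a \<in> carrier H. \<forall>b\<in>carrier H. f (a \<otimes> b) = 0}"
  note lin = linear_functionalD[OF f]
  show "ideal ?K H"
  proof (rule idealI[OF ring_axioms])
    show "subgroup ?K (add_monoid H)"
    proof (rule add.subgroupI)
      show "?K \<noteq> {}" using linear_functional_zero[OF f] by (auto intro!: exI[of _ \<zero>])
      show "\<ominus> a \<in> ?K" if "a \<in> ?K" for a
        using that lin(2)[of _ "- 1"] smult_uminus[of _ 1] by (auto simp: l_minus)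
      show "a \<oplus> b \<in> ?K" if "a \<in> ?K" "b \<in> ?K" for a b
        using that by (simp add: l_distr lin)
    qed blast
    show "x \<otimes> a \<in> ?K" "a \<otimes> x \<in> ?K" if "a \<in> ?K" "x \<in> carrier H" for a x
      using that by (auto simp: m_assoc m_lcomm)
  qed
  \<comment> \<open>A common zero of the finitely many left factors annihilates every term of the
    decomposition; this bounds the codimension of the radical.\<close>
  have "{x \<in> carrier H. \<forall>u\<in>set (map fst xs). u x = 0} \<subseteq> ?K"
  proof safe
    fix a b assume a: "a \<in> carrier H" "\<forall>u\<in>set (map fst xs). u a = 0" and b: "b \<in> carrier H"
    have "(\<Sum>(u, v)\<leftarrow>xs. u a * v b) = (\<Sum>x\<leftarrow>xs. 0)"
      using a(2) by (intro arg_cong[where f = sum_list] map_cong) auto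
    then show "f (a \<otimes> b) = 0"
      using rank[OF a(1) b] by simp
  qed
  moreover have "finite_codimension H {x \<in> carrier H. \<forall>u\<in>set (map fst xs). u x = 0}"
    by (rule finite_codimension_common_zeros) (use xs in auto)
  ultimately show "finite_codimension H ?K"
    by (rule finite_codimension_mono[rotated])
  show "f x = 0" if "x \<in> ?K" for x
    using that by (auto dest!: bspec[of _ _ \<one>])
qed

lemma dual_smult_closed: "f \<in> carrier FD \<Longrightarrow> c \<odot>\<^bsub>FD\<^esub> f \<in> carrier FD"
proof -
  assume "f \<in> carrier FD"
  then obtain I where f: "f \<in> LF" and I: "ideal I H" "finite_codimension H I" "\<And>x. x \<in> I \<Longrightarrow> f x = 0"
    by auto
  have "c \<odot>\<^bsub>FD\<^esub> f \<in> LF"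
    by (rule linear_functionalI) (simp_all add: linear_functionalD[OF f] algebra_simps)
  then show ?thesis
    by (rule dualI[OF _ I(1,2)]) (use I(3) ideal.Icarr[OF I(1)] in auto)
qed

text \<open>The ideals attached to \<open>f\<close> and \<open>g\<close> may differ. Both associated
  forms have finite rank, though, and concatenating their decompositions gives one for the
  sum.\<close>

lemma dual_add_closed:
  assumes "f \<in> carrier FD" "g \<in> carrier FD"
  shows "f \<oplus>\<^bsub>FD\<^esub> g \<in> carrier FD"
proof -
  note lin = linear_functionalD[OF dual_linear[OF assms(1)]] linear_functionalD[OF dual_linear[OF assms(2)]]
  obtain xs where xs: "set xs \<subseteq> carrier FD \<times> carrier FD"
    "\<And>a b. a \<in> carrier H \<Longrightarrow> b \<in> carrier H \<Longrightarrow> f (a \<otimes> b) = (\<Sum>(u, v)\<leftarrow>xs. u a * v b)"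
    using dual_finite_rank[OF assms(1)] by blast
  obtain ys where ys: "set ys \<subseteq> carrier FD \<times> carrier FD"
    "\<And>a b. a \<in> carrier H \<Longrightarrow> b \<in> carrier H \<Longrightarrow> g (a \<otimes> b) = (\<Sum>(u, v)\<leftarrow>ys. u a * v b)"
    using dual_finite_rank[OF assms(2)] by blast
  have "carrier FD \<subseteq> LF" by (rule subsetI) (rule dual_linear)
  then have "carrier FD \<times> carrier FD \<subseteq> LF \<times> LF" by (intro Sigma_mono)
  then have "set (xs @ ys) \<subseteq> LF \<times> LF"
    using xs(1) ys(1) by (simp only: set_append Un_subset_iff) blast
  moreover have "f \<oplus>\<^bsub>FD\<^esub> g \<in> LF"
    by (rule linear_functionalI) (simp_all add: lin algebra_simps)
  ultimately show ?thesis
    by (intro finite_rank_dual[of _ "xs @ ys"]) (simp_all add: xs(2) ys(2) del: finite_dual_algebra_sel(1))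
qed

section \<open>The tensor square of the finite dual inside the bilinear forms\<close>

lemma dual_evaluation_bilinear:
  "a \<in> carrier H \<Longrightarrow> b \<in> carrier H \<Longrightarrow> bilinear_form FD FD (\<lambda>u v. u a * v b)"
  by (simp add: bilinear_form_def algebra_simps)

text \<open>Terms with a common right factor merge by additivity and homogeneity in the left one. In
  \<open>tensor_zeroI\<close> this recombines the terms u \<otimes> v0 into u0 \<otimes> v0.\<close>

lemma tensor_collect_left:
  assumes "set ps \<subseteq> UNIV \<times> carrier FD" and v: "v \<in> carrier FD"
  defines "w \<equiv> \<lambda>h\<in>carrier H. \<Sum>(d, u)\<leftarrow>ps. d * u h"
  shows "w \<in> carrier FD \<and> (\<Sum>(d, u)\<leftarrow>ps. Poly_Mapping.single (u, v) d) - Poly_Mapping.single (w, v) 1 \<in> TR"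
  using assms(1) unfolding w_def
proof (induction ps)
  case Nil
  note sub = subspace_tensor_relations[of FD FD]
  \<comment> \<open>The empty combination is the zero functional. Writing it as zero times
    \<open>v\<close> gives both its membership in the finite dual and the required relation.\<close>
  have z: "(\<lambda>h\<in>carrier H. 0) = 0 \<odot>\<^bsub>FD\<^esub> v" by simp
  have "(\<lambda>h\<in>carrier H. 0) \<in> carrier FD"
    unfolding z by (rule dual_smult_closed[OF v])
  moreover have "Poly_Mapping.single (\<lambda>h\<in>carrier H. 0, v) 1 \<in> TR"
    unfolding z using tensor_relations_base(3)[OF v v, of 0] by (simp del: finite_dual_algebra_sel)
  ultimately show ?case
    using pm.subspace_neg[OF sub] by (simp del: finite_dual_algebra_sel restrict_apply)
next
  case (Cons p ps)
  note sub = subspace_tensor_relations[of FD FD]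
  obtain d u where p: "p = (d, u)" by (cases p)
  have u: "u \<in> carrier FD" using Cons.prems p by auto
  let ?w = "\<lambda>h\<in>carrier H. \<Sum>(d, u)\<leftarrow>ps. d * u h"
  have w: "?w \<in> carrier FD"
      and IH: "(\<Sum>(d, u)\<leftarrow>ps. Poly_Mapping.single (u, v) d) - Poly_Mapping.single (?w, v) 1 \<in> TR"
    using Cons.IH Cons.prems by (simp_all del: finite_dual_algebra_sel restrict_apply)
  have du: "d \<odot>\<^bsub>FD\<^esub> u \<in> carrier FD" by (rule dual_smult_closed[OF u])
  have eq: "(\<lambda>h\<in>carrier H. \<Sum>(d, u)\<leftarrow>p # ps. d * u h) = d \<odot>\<^bsub>FD\<^esub> u \<oplus>\<^bsub>FD\<^esub> ?w"
    by (rule ext) (simp add: p)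
  have 1: "Poly_Mapping.single (d \<odot>\<^bsub>FD\<^esub> u \<oplus>\<^bsub>FD\<^esub> ?w, v) 1 - Poly_Mapping.single (d \<odot>\<^bsub>FD\<^esub> u, v) 1
      - Poly_Mapping.single (?w, v) 1 \<in> TR"
    by (rule tensor_relations_base(1)[OF du w v])
  have 2: "Poly_Mapping.single (d \<odot>\<^bsub>FD\<^esub> u, v) 1 - Poly_Mapping.single (u, v) d \<in> TR"
    by (rule tensor_relations_base(3)[OF u v])
  have "(\<Sum>(d, u)\<leftarrow>p # ps. Poly_Mapping.single (u, v) d) - Poly_Mapping.single (d \<odot>\<^bsub>FD\<^esub> u \<oplus>\<^bsub>FD\<^esub> ?w, v) 1 \<in> TR"
    using pm.subspace_diff[OF sub pm.subspace_diff[OF sub IH 1] 2]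
    by (simp add: p algebra_simps del: finite_dual_algebra_sel)
  moreover have "d \<odot>\<^bsub>FD\<^esub> u \<oplus>\<^bsub>FD\<^esub> ?w \<in> carrier FD"
    by (rule dual_add_closed[OF du w])
  ultimately show ?case unfolding eq by blast
qed

text \<open>Injectivity of the map from the tensor square of the finite dual to bilinear forms: if some
  \<open>v\<^sub>0\<close> is non-zero at \<open>y\<close>, evaluating the relation at \<open>b = y\<close> expresses \<open>u\<^sub>0\<close> through the
  other \<open>u\<^sub>i\<close>, which removes one summand.\<close>

lemma tensor_zeroI:
  assumes "set xs \<subseteq> carrier FD \<times> carrier FD"
    and "\<And>a b. a \<in> carrier H \<Longrightarrow> b \<in> carrier H \<Longrightarrow> (\<Sum>(u, v)\<leftarrow>xs. u a * v b) = 0"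
  shows "(\<Sum>x\<leftarrow>xs. Poly_Mapping.single x 1) \<in> TR"
  using assms
proof (induction xs rule: length_induct)
  case (1 xs)
  note sub = subspace_tensor_relations[of FD FD]
  show ?case
  proof (cases xs)
    case Nil
    then show ?thesis using pm.subspace_0[OF sub] by simp
  next
    case (Cons x ys)
    obtain u0 v0 where x: "x = (u0, v0)" by (cases x)
    have u0: "u0 \<in> carrier FD" and v0: "v0 \<in> carrier FD" and ys: "set ys \<subseteq> carrier FD \<times> carrier FD"
      using "1.prems"(1) Cons x by auto
    have rel: "u0 a * v0 b + (\<Sum>(u, v)\<leftarrow>ys. u a * v b) = 0" if "a \<in> carrier H" "b \<in> carrier H" for a b
      using "1.prems"(2)[OF that] by (simp add: Cons x)
    show ?thesis
    proof (cases "\<forall>y\<in>carrier H. v0 y = 0")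
      case True
      \<comment> \<open>A functional that is zero on the carrier equals zero times itself because it
        is extensional; homogeneity with scalar zero then makes u0 \<otimes> v0 a relation.\<close>
      have "0 \<odot>\<^bsub>FD\<^esub> v0 = v0"
        using linear_functionalD(3)[OF dual_linear[OF v0]] True by (auto simp: extensional_def)
      then have "Poly_Mapping.single (u0, v0) 1 \<in> TR"
        using tensor_relations_base(4)[OF u0 v0, of 0] by simp
      moreover have "(\<Sum>x\<leftarrow>ys. Poly_Mapping.single x 1) \<in> TR"
        using "1.IH" ys rel True Cons by simp
      ultimately show ?thesis
        using pm.subspace_add[OF sub] by (simp add: Cons x)
    next
      case False
      then obtain y where y: "y \<in> carrier H" "v0 y \<noteq> 0" by blast
      define d where "d v = - (v y / v0 y)" for v :: "'h \<Rightarrow> 'k"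
      \<comment> \<open>Substituting the combination for \<open>u0\<close> moves u0 \<otimes> v0
        into the right factors of the other terms, which leaves a shorter list still evaluating to
        zero.\<close>
      define zs where "zs = map (\<lambda>(u, v). (u, v \<oplus>\<^bsub>FD\<^esub> d v \<odot>\<^bsub>FD\<^esub> v0)) ys"
      have zs: "set zs \<subseteq> carrier FD \<times> carrier FD"
        using ys dual_add_closed dual_smult_closed[OF v0]
        by (auto simp: zs_def simp del: finite_dual_algebra_sel)
      have dsum: "(\<Sum>(u, v)\<leftarrow>ys. d v * u a) = u0 a" if a: "a \<in> carrier H" for a
      proof -
        have "(\<Sum>(u, v)\<leftarrow>ys. d v * u a) = - (\<Sum>(u, v)\<leftarrow>ys. u a * v y) / v0 y"
          by (induction ys) (auto simp: d_def diff_divide_distrib mult.commute)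
        also have "\<dots> = u0 a * v0 y / v0 y"
          using rel[OF a y(1)] by (simp only: eq_neg_iff_add_eq_0[symmetric] minus_minus)
        finally show ?thesis using y(2) by simp
      qed
      have eval: "(\<Sum>(u, v)\<leftarrow>zs. u a * v b) = 0" if a: "a \<in> carrier H" and b: "b \<in> carrier H" for a b
      proof -
        have "(\<Sum>(u, v)\<leftarrow>zs. u a * v b) = (\<Sum>(u, v)\<leftarrow>ys. u a * v b) + (\<Sum>(u, v)\<leftarrow>ys. d v * u a) * v0 b"
          unfolding zs_def using b by (induction ys) (auto simp: algebra_simps)
        then show ?thesis using rel[OF a b] by (simp add: dsum[OF a] add.commute)
      qed
      have Z: "(\<Sum>x\<leftarrow>zs. Poly_Mapping.single x 1) \<in> TR"
      proof -
        have len: "length zs < length xs" by (simp add: zs_def Cons)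
        show ?thesis
          by (rule "1.IH"[rule_format, OF len zs]) (rule eval)
      qed
      \<comment> \<open>\<open>T\<close> is u0 \<otimes> v0 with \<open>u0\<close> expanded. Modulo
        the relations \<open>ys\<close> together with \<open>T\<close> is \<open>zs\<close>, while
        \<open>T\<close> collapses back to the single pair; subtracting the two facts gives the
        claim.\<close>
      define T where "T = (\<Sum>(u, v)\<leftarrow>ys. Poly_Mapping.single (u, v0) (d v))"
      have A: "(\<Sum>x\<leftarrow>ys. Poly_Mapping.single x 1) + T - (\<Sum>x\<leftarrow>zs. Poly_Mapping.single x 1) \<in> TR"
        using ys unfolding T_def zs_def
      proof (induction ys)
        case Nil
        then show ?case using pm.subspace_0[OF sub] by simp
      next
        case (Cons p ys)
        obtain u v where p: "p = (u, v)" by (cases p)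
        have u: "u \<in> carrier FD" and v: "v \<in> carrier FD" using Cons.prems p by auto
        have 1: "Poly_Mapping.single (u, v \<oplus>\<^bsub>FD\<^esub> d v \<odot>\<^bsub>FD\<^esub> v0) 1 - Poly_Mapping.single (u, v) 1
            - Poly_Mapping.single (u, d v \<odot>\<^bsub>FD\<^esub> v0) 1 \<in> TR"
          by (rule tensor_relations_base(2)[OF u v dual_smult_closed[OF v0]])
        have 2: "Poly_Mapping.single (u, d v \<odot>\<^bsub>FD\<^esub> v0) 1 - Poly_Mapping.single (u, v0) (d v) \<in> TR"
          by (rule tensor_relations_base(4)[OF u v0])
        have IH: "(\<Sum>x\<leftarrow>ys. Poly_Mapping.single x 1) + (\<Sum>(u, v)\<leftarrow>ys. Poly_Mapping.single (u, v0) (d v)) -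
            (\<Sum>x\<leftarrow>map (\<lambda>(u, v). (u, v \<oplus>\<^bsub>FD\<^esub> d v \<odot>\<^bsub>FD\<^esub> v0)) ys. Poly_Mapping.single x 1) \<in> TR"
          using Cons by (simp del: finite_dual_algebra_sel)
        show ?case
          using pm.subspace_diff[OF sub pm.subspace_diff[OF sub IH 1] 2]
          by (simp add: p algebra_simps del: finite_dual_algebra_sel)
      qed
      let ?ps = "map (\<lambda>(u, v). (d v, u)) ys"
      have u0_eq: "(\<lambda>h\<in>carrier H. \<Sum>(d, u)\<leftarrow>?ps. d * u h) = u0"
        using linear_functionalD(3)[OF dual_linear[OF u0]] dsum
        by (auto simp: fun_eq_iff extensional_def comp_def case_prod_unfold)
      have "set ?ps \<subseteq> UNIV \<times> carrier FD" using ys by auto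
      from tensor_collect_left[OF this v0]
      have "T - Poly_Mapping.single (u0, v0) 1 \<in> TR"
        unfolding u0_eq by (simp add: T_def comp_def case_prod_unfold)
      from pm.subspace_diff[OF sub pm.subspace_add[OF sub A Z] this]
      show ?thesis by (simp add: Cons x algebra_simps)
    qed
  qed
qed

text \<open>Coefficients are absorbed into the left factors. A list is used because the same pair
  may occur several times in a sum with unit coefficients.\<close>

lemma tensor_list_representative:
  assumes "Poly_Mapping.keys p \<subseteq> carrier FD \<times> carrier FD"
  shows "\<exists>xs. set xs \<subseteq> carrier FD \<times> carrier FD \<and> p - (\<Sum>x\<leftarrow>xs. Poly_Mapping.single x 1) \<in> TR"
  using assms
proof (induction p rule: poly_mapping_keys_induct)
  case zero
  show ?case
    using pm.subspace_0[OF subspace_tensor_relations] by (intro exI[of _ "[]"]) simp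
next
  case (single a c)
  obtain u v where a: "a = (u, v)" by (cases a)
  have u: "u \<in> carrier FD" and v: "v \<in> carrier FD" using single a by auto
  have "Poly_Mapping.single (u, v) c - Poly_Mapping.single (c \<odot>\<^bsub>FD\<^esub> u, v) 1 \<in> TR"
    using pm.subspace_neg[OF subspace_tensor_relations tensor_relations_base(3)[OF u v, of c]]
    by (simp del: finite_dual_algebra_sel)
  then show ?case
    using dual_smult_closed[OF u, of c] v
    by (intro exI[of _ "[(c \<odot>\<^bsub>FD\<^esub> u, v)]"]) (simp add: a del: finite_dual_algebra_sel)
next
  case (add p q)
  then obtain xs ys where "set xs \<subseteq> carrier FD \<times> carrier FD" "set ys \<subseteq> carrier FD \<times> carrier FD"
    and 1: "p - (\<Sum>x\<leftarrow>xs. Poly_Mapping.single x 1) \<in> TR" and 2: "q - (\<Sum>x\<leftarrow>ys. Poly_Mapping.single x 1) \<in> TR"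
    by blast
  then show ?case
    using pm.subspace_add[OF subspace_tensor_relations 1 2]
    by (intro exI[of _ "xs @ ys"]) (simp add: algebra_simps del: finite_dual_algebra_sel)
qed

lemma pm_eval_list: "pm_eval (case_prod \<phi>) (\<Sum>x\<leftarrow>xs. Poly_Mapping.single x 1) = (\<Sum>(u, v)\<leftarrow>xs. \<phi> u v)"
  by (induction xs) (auto simp: pm_eval_add)

text \<open>Converse of \<open>pm_eval_tensor_relations\<close> for the finite dual: evaluations at
  pairs of elements of \<open>H\<close> separate tensors. Passing to a list representative keeps the
  evaluations and reduces the claim to \<open>tensor_zeroI\<close>.\<close>

lemma tensor_relationsI:
  assumes "Poly_Mapping.keys p \<subseteq> carrier FD \<times> carrier FD"
    and "\<And>a b. a \<in> carrier H \<Longrightarrow> b \<in> carrier H \<Longrightarrow> pm_eval (case_prod (\<lambda>u v. u a * v b)) p = 0"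
  shows "p \<in> TR"
proof -
  obtain xs where xs: "set xs \<subseteq> carrier FD \<times> carrier FD" "p - (\<Sum>x\<leftarrow>xs. Poly_Mapping.single x 1) \<in> TR" (is "p - ?s \<in> TR")
    using tensor_list_representative[OF assms(1)] by blast
  have "(\<Sum>(u, v)\<leftarrow>xs. u a * v b) = 0" if "a \<in> carrier H" "b \<in> carrier H" for a b
    using pm_eval_tensor_relations[OF dual_evaluation_bilinear[OF that] xs(2)] assms(2)[OF that]
    by (simp add: pm_eval_diff pm_eval_list)
  then have "?s \<in> TR"
    by (rule tensor_zeroI[OF xs(1)])
  then show ?thesis
    using pm.subspace_add[OF subspace_tensor_relations xs(2), of ?s] by simp
qed

text \<open>This legitimates the definite description in \<open>finite_dual\<close>: a tensor exists
  by finite rank, and two of them differ by an element on which all evaluations vanish.\<close>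

lemma dual_comult_ex1:
  assumes "f \<in> carrier FD"
  shows "\<exists>!t. t \<in> carrier (tensor_algebra FD FD) \<and>
           (\<forall>a\<in>carrier H. \<forall>b\<in>carrier H. tensor_eval (\<lambda>u v. u a * v b) t = f (a \<otimes> b))"
proof -
  let ?\<pi> = "\<lambda>p. TR +>\<^bsub>free_pair_algebra FD FD\<^esub> p"
  have eval: "tensor_eval (\<lambda>u v. u a * v b) (?\<pi> p) = pm_eval (case_prod (\<lambda>u v. u a * v b)) p"
    if "a \<in> carrier H" "b \<in> carrier H" for a b p
    by (rule tensor_eval_coset[OF dual_evaluation_bilinear[OF that]])
  obtain xs where xs: "set xs \<subseteq> carrier FD \<times> carrier FD"
    "\<And>a b. a \<in> carrier H \<Longrightarrow> b \<in> carrier H \<Longrightarrow> f (a \<otimes> b) = (\<Sum>(u, v)\<leftarrow>xs. u a * v b)"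
    using dual_finite_rank[OF assms] by blast
  let ?p = "\<Sum>x\<leftarrow>xs. Poly_Mapping.single x (1 :: 'k)"
  have keys: "Poly_Mapping.keys ?p \<subseteq> carrier FD \<times> carrier FD"
    using xs(1)
  proof (induction xs)
    case (Cons x xs)
    then have "Poly_Mapping.keys (Poly_Mapping.single x (1 :: 'k)) \<subseteq> carrier FD \<times> carrier FD"
      by (simp add: keys_single del: finite_dual_algebra_sel)
    with Cons show ?case
      using Poly_Mapping.keys_add[of "Poly_Mapping.single x (1 :: 'k)" "\<Sum>x\<leftarrow>xs. Poly_Mapping.single x 1"]
      by (simp del: finite_dual_algebra_sel) blast
  qed simp
  show ?thesis
  proof (rule ex1I[of _ "?\<pi> ?p"])
    show "?\<pi> ?p \<in> carrier (tensor_algebra FD FD) \<and>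
        (\<forall>a\<in>carrier H. \<forall>b\<in>carrier H. tensor_eval (\<lambda>u v. u a * v b) (?\<pi> ?p) = f (a \<otimes> b))"
      using keys by (simp add: eval pm_eval_list xs(2) carrier_tensor_algebra del: finite_dual_algebra_sel)
    fix t assume t: "t \<in> carrier (tensor_algebra FD FD) \<and>
        (\<forall>a\<in>carrier H. \<forall>b\<in>carrier H. tensor_eval (\<lambda>u v. u a * v b) t = f (a \<otimes> b))"
    then obtain q where q: "t = ?\<pi> q" "Poly_Mapping.keys q \<subseteq> carrier FD \<times> carrier FD"
      by (auto simp only: carrier_tensor_algebra)
    have "q - ?p \<in> TR"
    proof (rule tensor_relationsI)
      show "Poly_Mapping.keys (q - ?p) \<subseteq> carrier FD \<times> carrier FD"
        using keys_diff_subset[of q ?p] q(2) keys by blast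
      show "pm_eval (case_prod (\<lambda>u v. u a * v b)) (q - ?p) = 0" if "a \<in> carrier H" "b \<in> carrier H"
          for a b
        using t that eval[OF that, of q] by (simp add: pm_eval_diff pm_eval_list xs(2) q(1))
    qed
    then show "t = ?\<pi> ?p"
      by (simp only: q(1) tensor_coset_eq_iff)
  qed
qed

text \<open>The tensor f \<otimes> f evaluates to \<open>f a * f b\<close>, so by uniqueness it is
  the comultiplication of f exactly when f is multiplicative. The counit condition says that f is
  unital.\<close>

lemma group_likes_finite_dual: "carrier (group_likes (finite_dual H)) = alg_hom H ground_algebra"
proof -
  let ?Q = "\<lambda>f t. t \<in> carrier (tensor_algebra FD FD) \<and>
           (\<forall>a\<in>carrier H. \<forall>b\<in>carrier H. tensor_eval (\<lambda>u v. u a * v b) t = f (a \<otimes> b))"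
  have comult: "comult (finite_dual H) f = (THE t. ?Q f t)" for f
    by (simp add: finite_dual_def module.defs bialgebra.defs)
  have counit: "counit (finite_dual H) f = f \<one>" for f
    by (simp add: finite_dual_def module.defs bialgebra.defs)
  have pure_iff: "?Q f (pure_tensor FD FD f f) \<longleftrightarrow> (\<forall>a\<in>carrier H. \<forall>b\<in>carrier H. f (a \<otimes> b) = f a * f b)"
    if "f \<in> carrier FD" for f
    using pure_tensor_closed[OF that that]
    by (auto simp: tensor_eval_pure_tensor[OF dual_evaluation_bilinear] simp del: finite_dual_algebra_sel)
  have comult_iff: "comult (finite_dual H) f = pure_tensor FD FD f f \<longleftrightarrow>
      (\<forall>a\<in>carrier H. \<forall>b\<in>carrier H. f (a \<otimes> b) = f a * f b)" if f: "f \<in> carrier FD" for f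
  proof
    have "?Q f (comult (finite_dual H) f)"
      unfolding comult by (rule theI'[OF dual_comult_ex1[OF f]])
    moreover assume "comult (finite_dual H) f = pure_tensor FD FD f f"
    ultimately show "\<forall>a\<in>carrier H. \<forall>b\<in>carrier H. f (a \<otimes> b) = f a * f b"
      unfolding pure_iff[OF f, symmetric] by (rule back_subst)
  next
    assume "\<forall>a\<in>carrier H. \<forall>b\<in>carrier H. f (a \<otimes> b) = f a * f b"
    then have "?Q f (pure_tensor FD FD f f)"
      by (simp only: pure_iff[OF f])
    then show "comult (finite_dual H) f = pure_tensor FD FD f f"
      unfolding comult by (rule the1_equality[OF dual_comult_ex1[OF f]])
  qed
  \<comment> \<open>For a character the form f (a b) has rank at most one, witnessed by the pair (f,
    f) itself.\<close>
  have dual: "f \<in> carrier FD" if f: "f \<in> alg_hom H ground_algebra" for f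
  proof -
    have "f \<in> LF"
      by (rule linear_functionalI) (simp_all add: alg_homD[OF f])
    then show ?thesis
      by (intro finite_rank_dual[of f "[(f, f)]"]) (simp_all add: alg_homD[OF f])
  qed
  have "f \<in> carrier (group_likes (finite_dual H)) \<longleftrightarrow> f \<in> alg_hom H ground_algebra" for f
  proof
    assume "f \<in> carrier (group_likes (finite_dual H))"
    then have f: "f \<in> carrier FD"
        and *: "comult (finite_dual H) f = pure_tensor FD FD f f" "f \<one> = 1"
      by (simp_all add: group_likes_def finite_dual_sel pure_tensor_finite_dual counit)
    note lin = linear_functionalD[OF dual_linear[OF f]]
    show "f \<in> alg_hom H ground_algebra"
      using * comult_iff[OF f] by (intro alg_homI) (simp_all add: lin)
  next
    assume f: "f \<in> alg_hom H ground_algebra"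
    show "f \<in> carrier (group_likes (finite_dual H))"
      using dual[OF f] comult_iff[OF dual[OF f]]
      by (simp add: group_likes_def finite_dual_sel(1) pure_tensor_finite_dual counit alg_homD[OF f]
          del: finite_dual_algebra_sel)
  qed
  then show ?thesis by blast
qed

end

section \<open>Poisson endomorphisms\<close>

lemma (in structure_constants) alg_hom_bialgebra: "alg_hom UB B = alg_hom UA B"
  by (simp add: alg_hom_def ring_hom_def universal_bialgebra_sel)

locale poisson_basis = poisson_algebra scale pmult bracket + structure_constants n \<tau> \<mu>
  for scale :: "'k::field \<Rightarrow> 'p::ab_group_add \<Rightarrow> 'p" and pmult bracket
    and n and \<tau> \<mu> :: "nat \<Rightarrow> nat \<Rightarrow> nat \<Rightarrow> 'k" +
  fixes e :: "nat \<Rightarrow> 'p"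
  assumes basis: "indexed_basis scale n e"
    and pmult_basis: "\<And>i j. i \<in> {1..n} \<Longrightarrow> j \<in> {1..n} \<Longrightarrow> pmult (e i) (e j) = (\<Sum>s=1..n. scale (\<tau> i j s) (e s))"
    and bracket_basis: "\<And>i j. i \<in> {1..n} \<Longrightarrow> j \<in> {1..n} \<Longrightarrow> bracket (e i) (e j) = (\<Sum>s=1..n. scale (\<mu> i j s) (e s))"
begin

sublocale endo: vector_space_pair scale scale
  by unfold_locales

abbreviation "lin \<equiv> Vector_Spaces.linear scale scale"

lemma basis_inj: "inj_on e {1..n}"
  and basis_independent: "independent (e ` {1..n})"
  and basis_span: "span (e ` {1..n}) = UNIV"
  using basis by (simp_all add: indexed_basis_def)

lemma linear_eqI:
  assumes "lin f" "lin g" "\<And>i. i \<in> {1..n} \<Longrightarrow> f (e i) = g (e i)"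
  shows "f = g"
proof
  show "f v = g v" for v
    by (rule endo.linear_eq_on[OF assms(1,2), of v "e ` {1..n}"]) (use basis_span assms(3) in auto)
qed

text \<open>A linear map with prescribed values exists because the basis is independent and is
  unique because it spans; both are needed to evaluate the definite description.\<close>

lemma
  shows linear_linear_extension: "lin (linear_extension scale n e w)"
    and linear_extension_basis: "i \<in> {1..n} \<Longrightarrow> linear_extension scale n e w (e i) = w i"
proof -
  let ?Q = "\<lambda>g. lin g \<and> (\<forall>i\<in>{1..n}. g (e i) = w i)"
  \<comment> \<open>\<open>construct\<close> takes values indexed by basis vectors; injectivity of
    \<open>e\<close> recovers the index from the vector.\<close>
  let ?g = "endo.construct (e ` {1..n}) (\<lambda>v. w (the_inv_into {1..n} e v))"
  have Q: "?Q ?g"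
    using endo.linear_construct[OF basis_independent] endo.construct_basis[OF basis_independent]
    by (simp add: the_inv_into_f_f[OF basis_inj])
  have "\<exists>!g. ?Q g"
  proof (rule ex1I)
    show "?Q ?g" by (rule Q)
    show "g = ?g" if "?Q g" for g
      by (rule linear_eqI) (use that Q in auto)
  qed
  then have "?Q (linear_extension scale n e w)"
    unfolding linear_extension_def by (rule theI')
  then show "lin (linear_extension scale n e w)"
    and "i \<in> {1..n} \<Longrightarrow> linear_extension scale n e w (e i) = w i"
    by blast+
qed

lemma linearD:
  assumes "lin f"
  shows "f (x + y) = f x + f y" "f (scale c x) = scale c (f x)" "f (sum g S) = (\<Sum>i\<in>S. f (g i))"
proof -
  interpret f: Vector_Spaces.linear scale scale f by fact
  show "f (x + y) = f x + f y" "f (scale c x) = scale c (f x)" "f (sum g S) = (\<Sum>i\<in>S. f (g i))"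
    by (rule f.add f.scale f.sum)+
qed

lemma linearI: "(\<And>x y. f (x + y) = f x + f y) \<Longrightarrow> (\<And>c x. f (scale c x) = scale c (f x)) \<Longrightarrow> lin f"
  unfolding Vector_Spaces.linear_iff using vector_space_axioms by blast

lemma coordinates_unique:
  assumes "(\<Sum>i=1..n. scale (c i) (e i)) = (\<Sum>i=1..n. scale (d i) (e i))" "i \<in> {1..n}"
  shows "c i = d i"
proof -
  let ?inv = "the_inv_into {1..n} e"
  have "(\<Sum>v\<in>e ` {1..n}. scale (c (?inv v) - d (?inv v)) v) = (\<Sum>i=1..n. scale (c i - d i) (e i))"
    by (subst sum.reindex[OF basis_inj]) (simp add: the_inv_into_f_f[OF basis_inj])
  also have "\<dots> = 0"
    using assms(1) by (simp add: scale_left_diff_distrib sum_subtractf)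
  finally have "(\<Sum>v\<in>e ` {1..n}. scale (c (?inv v) - d (?inv v)) v) = 0" .
  moreover have "\<not> (\<exists>u. (\<exists>v\<in>e ` {1..n}. u v \<noteq> 0) \<and> (\<Sum>v\<in>e ` {1..n}. scale (u v) v) = 0)"
    using basis_independent dependent_finite[of "e ` {1..n}"] by blast
  ultimately have "c (?inv v) - d (?inv v) = 0" if "v \<in> e ` {1..n}" for v
    using that by (auto dest!: spec[of _ "\<lambda>v. c (?inv v) - d (?inv v)"])
  from this[of "e i"] show ?thesis
    using assms(2) by (simp add: the_inv_into_f_f[OF basis_inj])
qed

lemma coordinates_exist: "\<exists>c. v = (\<Sum>i=1..n. scale (c i) (e i))"
proof -
  have "v \<in> span (e ` {1..n})" by (simp add: basis_span)
  then obtain u where "v = (\<Sum>x\<in>e ` {1..n}. scale (u x) x)"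
    by (auto simp: span_finite)
  then show ?thesis
    by (intro exI[of _ "u \<circ> e"]) (simp add: sum.reindex[OF basis_inj])
qed

text \<open>By bilinearity an operation is respected as soon as it is on pairs of basis vectors, and
  there the coefficients of each \<open>e a\<close> on the two sides are the two sides of the
  relation. The operation is generic, so the product and the bracket are both covered.\<close>

lemma preserves_iff_compatible:
  assumes left: "\<And>y. lin (\<lambda>x. bop x y)" and right: "\<And>x. lin (\<lambda>y. bop x y)"
    and \<sigma>: "\<And>i j. i \<in> {1..n} \<Longrightarrow> j \<in> {1..n} \<Longrightarrow> bop (e i) (e j) = (\<Sum>s=1..n. scale (\<sigma> i j s) (e s))"
    and g: "lin g" and M: "\<And>i. i \<in> {1..n} \<Longrightarrow> g (e i) = (\<Sum>s=1..n. scale (M s i) (e s))"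
  shows "(\<forall>x y. g (bop x y) = bop (g x) (g y)) \<longleftrightarrow> structure_compatible ground_algebra n \<sigma> M"
proof -
  note ldist = linearD[OF left] and rdist = linearD[OF right] and gdist = linearD[OF g]
  have ext: "(\<forall>x y. g (bop x y) = bop (g x) (g y)) \<longleftrightarrow>
      (\<forall>i\<in>{1..n}. \<forall>j\<in>{1..n}. g (bop (e i) (e j)) = bop (g (e i)) (g (e j)))"
  proof (intro iffI allI)
    fix x y assume *: "\<forall>i\<in>{1..n}. \<forall>j\<in>{1..n}. g (bop (e i) (e j)) = bop (g (e i)) (g (e j))"
    \<comment> \<open>The identity is extended one argument at a time: first to all \<open>x\<close>
      with a basis vector on the right, then to all \<open>y\<close>.\<close>
    have "(\<lambda>x. g (bop x (e j))) = (\<lambda>x. bop (g x) (g (e j)))" if "j \<in> {1..n}" for j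
      by (rule linear_eqI) (use * that in \<open>auto intro!: linearI simp: ldist gdist\<close>)
    then have "g (bop x (e j)) = bop (g x) (g (e j))" if "j \<in> {1..n}" for j
      using that by (simp add: fun_eq_iff)
    then have "(\<lambda>y. g (bop x y)) = (\<lambda>y. bop (g x) (g y))"
      by (intro linear_eqI) (auto intro!: linearI simp: rdist gdist)
    then show "g (bop x y) = bop (g x) (g y)" by (simp add: fun_eq_iff)
  qed blast
  have lhs: "g (bop (e i) (e j)) = (\<Sum>a=1..n. scale (\<Sum>u=1..n. \<sigma> i j u * M a u) (e a))"
    if "i \<in> {1..n}" "j \<in> {1..n}" for i j
  proof -
    have "g (bop (e i) (e j)) = (\<Sum>u=1..n. \<Sum>a=1..n. scale (\<sigma> i j u * M a u) (e a))"
      by (simp add: \<sigma>[OF that] gdist M scale_sum_right cong: sum.cong_simp)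
    also have "\<dots> = (\<Sum>a=1..n. \<Sum>u=1..n. scale (\<sigma> i j u * M a u) (e a))"
      by (rule sum.swap)
    finally show ?thesis by (simp add: scale_sum_left)
  qed
  have rhs: "bop (g (e i)) (g (e j)) = (\<Sum>a=1..n. scale (\<Sum>s=1..n. \<Sum>t=1..n. \<sigma> s t a * (M s i * M t j)) (e a))"
    if "i \<in> {1..n}" "j \<in> {1..n}" for i j
  proof -
    have "bop (g (e i)) (g (e j)) = (\<Sum>s=1..n. scale (M s i) (bop (e s) (g (e j))))"
      by (simp only: M[OF that(1)] ldist)
    also have "\<dots> = (\<Sum>s=1..n. \<Sum>t=1..n. scale (M s i) (scale (M t j) (bop (e s) (e t))))"
      by (simp only: M[OF that(2)] rdist scale_sum_right)
    also have "\<dots> = (\<Sum>s=1..n. \<Sum>t=1..n. \<Sum>a=1..n. scale (\<sigma> s t a * (M s i * M t j)) (e a))"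
      by (intro sum.cong refl) (simp add: \<sigma> scale_sum_right mult.commute mult.left_commute)
    also have "\<dots> = (\<Sum>s=1..n. \<Sum>a=1..n. \<Sum>t=1..n. scale (\<sigma> s t a * (M s i * M t j)) (e a))"
      by (intro sum.cong refl sum.swap)
    also have "\<dots> = (\<Sum>a=1..n. \<Sum>s=1..n. \<Sum>t=1..n. scale (\<sigma> s t a * (M s i * M t j)) (e a))"
      by (rule sum.swap)
    finally show ?thesis by (simp add: scale_sum_left)
  qed
  have "g (bop (e i) (e j)) = bop (g (e i)) (g (e j)) \<longleftrightarrow>
      (\<forall>a\<in>{1..n}. (\<Sum>u=1..n. \<sigma> i j u * M a u) = (\<Sum>s=1..n. \<Sum>t=1..n. \<sigma> s t a * (M s i * M t j)))"
    (is "?L \<longleftrightarrow> (\<forall>a\<in>{1..n}. ?c a = ?d a)")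
    if ij: "i \<in> {1..n}" "j \<in> {1..n}" for i j
  proof
    assume ?L
    then have "(\<Sum>a=1..n. scale (?c a) (e a)) = (\<Sum>a=1..n. scale (?d a) (e a))"
      by (simp only: lhs[OF ij] rhs[OF ij])
    then show "\<forall>a\<in>{1..n}. ?c a = ?d a"
      by (intro ballI) (rule coordinates_unique)
  next
    assume "\<forall>a\<in>{1..n}. ?c a = ?d a"
    then show ?L
      unfolding lhs[OF ij] rhs[OF ij] by (intro sum.cong refl) simp
  qed
  then show ?thesis
    unfolding ext structure_compatible_ground by blast
qed

section \<open>The correspondence between characters and Poisson endomorphisms\<close>

abbreviation "\<gamma> \<equiv> gamma_bar scale n e \<tau> \<mu>"
abbreviation "characters \<equiv> alg_hom UA (ground_algebra :: ('k, 'k) module)"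
abbreviation "convolve f g \<equiv> \<lambda>h\<in>carrier UA. tensor_eval (\<lambda>a b. f a * g b) (comult UB h)"

text \<open>Bijectivity is left out on purpose: this set is the image of all characters under
  \<open>\<gamma>\<close>, and invertibility is imposed on both sides only in
  \<open>gamma_iso\<close>.\<close>

definition endomorphisms :: "('p \<Rightarrow> 'p) set" where
  "endomorphisms = {g. lin g \<and> (\<forall>x y. g (pmult x y) = pmult (g x) (g y)) \<and>
     (\<forall>x y. g (bracket x y) = bracket (g x) (g y))}"

lemma linear_gamma: "lin (\<gamma> f)"
  unfolding gamma_bar_def by (rule linear_linear_extension)

lemma gamma_basis: "i \<in> {1..n} \<Longrightarrow> \<gamma> f (e i) = (\<Sum>s=1..n. scale (f (X s i)) (e s))"
  unfolding gamma_bar_def by (rule linear_extension_basis)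

lemma endomorphism_iff:
  assumes "lin g" "\<And>i. i \<in> {1..n} \<Longrightarrow> g (e i) = (\<Sum>s=1..n. scale (M s i) (e s))"
  shows "g \<in> endomorphisms \<longleftrightarrow>
    structure_compatible ground_algebra n \<tau> M \<and> structure_compatible ground_algebra n \<mu> M"
  using preserves_iff_compatible[OF pmult_linear_left pmult_linear_right pmult_basis assms]
    preserves_iff_compatible[OF bracket_linear_left bracket_linear_right bracket_basis assms] assms(1)
  unfolding endomorphisms_def by blast

lemma gamma_endomorphism:
  assumes "f \<in> characters"
  shows "\<gamma> f \<in> endomorphisms"
  using structure_compatible_hom[OF UA.comm_algebra_axioms comm_algebra_ground assms gen_closed gen_compatible(1)]
    structure_compatible_hom[OF UA.comm_algebra_axioms comm_algebra_ground assms gen_closed gen_compatible(2)]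
    endomorphism_iff[OF linear_gamma gamma_basis] by blast

text \<open>The coordinates of the images of the basis vectors are the values on the generators, and
  these determine a character.\<close>

lemma gamma_inj: "inj_on \<gamma> characters"
proof (rule inj_onI)
  fix f g assume f: "f \<in> characters" and g: "g \<in> characters" and eq: "\<gamma> f = \<gamma> g"
  show "f = g"
  proof (rule universal_hom_eqI[OF comm_algebra_ground f g])
    fix s i assume s: "s \<in> {1..n}" and i: "i \<in> {1..n}"
    show "f (X s i) = g (X s i)"
      by (rule coordinates_unique[OF _ s]) (simp only: gamma_basis[OF i, symmetric] eq)
  qed
qed

text \<open>The matrix of an endomorphism is a scalar solution of the defining relations, so the
  universal property provides a character with these values.\<close>

lemma gamma_surj:
  assumes g: "g \<in> endomorphisms"
  shows "\<exists>f\<in>characters. \<gamma> f = g"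
proof -
  have lin: "lin g" using g by (simp add: endomorphisms_def)
  have "\<exists>M. \<forall>i. g (e i) = (\<Sum>s=1..n. scale (M i s) (e s))"
    by (rule choice) (use coordinates_exist in blast)
  then obtain M where M: "\<And>i. g (e i) = (\<Sum>s=1..n. scale (M i s) (e s))" by blast
  \<comment> \<open>The chosen coordinates carry the index of the argument first, whereas the
    generator for (s, i) has it second; hence the transposed matrix.\<close>
  have comp: "structure_compatible ground_algebra n \<tau> (\<lambda>s i. M i s)"
    "structure_compatible ground_algebra n \<mu> (\<lambda>s i. M i s)"
    using endomorphism_iff[OF lin, of "\<lambda>s i. M i s"] M g by blast+
  obtain f where f: "f \<in> characters" "\<And>s i. s \<in> {1..n} \<Longrightarrow> i \<in> {1..n} \<Longrightarrow> f (X s i) = M i s"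
    by (rule universal_hom_exists[OF comm_algebra_ground _ comp]) (simp, rule that)
  have "\<gamma> f = g"
    by (rule linear_eqI[OF linear_gamma lin]) (simp add: gamma_basis M f(2))
  with f(1) show ?thesis by blast
qed

text \<open>The columns of the matrix are the images of the basis vectors, so the matrix product
  coming from \<Delta> is composition in the same order. This is why \<open>\<gamma>\<close> is a
  homomorphism and not an antihomomorphism.\<close>

lemma gamma_convolve:
  assumes f: "f \<in> characters" and g: "g \<in> characters"
  shows "\<gamma> (convolve f g) = \<gamma> f \<circ> \<gamma> g"
proof (rule linear_eqI[OF linear_gamma])
  show "lin (\<gamma> f \<circ> \<gamma> g)"
    by (rule linearI) (simp_all add: linearD[OF linear_gamma])
  fix j assume j: "j \<in> {1..n}"
  have "(\<gamma> f \<circ> \<gamma> g) (e j) = (\<Sum>s=1..n. scale (g (X s j)) (\<Sum>i=1..n. scale (f (X i s)) (e i)))"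
    using j by (simp add: gamma_basis linearD[OF linear_gamma] cong: sum.cong_simp)
  also have "\<dots> = (\<Sum>s=1..n. \<Sum>i=1..n. scale (f (X i s) * g (X s j)) (e i))"
    by (simp add: scale_sum_right mult.commute)
  also have "\<dots> = (\<Sum>i=1..n. \<Sum>s=1..n. scale (f (X i s) * g (X s j)) (e i))"
    by (rule sum.swap)
  also have "\<dots> = (\<Sum>i=1..n. scale (convolve f g (X i j)) (e i))"
    by (intro sum.cong refl) (simp only: convolution_gen[OF f g _ j] scale_sum_left)
  also have "\<dots> = \<gamma> (convolve f g) (e j)"
    by (rule gamma_basis[OF j, symmetric])
  finally show "\<gamma> (convolve f g) (e j) = (\<gamma> f \<circ> \<gamma> g) (e j)" by (rule sym)
qed

lemma gamma_counit: "\<gamma> (counit UB) = id"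
proof (rule linear_eqI[OF linear_gamma])
  show "lin id" by (rule linearI) simp_all
  fix i assume i: "i \<in> {1..n}"
  have "\<gamma> (counit UB) (e i) = (\<Sum>s=1..n. scale (counit UB (X s i)) (e s))"
    by (rule gamma_basis[OF i])
  also have "\<dots> = (\<Sum>s=1..n. if s = i then e s else 0)"
    by (intro sum.cong refl) (simp add: counit_gen[OF _ i])
  finally show "\<gamma> (counit UB) (e i) = id (e i)"
    using i by simp
qed

section \<open>The two groups and the isomorphism\<close>

abbreviation "GL \<equiv> group_likes (finite_dual UB)"
abbreviation "Aut \<equiv> poisson_aut_group scale pmult bracket"

sublocale UBr: bialgebra_record UB
  by (rule bialgebra_record.intro) (rule UB.comm_algebra_axioms)

lemma group_likes_sel:
  "carrier GL = characters" "f \<otimes>\<^bsub>GL\<^esub> g = convolve f g" "\<one>\<^bsub>GL\<^esub> = counit UB"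
proof -
  show "carrier GL = characters"
    using UBr.group_likes_finite_dual by (simp only: alg_hom_bialgebra)
  show "f \<otimes>\<^bsub>GL\<^esub> g = convolve f g"
    by (simp add: group_likes_def finite_dual_sel finite_dual_algebra_def universal_bialgebra_sel)
  show "\<one>\<^bsub>GL\<^esub> = counit UB"
    using alg_homD(6)[OF counit_hom]
    by (simp add: group_likes_def finite_dual_sel finite_dual_algebra_def universal_bialgebra_sel extensional_restrict)
qed

text \<open>\<open>\<gamma>\<close> is injective and takes convolution to composition and the counit
  to the identity, so associativity and the unit laws are inherited from functions.\<close>

lemma monoid_group_likes: "monoid GL"
proof (rule monoidI; simp only: group_likes_sel)
  show closed: "convolve f g \<in> characters" if "f \<in> characters" "g \<in> characters" for f g
    by (rule convolution_hom[OF that])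
  show "counit UB \<in> characters" by (rule counit_hom)
  show "convolve (convolve f g) h = convolve f (convolve g h)"
    if "f \<in> characters" "g \<in> characters" "h \<in> characters" for f g h
    by (rule inj_onD[OF gamma_inj]) (simp_all only: gamma_convolve closed that comp_assoc)
  show "convolve (counit UB) f = f" "convolve f (counit UB) = f" if "f \<in> characters" for f
    by (rule inj_onD[OF gamma_inj]; simp only: gamma_convolve closed that counit_hom gamma_counit id_comp comp_id)+
qed

lemma carrier_Aut: "carrier Aut = {g \<in> endomorphisms. bij g}"
  by (auto simp: poisson_aut_group_def endomorphisms_def)

lemma inverse_automorphism:
  assumes "g \<in> carrier Aut"
  shows "inv_into UNIV g \<in> carrier Aut"
proof -
  have g: "lin g" "bij g" "\<And>x y. g (pmult x y) = pmult (g x) (g y)" "\<And>x y. g (bracket x y) = bracket (g x) (g y)"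
    using assms by (auto simp: carrier_Aut endomorphisms_def)
  let ?h = "inv_into UNIV g"
  have gh: "g (?h x) = x" for x by (rule surj_f_inv_f[OF bij_is_surj[OF g(2)]])
  \<comment> \<open>Each identity for the inverse map is verified after applying \<open>g\<close> to
    both sides.\<close>
  have eqI: "x = y" if "g x = g y" for x y using that bij_is_inj[OF g(2)] by (simp add: inj_eq)
  have "lin ?h"
    by (rule linearI; rule eqI) (simp_all add: gh linearD[OF g(1)])
  moreover have "?h (pmult x y) = pmult (?h x) (?h y)" for x y
    by (rule eqI) (simp add: gh g(3))
  moreover have "?h (bracket x y) = bracket (?h x) (?h y)" for x y
    by (rule eqI) (simp add: gh g(4))
  ultimately show ?thesis
    using bij_imp_bij_inv[OF g(2)] by (simp add: carrier_Aut endomorphisms_def)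
qed

lemma group_Aut: "group Aut"
proof (rule groupI)
  show "\<exists>h\<in>carrier Aut. h \<otimes>\<^bsub>Aut\<^esub> g = \<one>\<^bsub>Aut\<^esub>" if "g \<in> carrier Aut" for g
    using inverse_automorphism[OF that] that
    by (intro bexI[of _ "inv_into UNIV g"]) (auto simp: carrier_Aut poisson_aut_group_def bij_is_inj)
qed (auto simp: poisson_aut_group_def linearD intro!: linearI bij_comp)

text \<open>An isomorphism of monoids matches invertible elements. Among Poisson endomorphisms these
  are the bijective ones, because the inverse map of a bijective endomorphism is again one.\<close>

lemma gamma_iso: "\<gamma> \<in> iso (units_of GL) Aut"
proof -
  interpret GL: monoid GL by (rule monoid_group_likes)
  have mult: "\<gamma> (f \<otimes>\<^bsub>GL\<^esub> g) = \<gamma> f \<circ> \<gamma> g" if "f \<in> carrier GL" "g \<in> carrier GL" for f g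
    using that by (simp only: group_likes_sel gamma_convolve)
  have one: "\<gamma> \<one>\<^bsub>GL\<^esub> = id"
    by (simp only: group_likes_sel gamma_counit)
  have inj: "inj_on \<gamma> (carrier GL)"
    by (simp only: group_likes_sel gamma_inj)
  have to_Aut: "\<gamma> f \<in> carrier Aut" if f: "f \<in> Units GL" for f
  proof -
    have c: "f \<in> carrier GL" using f by (rule GL.Units_closed)
    obtain g where g: "g \<in> carrier GL" "g \<otimes>\<^bsub>GL\<^esub> f = \<one>\<^bsub>GL\<^esub>" "f \<otimes>\<^bsub>GL\<^esub> g = \<one>\<^bsub>GL\<^esub>"
      using f by (auto simp: Units_def)
    have "bij (\<gamma> f)"
    proof (rule o_bij)
      show "\<gamma> g \<circ> \<gamma> f = id" using mult[OF g(1) c] by (simp only: g(2) one)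
      show "\<gamma> f \<circ> \<gamma> g = id" using mult[OF c g(1)] by (simp only: g(3) one)
    qed
    then show ?thesis
      using gamma_endomorphism c by (simp add: carrier_Aut group_likes_sel(1))
  qed
  have onto: "\<exists>f\<in>Units GL. \<gamma> f = h" if h: "h \<in> carrier Aut" for h
  proof -
    let ?k = "inv_into UNIV h"
    obtain f where f: "f \<in> carrier GL" "\<gamma> f = h"
      using gamma_surj[of h] h by (auto simp: carrier_Aut group_likes_sel(1))
    \<comment> \<open>The inverse of \<open>h\<close> also comes from a character; injectivity of
      \<open>\<gamma>\<close> turns the two composition identities into the statement that this
      character inverts \<open>f\<close>.\<close>
    obtain g where g: "g \<in> carrier GL" "\<gamma> g = ?k"
      using gamma_surj[of ?k] inverse_automorphism[OF h] by (auto simp: carrier_Aut group_likes_sel(1))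
    have "bij h" using h by (simp add: carrier_Aut)
    then have "h \<circ> ?k = id" "?k \<circ> h = id"
      by (simp_all add: bij_is_inj bij_is_surj flip: surj_iff inj_iff)
    then have "f \<otimes>\<^bsub>GL\<^esub> g = \<one>\<^bsub>GL\<^esub>" "g \<otimes>\<^bsub>GL\<^esub> f = \<one>\<^bsub>GL\<^esub>"
      using f g by (auto intro!: inj_onD[OF inj] simp: mult one)
    with f g show ?thesis by (auto simp: Units_def)
  qed
  show ?thesis
  proof (rule isoI)
    show "\<gamma> \<in> hom (units_of GL) Aut"
      by (rule homI)
        (auto simp: units_of_carrier units_of_mult mult GL.Units_closed to_Aut, simp add: poisson_aut_group_def)
    show "bij_betw \<gamma> (carrier (units_of GL)) (carrier Aut)"
      unfolding bij_betw_def units_of_carrier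
      using inj_on_subset[OF inj] GL.Units_closed to_Aut onto by blast
  qed
qed

end

theorem theorem3p6:
  fixes scale :: "'k::field \<Rightarrow> 'p::ab_group_add \<Rightarrow> 'p"
    and pmult bracket :: "'p \<Rightarrow> 'p \<Rightarrow> 'p"
    and n :: nat and e :: "nat \<Rightarrow> 'p"
    and \<tau> \<mu> :: "nat \<Rightarrow> nat \<Rightarrow> nat \<Rightarrow> 'k"
  assumes "poisson_algebra scale pmult bracket"
    and "indexed_basis scale n e"
    and "\<And>i j. i \<in> {1..n} \<Longrightarrow> j \<in> {1..n} \<Longrightarrow> pmult (e i) (e j) = (\<Sum>s=1..n. scale (\<tau> i j s) (e s))"
    and "\<And>i j. i \<in> {1..n} \<Longrightarrow> j \<in> {1..n} \<Longrightarrow> bracket (e i) (e j) = (\<Sum>s=1..n. scale (\<mu> i j s) (e s))"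
  shows "group (invertible_group_likes n \<tau> \<mu>) \<and>
         group (poisson_aut_group scale pmult bracket) \<and>
         gamma_bar scale n e \<tau> \<mu> \<in> iso (invertible_group_likes n \<tau> \<mu>) (poisson_aut_group scale pmult bracket)"
proof -
  interpret poisson_basis scale pmult bracket n \<tau> \<mu> e
    by (intro poisson_basis.intro poisson_basis_axioms.intro assms)
  show ?thesis
    unfolding invertible_group_likes_def
    using monoid.units_group[OF monoid_group_likes] group_Aut gamma_iso by blast
qed

end
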